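(* Let $V$ be a finite-dimensional vector space over $k$, let $\mathfrak g\subset\mathfrak{gl}_k(V)$ be a Lie subalgebra with radical $\mathfrak r\subset\mathfrak g$, let $\mathfrak h$ be a Cartan subalgebra of $\mathfrak{sl}_k(V)\subset\mathfrak{gl}_k(V)$, and assume that $\mathfrak h\subset\mathfrak g$. Let $0=V_{r+1}\subset V_r\subset\cdots\subset V_1\subset V_0=V$ be a composition series of $V$ as $\mathfrak g$-module, and let $n_i=\dim_kV_i/V_{i+1}$, $i=0,1,\dots,r$, be the dimensions of the simple subquotients. Let $F$ be the set of indices $f\in\{0,\dots,r\}$ such that $n_f\ge 2$. Then $$\mathfrak g\cong\mathfrak r\rtimes\bigoplus_{f\in F}\mathfrak{sl}_{n_f}.$$
   Context: $k$ is an algebraically closed field of characteristic $0$. *)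

theory Defs
  imports "HOL-Algebra.AbelCoset" "Jordan_Normal_Form.VS_Connect" "HOL-Computational_Algebra.Polynomial"
begin

section \<open>Lie algebras\<close>

text \<open>
  Lie algebras over the field given by a type \<open>'k::field\<close>, with an explicit carrier. They extend
  the vector spaces (records of type \<open>module\<close> over \<open>class_ring\<close>) of the library by a bracket. The
  ring multiplication and unit that these records also carry play no role and are left
  \<open>undefined\<close>.
\<close>

record ('k, 'a) lie_algebra = "('k, 'a) module" +
  bracket :: "'a \<Rightarrow> 'a \<Rightarrow> 'a"

locale lie_algebra = vectorspace class_ring L
  for L :: "('k::field, 'a, 'm) lie_algebra_scheme" (structure) +
  assumes bracket_closed:
      "\<lbrakk>x \<in> carrier L; y \<in> carrier L\<rbrakk> \<Longrightarrow> bracket L x y \<in> carrier L"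
    and bracket_add_left:
      "\<lbrakk>x \<in> carrier L; y \<in> carrier L; z \<in> carrier L\<rbrakk>
        \<Longrightarrow> bracket L (x \<oplus> y) z = bracket L x z \<oplus> bracket L y z"
    and bracket_add_right:
      "\<lbrakk>x \<in> carrier L; y \<in> carrier L; z \<in> carrier L\<rbrakk>
        \<Longrightarrow> bracket L x (y \<oplus> z) = bracket L x y \<oplus> bracket L x z"
    and bracket_smult_left:
      "\<lbrakk>x \<in> carrier L; y \<in> carrier L\<rbrakk> \<Longrightarrow> bracket L (c \<odot>\<^bsub>L\<^esub> x) y = c \<odot>\<^bsub>L\<^esub> bracket L x y"
    and bracket_smult_right:
      "\<lbrakk>x \<in> carrier L; y \<in> carrier L\<rbrakk> \<Longrightarrow> bracket L x (c \<odot>\<^bsub>L\<^esub> y) = c \<odot>\<^bsub>L\<^esub> bracket L x y"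
    and bracket_self: "x \<in> carrier L \<Longrightarrow> bracket L x x = \<zero>"
    and jacobi:
      "\<lbrakk>x \<in> carrier L; y \<in> carrier L; z \<in> carrier L\<rbrakk>
        \<Longrightarrow> bracket L x (bracket L y z) \<oplus> bracket L y (bracket L z x)
              \<oplus> bracket L z (bracket L x y) = \<zero>"

definition lie_subalgebra :: "'a set \<Rightarrow> ('k::field, 'a, 'm) lie_algebra_scheme \<Rightarrow> bool" where
  "lie_subalgebra H L \<longleftrightarrow>
     subspace class_ring H L \<and> (\<forall>x\<in>H. \<forall>y\<in>H. bracket L x y \<in> H)"

definition lie_ideal :: "'a set \<Rightarrow> ('k::field, 'a, 'm) lie_algebra_scheme \<Rightarrow> bool" where
  "lie_ideal I L \<longleftrightarrow>
     subspace class_ring I L \<and> (\<forall>x\<in>carrier L. \<forall>y\<in>I. bracket L x y \<in> I)"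

definition bracket_span ::
    "('k::field, 'a, 'm) lie_algebra_scheme \<Rightarrow> 'a set \<Rightarrow> 'a set \<Rightarrow> 'a set" where
  "bracket_span L A B =
     LinearCombinations.module.span class_ring L {bracket L x y | x y. x \<in> A \<and> y \<in> B}"

primrec derived_series :: "('k::field, 'a, 'm) lie_algebra_scheme \<Rightarrow> nat \<Rightarrow> 'a set" where
  "derived_series L 0 = carrier L"
| "derived_series L (Suc n) = bracket_span L (derived_series L n) (derived_series L n)"

primrec lower_central_series :: "('k::field, 'a, 'm) lie_algebra_scheme \<Rightarrow> nat \<Rightarrow> 'a set" where
  "lower_central_series L 0 = carrier L"
| "lower_central_series L (Suc n) = bracket_span L (carrier L) (lower_central_series L n)"

definition lie_solvable :: "('k::field, 'a, 'm) lie_algebra_scheme \<Rightarrow> bool" where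
  "lie_solvable L \<longleftrightarrow> (\<exists>n. derived_series L n = {\<zero>\<^bsub>L\<^esub>})"

definition lie_nilpotent :: "('k::field, 'a, 'm) lie_algebra_scheme \<Rightarrow> bool" where
  "lie_nilpotent L \<longleftrightarrow> (\<exists>n. lower_central_series L n = {\<zero>\<^bsub>L\<^esub>})"

definition lie_radical :: "'a set \<Rightarrow> ('k::field, 'a, 'm) lie_algebra_scheme \<Rightarrow> bool" where
  "lie_radical R L \<longleftrightarrow>
     lie_ideal R L \<and> lie_solvable (L\<lparr>carrier := R\<rparr>) \<and>
     (\<forall>I. lie_ideal I L \<and> lie_solvable (L\<lparr>carrier := I\<rparr>) \<longrightarrow> I \<subseteq> R)"

definition lie_normalizer :: "('k::field, 'a, 'm) lie_algebra_scheme \<Rightarrow> 'a set \<Rightarrow> 'a set" where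
  "lie_normalizer L H = {x \<in> carrier L. \<forall>y\<in>H. bracket L x y \<in> H}"

definition cartan_subalgebra :: "'a set \<Rightarrow> ('k::field, 'a, 'm) lie_algebra_scheme \<Rightarrow> bool" where
  "cartan_subalgebra H L \<longleftrightarrow>
     lie_subalgebra H L \<and> lie_nilpotent (L\<lparr>carrier := H\<rparr>) \<and> lie_normalizer L H = H"

definition lie_isomorphic ::
    "('k::field, 'a, 'm) lie_algebra_scheme \<Rightarrow> ('k, 'b, 'n) lie_algebra_scheme \<Rightarrow> bool" where
  "lie_isomorphic L M \<longleftrightarrow>
     (\<exists>\<phi> \<in> LinearCombinations.module_hom class_ring L M.
        bij_betw \<phi> (carrier L) (carrier M) \<and>
        (\<forall>x\<in>carrier L. \<forall>y\<in>carrier L. \<phi> (bracket L x y) = bracket M (\<phi> x) (\<phi> y)))"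


subsection \<open>Direct sums and semidirect products\<close>

text \<open>The index set \<open>I\<close> is meant to be finite; otherwise this is the direct product.\<close>

definition lie_direct_sum ::
    "'i set \<Rightarrow> ('i \<Rightarrow> ('k::field, 'a, 'm) lie_algebra_scheme) \<Rightarrow> ('k, 'i \<Rightarrow> 'a) lie_algebra" where
  "lie_direct_sum I L =
     \<lparr>carrier = (\<Pi>\<^sub>E i\<in>I. carrier (L i)),
      monoid.mult = undefined, one = undefined,
      zero = (\<lambda>i\<in>I. \<zero>\<^bsub>L i\<^esub>),
      add = (\<lambda>x y. \<lambda>i\<in>I. x i \<oplus>\<^bsub>L i\<^esub> y i),
      smult = (\<lambda>c x. \<lambda>i\<in>I. c \<odot>\<^bsub>L i\<^esub> x i),
      bracket = (\<lambda>x y. \<lambda>i\<in>I. bracket (L i) (x i) (y i))\<rparr>"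

definition lie_derivation :: "('k::field, 'a, 'm) lie_algebra_scheme \<Rightarrow> ('a \<Rightarrow> 'a) \<Rightarrow> bool" where
  "lie_derivation L D \<longleftrightarrow>
     D \<in> LinearCombinations.module_hom class_ring L L \<and>
     (\<forall>x\<in>carrier L. \<forall>y\<in>carrier L.
        D (bracket L x y) = bracket L (D x) y \<oplus>\<^bsub>L\<^esub> bracket L x (D y))"

text \<open>\<open>\<theta>\<close> is a homomorphism of Lie algebras from \<open>S\<close> to the derivations of \<open>R\<close>.\<close>

definition lie_derivation_action ::
    "('k::field, 'b, 'n) lie_algebra_scheme \<Rightarrow> ('k, 'a, 'm) lie_algebra_scheme
      \<Rightarrow> ('b \<Rightarrow> 'a \<Rightarrow> 'a) \<Rightarrow> bool" where
  "lie_derivation_action S R \<theta> \<longleftrightarrow>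
     (\<forall>s\<in>carrier S. lie_derivation R (\<theta> s)) \<and>
     (\<forall>s\<in>carrier S. \<forall>t\<in>carrier S. \<forall>x\<in>carrier R.
        \<theta> (s \<oplus>\<^bsub>S\<^esub> t) x = \<theta> s x \<oplus>\<^bsub>R\<^esub> \<theta> t x) \<and>
     (\<forall>c. \<forall>s\<in>carrier S. \<forall>x\<in>carrier R. \<theta> (c \<odot>\<^bsub>S\<^esub> s) x = c \<odot>\<^bsub>R\<^esub> \<theta> s x) \<and>
     (\<forall>s\<in>carrier S. \<forall>t\<in>carrier S. \<forall>x\<in>carrier R.
        \<theta> (bracket S s t) x = \<theta> s (\<theta> t x) \<ominus>\<^bsub>R\<^esub> \<theta> t (\<theta> s x))"

definition lie_semidirect ::
    "('k::field, 'a, 'm) lie_algebra_scheme \<Rightarrow> ('k, 'b, 'n) lie_algebra_scheme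
      \<Rightarrow> ('b \<Rightarrow> 'a \<Rightarrow> 'a) \<Rightarrow> ('k, 'a \<times> 'b) lie_algebra" where
  "lie_semidirect R S \<theta> =
     \<lparr>carrier = carrier R \<times> carrier S,
      monoid.mult = undefined, one = undefined,
      zero = (\<zero>\<^bsub>R\<^esub>, \<zero>\<^bsub>S\<^esub>),
      add = (\<lambda>(x, s) (y, t). (x \<oplus>\<^bsub>R\<^esub> y, s \<oplus>\<^bsub>S\<^esub> t)),
      smult = (\<lambda>c (x, s). (c \<odot>\<^bsub>R\<^esub> x, c \<odot>\<^bsub>S\<^esub> s)),
      bracket = (\<lambda>(x, s) (y, t).
        (bracket R x y \<oplus>\<^bsub>R\<^esub> \<theta> s y \<ominus>\<^bsub>R\<^esub> \<theta> t x, bracket S s t))\<rparr>"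


subsection \<open>The Lie algebras of endomorphisms and of matrices\<close>

definition lie_gl :: "('k::field \<Rightarrow> 'v::ab_group_add \<Rightarrow> 'v) \<Rightarrow> ('k, 'v \<Rightarrow> 'v) lie_algebra" where
  "lie_gl scale =
     \<lparr>carrier = {f. Vector_Spaces.linear scale scale f},
      monoid.mult = undefined, one = undefined,
      zero = (\<lambda>v. 0),
      add = (\<lambda>f g v. f v + g v),
      smult = (\<lambda>c f v. scale c (f v)),
      bracket = (\<lambda>f g v. f (g v) - g (f v))\<rparr>"

text \<open>The trace is computed in the basis \<open>B\<close>; see \<open>endo_trace_basis_independent\<close> below.\<close>

definition endo_trace ::
    "('k::field \<Rightarrow> 'v::ab_group_add \<Rightarrow> 'v) \<Rightarrow> 'v set \<Rightarrow> ('v \<Rightarrow> 'v) \<Rightarrow> 'k" where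
  "endo_trace scale B f = (\<Sum>b\<in>B. Modules.module.representation scale B (f b) b)"

definition lie_sl ::
    "('k::field \<Rightarrow> 'v::ab_group_add \<Rightarrow> 'v) \<Rightarrow> 'v set \<Rightarrow> ('k, 'v \<Rightarrow> 'v) lie_algebra" where
  "lie_sl scale B =
     (lie_gl scale)\<lparr>carrier := {f \<in> carrier (lie_gl scale). endo_trace scale B f = 0}\<rparr>"

definition mat_trace :: "'k::field mat \<Rightarrow> 'k" where
  "mat_trace A = (\<Sum>i<dim_row A. A $$ (i, i))"

definition lie_sl_mat :: "nat \<Rightarrow> ('k::field, 'k mat) lie_algebra" where
  "lie_sl_mat n =
     \<lparr>carrier = {A \<in> carrier_mat n n. mat_trace A = 0},
      monoid.mult = undefined, one = undefined,
      zero = 0\<^sub>m n n,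
      add = (+),
      smult = (\<cdot>\<^sub>m),
      bracket = (\<lambda>A B. A * B - B * A)\<rparr>"


subsection \<open>Consistency of the definitions\<close>

lemma class_field: "field (class_ring :: 'k::field ring)"
  by (rule class_field.field_axioms)

lemma lie_subalgebra_lie_algebra:
  assumes "lie_algebra L" "lie_subalgebra H L"
  shows "lie_algebra (L\<lparr>carrier := H\<rparr>)"
proof -
  interpret lie_algebra L by fact
  have sub: "subspace class_ring H L" and cl: "\<And>x y. x \<in> H \<Longrightarrow> y \<in> H
         \<Longrightarrow> bracket L x y \<in> H"
    using assms(2) by (auto simp: lie_subalgebra_def)
  have H: "x \<in> carrier L" if "x \<in> H" for x
    using sub that by (auto simp: VectorSpace.subspace_def submodule_def)
  have "vectorspace class_ring (L\<lparr>carrier := H\<rparr>)"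
    by (rule subspace_is_vs[OF sub])
  thus ?thesis
    by (intro lie_algebra.intro lie_algebra_axioms.intro)
       (simp_all add: H cl bracket_add_left bracket_add_right bracket_smult_left
          bracket_smult_right bracket_self jacobi)
qed

lemma lie_algebra_lie_gl:
  assumes "vector_space scale"
  shows "lie_algebra (lie_gl scale)"
proof -
  interpret vector_space_pair scale scale using assms by (simp add: vector_space_pair_def)
  have inv: "\<exists>g. Vector_Spaces.linear scale scale g \<and> (\<forall>v. f v + g v = 0)"
    if "Vector_Spaces.linear scale scale f" for f
    using linear_compose_neg[OF that] by (intro exI[of _ "\<lambda>v. - f v"]) simp
  have cmp: "Vector_Spaces.linear scale scale (\<lambda>v. f (g v))"
    if "Vector_Spaces.linear scale scale f" "Vector_Spaces.linear scale scale g" for f g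
    using Vector_Spaces.linear_compose[OF that(2,1)] by (simp add: o_def)
  have ab: "abelian_group (lie_gl scale)"
    by (rule abelian_groupI)
       (auto simp: lie_gl_def linear_compose_add linear_zero inv fun_eq_iff add_ac)
  have "Module.module class_ring (lie_gl scale)"
    by (rule moduleI[OF field.axioms(1)[THEN domain.axioms(1), OF class_field] ab])
       (auto simp: lie_gl_def linear_compose_scale_right vs1.scale_left_distrib vs1.scale_right_distrib)
  hence "vectorspace class_ring (lie_gl scale)"
    by (simp add: vectorspace_def class_field)
  thus ?thesis
    apply (intro lie_algebra.intro lie_algebra_axioms.intro)
    apply (auto simp add: lie_gl_def linear_compose_sub cmp linear_add linear_diff linear_scale
         vs1.scale_right_diff_distrib fun_eq_iff)
    done
qed

lemma lie_algebra_lie_sl_mat: "lie_algebra (lie_sl_mat n :: ('k::field, 'k mat) lie_algebra)"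
proof -
  have tr_comm: "mat_trace (A * B) = mat_trace (B * A)"
    if "A \<in> carrier_mat n n" "B \<in> carrier_mat n n" for A B :: "'k mat"
    using that sum.swap[of "\<lambda>i j. A $$ (i, j) * B $$ (j, i)" "{0..<n}" "{..<n}"]
    by (auto simp: mat_trace_def scalar_prod_def mult.commute atLeast0LessThan intro!: sum.cong)
  have tr_add: "mat_trace (A + B) = mat_trace A + mat_trace B"
    and tr_minus: "mat_trace (A - B) = mat_trace A - mat_trace B"
    and tr_smult: "mat_trace (c \<cdot>\<^sub>m A) = c * mat_trace A"
    if "A \<in> carrier_mat n n" "B \<in> carrier_mat n n" for A B :: "'k mat" and c
    using that by (simp_all add: mat_trace_def sum.distrib sum_subtractf sum_distrib_left)
  have inv: "\<exists>B. B \<in> carrier_mat n n \<and> mat_trace B = 0 \<and> A + B = 0\<^sub>m n n"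
    if "A \<in> carrier_mat n n" "mat_trace A = 0" for A :: "'k mat"
    using that by (intro exI[of _ "- A"]) (auto simp: mat_trace_def sum_negf intro!: eq_matI)
  have smult_minus: "c \<cdot>\<^sub>m (A - B) = c \<cdot>\<^sub>m A - c \<cdot>\<^sub>m B"
    if "A \<in> carrier_mat n n" "B \<in> carrier_mat n n" for A B :: "'k mat" and c
    using that by (intro eq_matI) (auto simp: algebra_simps)
  have cyclic: "a - b - (c - d) + (c - e - (f - b)) + (f - d - (a - e)) = 0\<^sub>m n n"
    if "a \<in> carrier_mat n n" "b \<in> carrier_mat n n" "c \<in> carrier_mat n n"
      "d \<in> carrier_mat n n" "e \<in> carrier_mat n n" "f \<in> carrier_mat n n"
    for a b c d e f :: "'k mat"
    using that by (intro eq_matI) auto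
  have ab: "abelian_group (lie_sl_mat n :: ('k, 'k mat) lie_algebra)"
    apply (rule abelian_groupI)
         apply (auto simp: lie_sl_mat_def tr_add comm_add_mat[of _ n n] assoc_add_mat[of _ n n] inv)
    apply (simp add: mat_trace_def)
    done
  have "Module.module class_ring (lie_sl_mat n :: ('k, 'k mat) lie_algebra)"
    apply (rule moduleI[OF field.axioms(1)[THEN domain.axioms(1), OF class_field] ab])
       apply (auto simp: lie_sl_mat_def tr_smult add_smult_distrib_left_mat[of _ n n]
         add_smult_distrib_right_mat[of _ n n])
    done
  hence "vectorspace class_ring (lie_sl_mat n :: ('k, 'k mat) lie_algebra)"
    by (simp add: vectorspace_def class_field)
  thus ?thesis
    apply (intro lie_algebra.intro lie_algebra_axioms.intro)
    apply (auto simp add: lie_sl_mat_def tr_comm tr_minus smult_minus cyclic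
        add_mult_distrib_mat[of _ n n] mult_add_distrib_mat[of _ n n]
        mult_smult_assoc_mat[of _ n n] mult_smult_distrib[of _ n n]
        assoc_mult_mat[of _ n n _ n _ n] minus_r_inv_mat[of _ n n]
        minus_mult_distrib_mat[of _ n n] mult_minus_distrib_mat[of _ n n _ n])
    done
qed

lemma endo_trace_basis_independent:
  assumes "finite_dimensional_vector_space scale B" "finite_dimensional_vector_space scale C"
    and "Vector_Spaces.linear scale scale f"
  shows "endo_trace scale B f = endo_trace scale C f"
proof -
  interpret B: finite_dimensional_vector_space scale B by fact
  interpret C: finite_dimensional_vector_space scale C by fact
  interpret f: Vector_Spaces.linear scale scale f by fact
  have eqB: "(\<Sum>b\<in>B. scale (B.representation B v b) b) = v" for v
    by (rule B.sum_representation_eq[OF B.independent_Basis])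
       (simp_all add: B.span_Basis B.finite_Basis)
  have eqC: "(\<Sum>c\<in>C. scale (B.representation C v c) c) = v" for v
    by (rule B.sum_representation_eq[OF C.independent_Basis])
       (simp_all add: C.span_Basis C.finite_Basis)
  have rB: "B.representation B (\<Sum>c\<in>C. scale (a c) (w c)) b
      = (\<Sum>c\<in>C. a c * B.representation B (w c) b)"
    for a w b
    by (subst B.representation_sum)
       (simp_all add: B.independent_Basis B.span_Basis B.representation_scale)
  have rC: "B.representation C (\<Sum>b\<in>B. scale (a b) (w b)) c
      = (\<Sum>b\<in>B. a b * B.representation C (w b) c)"
    for a w c
    by (subst B.representation_sum)
       (simp_all add: C.independent_Basis C.span_Basis B.representation_scale)
  have "B.representation B (f b) b
      = (\<Sum>c\<in>C. B.representation C b c * B.representation B (f c) b)" for b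
    by (subst (1) eqC[of b, symmetric]) (simp add: f.sum f.scale rB)
  hence "endo_trace scale B f
      = (\<Sum>c\<in>C. \<Sum>b\<in>B. B.representation B (f c) b * B.representation C b c)"
    by (simp add: endo_trace_def sum.swap[of _ B] mult.commute)
  also have "\<dots> = (\<Sum>c\<in>C. B.representation C (f c) c)"
    by (simp flip: rC add: eqB)
  finally show ?thesis by (simp add: endo_trace_def)
qed


section \<open>Modules and composition series\<close>

definition vector_space_record ::
    "('k::field \<Rightarrow> 'v::ab_group_add \<Rightarrow> 'v) \<Rightarrow> ('k, 'v) module" where
  "vector_space_record scale =
     \<lparr>carrier = UNIV, monoid.mult = undefined, one = undefined, zero = 0, add = (+), smult = scale\<rparr>"

text \<open>
  A module over a Lie algebra is given by a vector space \<open>M\<close> and the action \<open>act x\<close> on \<open>M\<close>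
  of each \<open>x\<close> in the set \<open>G\<close>. The submodules and the simplicity of a module depend only on this family of operators.
\<close>

definition lie_submodule ::
    "'g set \<Rightarrow> ('g \<Rightarrow> 'a \<Rightarrow> 'a) \<Rightarrow> 'a set \<Rightarrow> ('k::field, 'a, 'm) module_scheme \<Rightarrow> bool" where
  "lie_submodule G act W M \<longleftrightarrow>
     subspace class_ring W M \<and> (\<forall>x\<in>G. \<forall>w\<in>W. act x w \<in> W)"

definition simple_lie_module ::
    "'g set \<Rightarrow> ('g \<Rightarrow> 'a \<Rightarrow> 'a) \<Rightarrow> ('k::field, 'a, 'm) module_scheme \<Rightarrow> bool" where
  "simple_lie_module G act M \<longleftrightarrow>
     carrier M \<noteq> {\<zero>\<^bsub>M\<^esub>} \<and>
     (\<forall>W. lie_submodule G act W M \<longrightarrow> W = {\<zero>\<^bsub>M\<^esub>} \<or> W = carrier M)"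

text \<open>
  The quotient of \<open>M\<close> by a subspace \<open>U\<close> consists of the cosets of \<open>U\<close>. As in the library's
  \<open>rcoset_mult\<close>, an operation on a coset is the union of the cosets of the results on its elements.
\<close>

definition quotient_space :: "('k::field, 'a, 'm) module_scheme \<Rightarrow> 'a set \<Rightarrow> ('k, 'a set) module" where
  "quotient_space M U =
     \<lparr>carrier = a_rcosets\<^bsub>M\<^esub> U, monoid.mult = undefined, one = undefined,
      zero = U,
      add = set_add M,
      smult = (\<lambda>c A. \<Union>a\<in>A. U +>\<^bsub>M\<^esub> (c \<odot>\<^bsub>M\<^esub> a))\<rparr>"

definition quotient_action ::
    "('k::field, 'a, 'm) module_scheme \<Rightarrow> 'a set \<Rightarrow> ('g \<Rightarrow> 'a \<Rightarrow> 'a) \<Rightarrow> 'g \<Rightarrow> 'a set \<Rightarrow> 'a set" where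
  "quotient_action M U act x A = (\<Union>a\<in>A. U +>\<^bsub>M\<^esub> act x a)"

definition subquotient ::
    "('k::field, 'a, 'm) module_scheme \<Rightarrow> (nat \<Rightarrow> 'a set) \<Rightarrow> nat \<Rightarrow> ('k, 'a set) module" where
  "subquotient M W i = quotient_space (M\<lparr>carrier := W i\<rparr>) (W (Suc i))"

definition composition_series ::
    "'g set \<Rightarrow> ('g \<Rightarrow> 'a \<Rightarrow> 'a) \<Rightarrow> ('k::field, 'a, 'm) module_scheme
      \<Rightarrow> nat \<Rightarrow> (nat \<Rightarrow> 'a set) \<Rightarrow> bool" where
  "composition_series G act M m W \<longleftrightarrow>
     W 0 = carrier M \<and> W m = {\<zero>\<^bsub>M\<^esub>} \<and>
     (\<forall>i\<le>m. lie_submodule G act (W i) M) \<and>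
     (\<forall>i<m. W (Suc i) \<subset> W i \<and>
        simple_lie_module G (quotient_action (M\<lparr>carrier := W i\<rparr>) (W (Suc i)) act) (subquotient M W i))"

end

theory Submission
  imports Defs
begin

text \<open>
  \<^bold>\<open>Cartan subalgebras.\<close> Let \<open>h\<close> be a Cartan subalgebra of \<open>sl(V)\<close>. As \<open>h\<close> is nilpotent, \<open>V\<close> has a
  basis in which every element of \<open>h\<close> is triangular and block diagonal, with one eigenvalue on each
  block (\<open>weight_basis_exists\<close>). The blocks come from Fitting decompositions; inside a block, the
  characteristic being \<open>0\<close>, nilpotency makes \<open>h\<close> act by scalars on simple subquotients
  (\<open>common_eigenvector_mod\<close>). Let \<open>N d\<close> be the space of operators that respect the blocks and move every
  basis vector at least \<open>d\<close> steps down. Then \<open>[N d, h]\<close> lies in \<open>N (d + 1)\<close>, so that descending induction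
  on \<open>d\<close> and self-normalization of \<open>h\<close> put all traceless elements of \<open>N 0\<close> into \<open>h\<close>
  (\<open>weight_triangular_in_self_normalizing\<close>). In particular \<open>h\<close> contains all traceless diagonal operators
  of some basis (\<open>cartan_subalgebra_diagonal\<close>), and this is all that is used of \<open>h\<close>.

  \<^bold>\<open>Block structure.\<close> Now let \<open>g\<close> contain the traceless diagonal operators of a basis. The weights
  of their adjoint action on the off-diagonal matrix units are nonzero and pairwise distinct. Hence \<open>g\<close>,
  and every ideal of \<open>g\<close>, contains the matrix unit at each off-diagonal position at which one of its
  elements has a nonzero entry (\<open>unit_component\<close>). Likewise every submodule of \<open>V\<close> is spanned by basis
  vectors. A composition series therefore sorts the basis into blocks, one for each simple subquotient and
  of the same dimension (\<open>dim_subquotient\<close>). The elements of \<open>g\<close> are block triangular, and simplicity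
  forces \<open>g\<close> to contain all off-diagonal matrix units inside each block (\<open>simple_quotient_units\<close>).

  \<^bold>\<open>The radical.\<close> The elements of \<open>g\<close> that act as a scalar on every simple subquotient form an ideal.
  It is solvable since its commutators are strictly block triangular. An ideal that is not contained in it
  contains a matrix unit inside a block, hence a copy of \<open>sl\<^sub>2\<close>, and is not solvable
  (\<open>lie_radical_eq_rad\<close>).

  \<^bold>\<open>The decomposition.\<close> Taking the traceless parts of the diagonal blocks is a homomorphism from \<open>g\<close>
  to the sum of the \<open>sl\<close> of the blocks. Its kernel is the radical, and it is split by the inclusion of the
  block diagonal operators (\<open>semidirect_decomposition\<close>). A split extension is a semidirect product
  (\<open>split_extension_semidirect\<close>).
\<close>

section \<open>Linear operators\<close>

text \<open>The bracket of \<open>gl(V)\<close>.\<close>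

definition commutator :: "('v::ab_group_add \<Rightarrow> 'v) \<Rightarrow> ('v \<Rightarrow> 'v) \<Rightarrow> 'v \<Rightarrow> 'v" where
  "commutator x y = (\<lambda>v. x (y v) - y (x v))"

lemma commutator_apply: "commutator x y v = x (y v) - y (x v)"
  by (simp add: commutator_def)

text \<open>
  A finite-dimensional vector space over an algebraically closed field of characteristic \<open>0\<close>, with a
  chosen basis. The field is a type, so that these properties are sort constraints.
\<close>

locale closed_field_space = finite_dimensional_vector_space scale Basis
  for scale :: "'k::{alg_closed_field, field_char_0} \<Rightarrow> 'v::ab_group_add \<Rightarrow> 'v" (infixr \<open>*s\<close> 75)
    and Basis :: "'v set"
begin

sublocale ends: vector_space_pair scale scale ..

abbreviation endo :: "('v \<Rightarrow> 'v) \<Rightarrow> bool" where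
  "endo \<equiv> Vector_Spaces.linear scale scale"

lemmas endo_add = ends.linear_add
  and endo_diff = ends.linear_diff
  and endo_scale = ends.linear_scale
  and endo_0 = ends.linear_0
  and endo_sum = ends.linear_sum

lemma endo_shift: "endo x \<Longrightarrow> endo (\<lambda>v. x v - \<mu> *s v)"
  by (rule ends.linear_compose_sub[OF _ linear_scale_self])

lemma endo_compose: "endo x \<Longrightarrow> endo y \<Longrightarrow> endo (\<lambda>v. x (y v))"
  using Vector_Spaces.linear_compose[of scale scale y scale x] by (simp add: o_def)

lemma endo_funpow: "endo x \<Longrightarrow> endo (x ^^ k)"
proof (induction k)
  case 0
  show ?case by (simp add: linear_id id_def[symmetric])
next
  case (Suc k)
  then show ?case using endo_compose[of x "x ^^ k"] by (simp add: comp_def)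
qed

lemma endo_commutator: "endo x \<Longrightarrow> endo y \<Longrightarrow> endo (commutator x y)"
  unfolding commutator_def by (rule ends.linear_compose_sub[OF endo_compose endo_compose])

lemma funpow_image_subset: "x ` W \<subseteq> W \<Longrightarrow> (x ^^ k) ` W \<subseteq> W"
  by (induction k) auto

section \<open>Eigenvectors and the Fitting decomposition\<close>

text \<open>\<open>poly_act x p\<close> is the operator \<open>p(x)\<close>.\<close>

definition poly_act :: "('v \<Rightarrow> 'v) \<Rightarrow> 'k poly \<Rightarrow> 'v \<Rightarrow> 'v" where
  "poly_act x p v = (\<Sum>i\<le>degree p. coeff p i *s (x ^^ i) v)"

lemma poly_act_bound:
  assumes "degree p \<le> n"
  shows "poly_act x p v = (\<Sum>i\<le>n. coeff p i *s (x ^^ i) v)"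
  unfolding poly_act_def using assms
  by (intro sum.mono_neutral_left) (auto simp: not_le intro: coeff_eq_0)

lemma poly_act_add: "poly_act x (p + q) v = poly_act x p v + poly_act x q v"
proof -
  define n where "n = max (degree p) (degree q)"
  have "degree (p + q) \<le> n" "degree p \<le> n" "degree q \<le> n"
    by (auto simp: n_def intro: degree_add_le)
  then show ?thesis
    by (simp add: poly_act_bound[of _ n] scale_left_distrib sum.distrib)
qed

lemma poly_act_smult: "poly_act x (Polynomial.smult c p) v = c *s poly_act x p v"
  by (simp add: poly_act_bound[of _ "degree p"] scale_sum_right degree_smult_le)

lemma poly_act_pCons:
  assumes "endo x"
  shows "poly_act x (pCons a p) v = a *s v + x (poly_act x p v)"
proof -
  have "poly_act x (pCons a p) v = (\<Sum>i\<le>Suc (degree p). coeff (pCons a p) i *s (x ^^ i) v)"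
    by (rule poly_act_bound) (rule degree_pCons_le)
  also have "\<dots> = a *s v + (\<Sum>i\<le>degree p. coeff p i *s x ((x ^^ i) v))"
    by (subst sum.atMost_Suc_shift) simp
  also have "(\<Sum>i\<le>degree p. coeff p i *s x ((x ^^ i) v)) = x (poly_act x p v)"
    by (simp add: poly_act_def endo_sum[OF assms] endo_scale[OF assms])
  finally show ?thesis .
qed

lemma poly_act_linear_factor:
  assumes "endo x"
  shows "poly_act x ([:-\<mu>, 1:] * q) v = x (poly_act x q v) - \<mu> *s poly_act x q v"
proof -
  have "[:-\<mu>, 1:] * q = Polynomial.smult (-\<mu>) q + pCons 0 q"
    by simp
  then show ?thesis
    by (simp only: poly_act_add poly_act_smult poly_act_pCons[OF assms]) simp
qed

lemma poly_act_in:
  assumes "subspace W" "x ` W \<subseteq> W" "v \<in> W"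
  shows "poly_act x p v \<in> W"
  unfolding poly_act_def using assms funpow_image_subset[OF assms(2)]
  by (intro subspace_sum subspace_scale) auto

lemma annihilating_poly:
  assumes "endo x"
  obtains p where "p \<noteq> 0" "poly_act x p v = 0"
proof -
  \<comment> \<open>The vectors \<open>q(x) v\<close> with \<open>q\<close> of degree below \<open>n\<close>. Some power \<open>x\<^sup>n v\<close> lies among them,
    as otherwise the powers would be linearly independent.\<close>
  define A where "A n = {poly_act x q v |q. degree q < n \<or> q = 0}" for n
  have A: "subspace (A n)" for n
  proof (rule subspaceI)
    show "0 \<in> A n"
      unfolding A_def by (intro CollectI exI[of _ 0]) (simp add: poly_act_def)
  next
    fix u w assume "u \<in> A n" "w \<in> A n"
    then obtain p q where "u = poly_act x p v" "degree p < n \<or> p = 0"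
      "w = poly_act x q v" "degree q < n \<or> q = 0"
      by (auto simp: A_def)
    moreover from this have "degree (p + q) < n \<or> p + q = 0"
      by (auto intro: degree_add_less)
    ultimately show "u + w \<in> A n"
      unfolding A_def by (intro CollectI exI[of _ "p + q"]) (simp add: poly_act_add)
  next
    fix c u assume "u \<in> A n"
    then obtain p where "u = poly_act x p v" "degree p < n \<or> p = 0"
      by (auto simp: A_def)
    then show "c *s u \<in> A n"
      unfolding A_def
      by (intro CollectI exI[of _ "Polynomial.smult c p"])
        (auto simp: poly_act_smult degree_smult_eq)
  qed
  have mono: "poly_act x (monom 1 i) v = (x ^^ i) v" for i
  proof -
    have "poly_act x (monom 1 i) v = (\<Sum>j\<le>i. coeff (monom 1 i) j *s (x ^^ j) v)"
      by (rule poly_act_bound) (rule degree_monom_le)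
    also have "\<dots> = (\<Sum>j\<le>i. if j = i then (x ^^ j) v else 0)"
      by (rule sum.cong) auto
    finally show ?thesis by simp
  qed
  let ?S = "\<lambda>n. (\<lambda>i. (x ^^ i) v) ` {..<n}"
  have sub: "span (?S n) \<subseteq> A n" for n
  proof (rule span_minimal[OF _ A], rule image_subsetI)
    fix i assume "i \<in> {..<n}"
    then show "(x ^^ i) v \<in> A n"
      unfolding A_def by (intro CollectI exI[of _ "monom 1 i"]) (simp add: mono degree_monom_eq)
  qed
  have "\<exists>n. (x ^^ n) v \<in> span (?S n)"
  proof (rule ccontr)
    assume no: "\<nexists>n. (x ^^ n) v \<in> span (?S n)"
    have "independent (?S n) \<and> card (?S n) = n" for n
    proof (induction n)
      case (Suc n)
      have 1: "(x ^^ n) v \<notin> span (?S n)"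
        by (rule contrapos_nn[OF no exI])
      then have 2: "(x ^^ n) v \<notin> ?S n"
        by (rule contrapos_nn) (rule span_base)
      have "?S (Suc n) = insert ((x ^^ n) v) (?S n)"
        by (simp only: lessThan_Suc image_insert)
      moreover have "independent (insert ((x ^^ n) v) (?S n))"
        using Suc independent_insertI[OF 1] by blast
      moreover have "card (insert ((x ^^ n) v) (?S n)) = Suc n"
        using Suc card_insert_disjoint[OF _ 2] by simp
      ultimately show ?case by (simp only: simp_thms)
    qed (simp add: independent_empty)
    then have "card (?S (Suc (dim UNIV))) \<le> dim UNIV" "card (?S (Suc (dim UNIV))) = Suc (dim UNIV)"
      using independent_card_le_dim[OF subset_UNIV] by blast+
    then show False by linarith
  qed
  then obtain n where "(x ^^ n) v \<in> span (?S n)" ..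
  then have "(x ^^ n) v \<in> A n"
    by (rule subsetD[OF sub])
  then obtain q where q: "(x ^^ n) v = poly_act x q v" "degree q < n \<or> q = 0"
    unfolding A_def by blast
  let ?p = "monom 1 n + Polynomial.smult (-1) q"
  have "coeff ?p n = 1"
    using q(2) by (auto simp: coeff_eq_0)
  then have "?p \<noteq> 0" by (metis coeff_0 zero_neq_one)
  moreover have "poly_act x ?p v = 0"
    by (simp only: poly_act_add poly_act_smult mono q(1)) simp
  ultimately show thesis by (rule that)
qed

lemma eigenvector_exists:
  assumes x: "endo x" and W: "subspace W" "x ` W \<subseteq> W" "W \<noteq> {0}"
  obtains \<mu> v where "v \<in> W" "v \<noteq> 0" "x v = \<mu> *s v"
proof -
  obtain v where v: "v \<in> W" "v \<noteq> 0"
    using W subspace_0 by blast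
  obtain p where "p \<noteq> 0" "poly_act x p v = 0"
    using annihilating_poly[OF x] .
  then have "\<exists>\<mu> v. v \<in> W \<and> v \<noteq> 0 \<and> x v = \<mu> *s v"
  proof (induction "degree p" arbitrary: p rule: less_induct)
    case less
    show ?case
    proof (cases "degree p = 0")
      case True
      then obtain c where "p = [:c:]" by (rule degree_eq_zeroE)
      then show ?thesis using less.prems v by (simp add: poly_act_def)
    next
      case False
      then obtain \<mu> where "poly p \<mu> = 0"
        using alg_closed_imp_poly_has_root[of p] by auto
      then obtain q where p: "p = [:-\<mu>, 1:] * q"
        by (metis dvdE poly_eq_0_iff_dvd)
      have q0: "q \<noteq> 0" using less.prems p by auto
      have deg: "degree q < degree p"
        unfolding p using q0 by (subst degree_mult_eq) auto
      let ?u = "poly_act x q v"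
      have "x ?u = \<mu> *s ?u"
        using less.prems(2) unfolding p poly_act_linear_factor[OF x] by simp
      moreover have "?u \<in> W" using poly_act_in W v by blast
      ultimately show ?thesis
        using less.hyps[OF deg q0] by blast
    qed
  qed
  with that show thesis by blast
qed

lemma subspace_image: "endo x \<Longrightarrow> subspace W \<Longrightarrow> subspace (x ` W)"
  by (rule ends.linear_subspace_image)

lemma subspace_ker_in: "endo x \<Longrightarrow> subspace W \<Longrightarrow> subspace {v \<in> W. x v = 0}"
  by (rule subspaceI) (auto simp: subspace_0 subspace_add subspace_scale endo_add endo_scale endo_0)

text \<open>
  The Fitting decomposition: for large \<open>m\<close>, the kernel and the image of \<open>x ^^ m\<close> on \<open>W\<close> no longer depend
  on \<open>m\<close>, and \<open>W\<close> is their direct sum.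
\<close>

lemma fitting:
  assumes x: "endo x" and W: "subspace W" "x ` W \<subseteq> W"
  obtains m where "\<forall>j. (x ^^ (m + j)) ` W = (x ^^ m) ` W"
    and "\<forall>j. \<forall>v\<in>W. (x ^^ (m + j)) v = 0 \<longrightarrow> (x ^^ m) v = 0"
    and "{v \<in> W. (x ^^ m) v = 0} \<inter> (x ^^ m) ` W = {0}"
    and "\<forall>v\<in>W. \<exists>w \<in> W. (x ^^ m) (v - (x ^^ m) w) = 0"
proof -
  let ?I = "\<lambda>k. (x ^^ k) ` W" and ?K = "\<lambda>k. {v \<in> W. (x ^^ k) v = 0}"
  have sI: "subspace (?I k)" and sK: "subspace (?K k)" for k
    using subspace_image subspace_ker_in endo_funpow x W by blast+
  \<comment> \<open>Take \<open>m\<close> beyond the points \<open>a\<close> and \<open>b\<close> at which the dimensions of the decreasing images and of the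
    increasing kernels become stationary.\<close>
  have Idec: "?I (k + j) \<subseteq> ?I k" for k j
    using funpow_image_subset[OF W(2), of j] by (auto simp: funpow_add)
  have Kinc: "?K k \<subseteq> ?K (j + k)" for k j
    using endo_0[OF endo_funpow[OF x]] by (auto simp: funpow_add)
  obtain a where a: "\<And>k. dim (?I a) \<le> dim (?I k)"
    using ex_has_least_nat[of "\<lambda>_. True" _ "\<lambda>k. dim (?I k)"] by auto
  obtain b where b: "\<And>k. dim (?K k) \<le> dim (?K b)"
    using ex_has_greatest_nat[of "\<lambda>_. True" 0 "\<lambda>k. dim (?K k)" "Suc dimension"] dim_subset_UNIV
    by (auto simp: less_Suc_eq_le)
  define m where "m = a + b"
  have Ia: "?I (a + j) = ?I a" for j
    by (rule subspace_dim_equal[OF sI sI Idec a])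
  have Kb: "?K b = ?K (j + b)" for j
    by (rule subspace_dim_equal[OF sK sK Kinc b])
  have I: "?I (m + j) = ?I m" for j
    unfolding m_def using Ia[of "b + j"] Ia[of b] by (simp add: add.assoc)
  have K: "?K (m + j) = ?K m" for j
    unfolding m_def using Kb[of "a + j"] Kb[of a] by (simp add: ac_simps)
  show thesis
  proof (rule that)
    show "\<forall>j. ?I (m + j) = ?I m" using I by blast
    show "\<forall>j. \<forall>v\<in>W. (x ^^ (m + j)) v = 0 \<longrightarrow> (x ^^ m) v = 0"
      using K by blast
    show "?K m \<inter> ?I m = {0}"
    proof -
      have "v = 0" if "v \<in> ?K m" "v = (x ^^ m) w" "w \<in> W" for v w
        using that K[of m] by (auto simp: funpow_add)
      moreover have "0 \<in> ?K m \<inter> ?I m"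
        using subspace_0[OF sI, of m] subspace_0[OF sK, of m] by blast
      ultimately show ?thesis by auto
    qed
    show "\<forall>v\<in>W. \<exists>w\<in>W. (x ^^ m) (v - (x ^^ m) w) = 0"
    proof
      fix v assume "v \<in> W"
      then have "(x ^^ m) v \<in> ?I (m + m)" using I[of m] by blast
      then obtain w where "w \<in> W" "(x ^^ m) v = (x ^^ m) ((x ^^ m) w)"
        by (auto simp: funpow_add)
      then show "\<exists>w\<in>W. (x ^^ m) (v - (x ^^ m) w) = 0"
        by (intro bexI[of _ w]) (simp_all add: endo_diff[OF endo_funpow[OF x]])
    qed
  qed
qed


lemma funpow_eigenvector: "endo x \<Longrightarrow> x v = c *s v \<Longrightarrow> (x ^^ k) v = c ^ k *s v"
  by (induction k) (simp_all add: endo_scale mult.commute)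

lemma subspace_scale_cancel:
  assumes "subspace U" "c *s v \<in> U" "c \<noteq> 0"
  shows "v \<in> U"
  using subspace_scale[OF assms(1,2), of "inverse c"] assms(3) by simp

lemma representation_outside_span:
  assumes "independent S" "T \<subseteq> S" "v \<in> span T" "b \<notin> T"
  shows "representation S v b = 0"
  using representation_extend[OF assms(1,3,2)] representation_ne_zero[of T v b] assms(4) by auto

lemma endo_image_span:
  assumes "endo x" "\<And>b. b \<in> S \<Longrightarrow> x b \<in> U" "subspace U" "v \<in> span S"
  shows "x v \<in> U"
  using assms(4)
proof (induction rule: span_induct_alt)
  case base
  show ?case using endo_0[OF assms(1)] subspace_0[OF assms(3)] by simp
next
  case (step c b y)
  then show ?case
    using assms by (simp add: endo_add endo_scale subspace_add subspace_scale)
qed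

end

section \<open>Weight bases of nilpotent Lie algebras of operators\<close>

text \<open>
  A set \<open>h\<close> of linear operators together with a central series \<open>C\<close> that descends from \<open>h\<close> to zero. No
  linear structure on \<open>h\<close> is needed.
\<close>

locale nilpotent_operators = closed_field_space scale Basis
  for scale :: "'k::{alg_closed_field, field_char_0} \<Rightarrow> 'v::ab_group_add \<Rightarrow> 'v" (infixr \<open>*s\<close> 75)
    and Basis :: "'v set" +
  fixes h :: "('v \<Rightarrow> 'v) set" and C :: "nat \<Rightarrow> ('v \<Rightarrow> 'v) set" and n :: nat
  assumes h_endo: "x \<in> h \<Longrightarrow> endo x"
    and C_0: "C 0 = h"
    and C_subset: "C j \<subseteq> h"
    and C_commutator: "x \<in> h \<Longrightarrow> y \<in> C j \<Longrightarrow> commutator x y \<in> C (Suc j)"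
    and C_n: "y \<in> C n \<Longrightarrow> y v = 0"
begin

text \<open>The subspaces that are stable under \<open>h\<close>.\<close>

definition invariant :: "'v set \<Rightarrow> bool" where
  "invariant W \<longleftrightarrow> subspace W \<and> (\<forall>x\<in>h. \<forall>v\<in>W. x v \<in> W)"

abbreviation shift :: "('v \<Rightarrow> 'v) \<Rightarrow> 'k \<Rightarrow> 'v \<Rightarrow> 'v" where
  "shift x \<mu> \<equiv> \<lambda>v. x v - \<mu> *s v"

lemma endo_C: "y \<in> C j \<Longrightarrow> endo y"
  using C_subset h_endo by blast

lemma shift_commute:
  assumes "endo x" "endo y"
  shows "shift x \<mu> (y v) = y (shift x \<mu> v) + commutator x y v"
  using assms by (simp add: commutator_apply endo_diff endo_scale)

lemma shift_invariant: "invariant W \<Longrightarrow> x \<in> h \<Longrightarrow> v \<in> W \<Longrightarrow> shift x \<mu> v \<in> W"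
  by (simp add: invariant_def subspace_diff subspace_scale)

lemma funpow_shift_invariant: "invariant W \<Longrightarrow> x \<in> h \<Longrightarrow> v \<in> W \<Longrightarrow> (shift x \<mu> ^^ k) v \<in> W"
  by (induction k) (simp_all add: shift_invariant)

text \<open>
  Generalized eigenspaces of \<open>x\<close> are stable under \<open>h\<close>: moving \<open>y\<close> past one factor \<open>x - \<mu>\<close> costs a
  commutator with \<open>x\<close>, which can happen at most \<open>l\<close> times as \<open>y\<close> lies \<open>l\<close> steps above the end of the
  series.
\<close>

lemma funpow_shift_ker:
  assumes x: "x \<in> h"
  shows "y \<in> C j \<Longrightarrow> j + l = n \<Longrightarrow> (shift x \<mu> ^^ k) v = 0 \<Longrightarrow> (shift x \<mu> ^^ (k + l)) (y v) = 0"
proof (induction k arbitrary: v j l y)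
  case 0
  then show ?case
    by (simp add: endo_0[OF endo_C] endo_0[OF endo_funpow[OF endo_shift[OF h_endo[OF x]]]])
next
  case (Suc k)
  note IH = Suc.IH
  let ?s = "shift x \<mu>"
  have s: "endo (?s ^^ i)" for i
    by (rule endo_funpow[OF endo_shift[OF h_endo[OF x]]])
  have v: "(?s ^^ k) (?s v) = 0"
    using Suc.prems(3) by (simp only: funpow_Suc_right comp_apply)
  show ?case
    using Suc.prems(1,2)
  proof (induction l arbitrary: j y)
    case 0
    then show ?case by (simp only: C_n add_0_right endo_0[OF s])
  next
    case (Suc l)
    have "(?s ^^ (Suc k + Suc l)) (y v) = (?s ^^ (Suc k + l)) (?s (y v))"
      by (simp only: add_Suc_right funpow_Suc_right comp_apply)
    also have "?s (y v) = y (?s v) + commutator x y v"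
      by (rule shift_commute[OF h_endo[OF x] endo_C[OF Suc.prems(1)]])
    also have "(?s ^^ (Suc k + l)) \<dots> = (?s ^^ (k + Suc l)) (y (?s v)) + (?s ^^ (Suc k + l)) (commutator x y v)"
      by (simp only: endo_add[OF s] add_Suc_shift)
    also have "(?s ^^ (k + Suc l)) (y (?s v)) = 0"
      by (rule IH[OF Suc.prems v])
    also have "(?s ^^ (Suc k + l)) (commutator x y v) = 0"
      using Suc.IH[OF C_commutator[OF x Suc.prems(1)]] Suc.prems(2) by simp
    finally show ?case by simp
  qed
qed

text \<open>The same argument for the images of the powers of \<open>x - \<mu>\<close>.\<close>

lemma funpow_shift_image:
  assumes x: "x \<in> h" and W: "invariant W" and v: "v \<in> W"
  shows "y \<in> C j \<Longrightarrow> j + l = n \<Longrightarrow> y ((shift x \<mu> ^^ (k + l)) v) \<in> (shift x \<mu> ^^ k) ` W"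
proof (induction k arbitrary: j l y)
  case 0
  then have "y \<in> h" using C_subset by blast
  then show ?case
    using W funpow_shift_invariant[OF W x v] by (auto simp: invariant_def)
next
  case (Suc k)
  note IH = Suc.IH
  let ?s = "shift x \<mu>"
  have s: "endo (?s ^^ i)" for i
    by (rule endo_funpow[OF endo_shift[OF h_endo[OF x]]])
  have sub: "subspace ((?s ^^ i) ` W)" for i
    using subspace_image[OF s] W by (simp add: invariant_def)
  show ?case
    using Suc.prems
  proof (induction l arbitrary: j y)
    case 0
    then have "y \<in> C n" by simp
    then show ?case using subspace_0[OF sub] by (simp only: C_n)
  next
    case (Suc l)
    let ?u = "(?s ^^ (k + Suc l)) v"
    have "y ((?s ^^ (Suc k + Suc l)) v) = ?s (y ?u) - commutator x y ?u"
      using shift_commute[OF h_endo[OF x] endo_C[OF Suc.prems(1)], where \<mu> = \<mu> and v = ?u] by simp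
    moreover have "?s (y ?u) \<in> (?s ^^ Suc k) ` W"
    proof -
      obtain w where "w \<in> W" "y ?u = (?s ^^ k) w"
        using IH[OF Suc.prems] by (rule imageE)
      then show ?thesis by (intro image_eqI[of _ _ w]) simp_all
    qed
    moreover have "commutator x y ?u \<in> (?s ^^ Suc k) ` W"
      using Suc.IH[OF C_commutator[OF x Suc.prems(1)]] Suc.prems(2) by (simp only: add_Suc_shift)
    ultimately show ?case
      using subspace_diff[OF sub] by (simp only:)
  qed
qed

lemma fitting_invariant:
  assumes x: "x \<in> h" and W: "invariant W"
  obtains K I m where "invariant K" "invariant I" "K \<inter> I = {0}" "K \<subseteq> W" "I \<subseteq> W"
    "\<forall>v\<in>W. \<exists>a\<in>K. \<exists>b\<in>I. v = a + b"
    "\<forall>v\<in>K. (shift x \<mu> ^^ m) v = 0" "\<forall>v\<in>W. \<forall>j. (shift x \<mu> ^^ j) v = 0 \<longrightarrow> v \<in> K"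
proof -
  let ?s = "shift x \<mu>"
  have s: "endo ?s" "\<And>i. endo (?s ^^ i)"
    using endo_funpow endo_shift h_endo x by blast+
  have W': "subspace W" "?s ` W \<subseteq> W"
    using W shift_invariant[OF W x] by (auto simp: invariant_def)
  obtain m where m: "\<forall>j. (?s ^^ (m + j)) ` W = (?s ^^ m) ` W"
      "\<forall>j. \<forall>v\<in>W. (?s ^^ (m + j)) v = 0 \<longrightarrow> (?s ^^ m) v = 0"
      "{v \<in> W. (?s ^^ m) v = 0} \<inter> (?s ^^ m) ` W = {0}"
      "\<forall>v\<in>W. \<exists>w \<in> W. (?s ^^ m) (v - (?s ^^ m) w) = 0"
    by (rule fitting[OF s(1) W'])
  let ?K = "{v \<in> W. (?s ^^ m) v = 0}" and ?I = "(?s ^^ m) ` W"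
  have IW: "?I \<subseteq> W"
    using funpow_shift_invariant[OF W x] by blast
  have "invariant ?K"
    unfolding invariant_def
  proof (intro conjI ballI)
    show "subspace ?K" by (rule subspace_ker_in[OF s(2) W'(1)])
    fix y v assume y: "y \<in> h" and v: "v \<in> ?K"
    have "(?s ^^ (m + n)) (y v) = 0"
      using funpow_shift_ker[OF x, where y = y and j = 0 and l = n and k = m and v = v and \<mu> = \<mu>] y v by (simp add: C_0)
    then show "y v \<in> ?K"
      using m(2) W y v by (auto simp: invariant_def)
  qed
  moreover have "invariant ?I"
    unfolding invariant_def
  proof (intro conjI ballI)
    show "subspace ?I" by (rule subspace_image[OF s(2) W'(1)])
    fix y v assume y: "y \<in> h" and v: "v \<in> ?I"
    then have "v \<in> (?s ^^ (m + n)) ` W" using m(1) by blast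
    then obtain w where "w \<in> W" "v = (?s ^^ (m + n)) w" by blast
    then show "y v \<in> ?I"
      using funpow_shift_image[OF x W, of w y 0 n] y by (simp add: C_0)
  qed
  moreover have "\<forall>v\<in>W. \<exists>a\<in>?K. \<exists>b\<in>?I. v = a + b"
  proof
    fix v assume "v \<in> W"
    obtain w where w: "w \<in> W" "(?s ^^ m) (v - (?s ^^ m) w) = 0"
      using m(4) \<open>v \<in> W\<close> by blast
    then have "v - (?s ^^ m) w \<in> ?K"
      using \<open>v \<in> W\<close> IW subspace_diff[OF W'(1)] by blast
    then show "\<exists>a\<in>?K. \<exists>b\<in>?I. v = a + b"
      using w(1) by (intro bexI[of _ "v - (?s ^^ m) w"] bexI[of _ "(?s ^^ m) w"]) auto
  qed
  moreover have "v \<in> ?K" if "v \<in> W" "(?s ^^ j) v = 0" for v j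
  proof -
    have "(?s ^^ (m + j)) v = 0"
      using that(2) endo_0[OF s(2)] by (simp add: funpow_add)
    then show ?thesis using m(2) that(1) by blast
  qed
  ultimately show thesis
    using m(3) IW by (intro that[of ?K ?I m]) auto
qed


lemma funpow_shift_zero_imp_eq:
  assumes "x \<in> h" "w \<noteq> 0" "x w = \<nu> *s w" "(shift x \<mu> ^^ m) w = 0"
  shows "\<nu> = \<mu>"
proof -
  have "shift x \<mu> w = (\<nu> - \<mu>) *s w"
    using assms(3) by (simp add: scale_left_diff_distrib)
  from funpow_eigenvector[OF endo_shift[OF h_endo[OF assms(1)]] this, of m]
  show ?thesis using assms(2,4) by simp
qed

text \<open>
  If every operator of the nilpotent family has a single eigenvalue on \<open>W\<close>, then above every proper
  submodule \<open>U\<close> of \<open>W\<close> there is a common eigenvector modulo \<open>U\<close>.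
\<close>

lemma common_eigenvector_mod:
  assumes W: "invariant W" and U: "invariant U" "U \<subset> W"
    and nil: "\<And>x. x \<in> h \<Longrightarrow> \<exists>m. \<forall>v\<in>W. (shift x (lam x) ^^ m) v = 0"
  obtains w where "w \<in> W" "w \<notin> U" "\<forall>x\<in>h. x w - lam x *s w \<in> U"
proof -
  \<comment> \<open>For \<open>X\<close> of least dimension, \<open>X / U\<close> is a simple module. Going up the central series, its members are
    shown to act on \<open>X / U\<close> by scalars.\<close>
  define good where "good X \<longleftrightarrow> invariant X \<and> U \<subset> X \<and> X \<subseteq> W" for X
  have "good W" using W U by (simp add: good_def)
  then obtain X where X: "good X" and least: "\<And>Y. good Y \<Longrightarrow> dim X \<le> dim Y"
    using ex_has_least_nat[of good W dim] by blast
  have XI: "invariant X" and XU: "U \<subset> X" and XW: "X \<subseteq> W"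
    using X by (auto simp: good_def)
  have sU: "subspace U" and sX: "subspace X"
    using U XI by (auto simp: invariant_def)
  have Uinv: "y u \<in> U" if "y \<in> h" "u \<in> U" for y u
    using U that by (auto simp: invariant_def)
  have Xinv: "y u \<in> X" if "y \<in> h" "u \<in> X" for y u
    using XI that by (auto simp: invariant_def)
  have main: "\<forall>z\<in>C j. \<forall>v\<in>X. z v - lam z *s v \<in> U" if "j + l = n" for j l
    using that
  proof (induction l arbitrary: j)
    case 0
    show ?case
    proof (intro ballI)
      fix z v assume z: "z \<in> C j" and v: "v \<in> X"
      have z0: "z u = 0" for u using z 0 C_n by simp
      have zh: "z \<in> h" using z C_subset by blast
      obtain w where w: "w \<in> X" "w \<noteq> 0" using XU subspace_0[OF sU] by blast
      obtain m where m: "\<forall>v\<in>W. (shift z (lam z) ^^ m) v = 0"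
        using nil[OF zh] by (rule exE)
      have "(shift z (lam z) ^^ m) w = 0" using m w XW by (simp only: subset_iff)
      then have "0 = lam z"
        by (rule funpow_shift_zero_imp_eq[OF zh w(2), rotated]) (simp add: z0)
      then show "z v - lam z *s v \<in> U"
        using subspace_0[OF sU] by (simp add: z0 flip: \<open>0 = lam z\<close>)
    qed
  next
    case (Suc l)
    have IH: "z v - lam z *s v \<in> U" if "z \<in> C (Suc j)" "v \<in> X" for z v
      using Suc.IH[of "Suc j"] Suc.prems that by simp
    show ?case
    proof (intro ballI)
      fix z v assume z: "z \<in> C j" and v: "v \<in> X"
      have zh: "z \<in> h" using z C_subset by blast
      let ?s = "shift z (lam z)"
      have s: "endo ?s" "\<And>i. endo (?s ^^ i)"
        using endo_shift[OF h_endo[OF zh]] endo_funpow by auto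
      have sinv: "?s u \<in> U" if "u \<in> U" for u
        by (rule shift_invariant[OF U(1) zh that])
      have sX: "(?s ^^ i) u \<in> X" if "u \<in> X" for u i
        by (rule funpow_shift_invariant[OF XI zh that])
      define k where "k = (LEAST k. \<forall>v\<in>X. (?s ^^ k) v \<in> U)"
      obtain m where "\<forall>v\<in>W. (?s ^^ m) v = 0"
        using nil[OF zh] by (rule exE)
      then have "\<forall>v\<in>X. (?s ^^ m) v \<in> U"
        using XW subspace_0[OF sU] by (simp add: subset_iff)
      then have k: "\<forall>v\<in>X. (?s ^^ k) v \<in> U"
        unfolding k_def by (rule LeastI)
      have "k \<noteq> 0"
      proof
        assume "k = 0"
        then have "X \<subseteq> U" using k by auto
        then show False using XU by blast
      qed
      then obtain k' where k': "k = Suc k'" by (cases k) auto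
      have "\<not> (\<forall>v\<in>X. (?s ^^ k') v \<in> U)"
        using not_less_Least[of k' "\<lambda>k. \<forall>v\<in>X. (?s ^^ k) v \<in> U"] k' unfolding k_def[symmetric] by simp
      then obtain u where u: "u \<in> X" "(?s ^^ k') u \<notin> U" by (auto simp only: ball_simps)
      \<comment> \<open>The commutator acts on \<open>X / U\<close> by a scalar \<open>c\<close>, so that \<open>s\<^sup>i y\<close> and \<open>y s\<^sup>i - i c s\<^sup>i\<^sup>-\<^sup>1\<close> agree there for the
        nilpotent operator \<open>s = z - lam z\<close>. With \<open>i = k\<close> least such that \<open>s\<^sup>k\<close> vanishes on \<open>X / U\<close>,
        this gives \<open>k c = 0\<close>.\<close>
      have comm: "commutator y z v \<in> U" if y: "y \<in> h" and v: "v \<in> X" for y v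
      proof -
        let ?c = "lam (commutator y z)"
        have cz: "commutator y z \<in> C (Suc j)" by (rule C_commutator[OF y z])
        have e: "?s (y v) - y (?s v) + ?c *s v \<in> U" if "v \<in> X" for v
        proof -
          have "?s (y v) - y (?s v) + ?c *s v = - (commutator y z v - ?c *s v)"
            using h_endo[OF y] by (simp add: commutator_apply endo_diff endo_scale)
          then show ?thesis using subspace_neg[OF sU IH[OF cz that]] by simp
        qed
        have Q: "(?s ^^ Suc i) (y v) - y ((?s ^^ Suc i) v) + (of_nat (Suc i) * ?c) *s (?s ^^ i) v \<in> U"
          if "v \<in> X" for i v
        proof (induction i)
          case 0
          show ?case using e[OF that] by simp
        next
          case (Suc i)
          let ?u = "(?s ^^ Suc i) v"
          let ?r = "(?s ^^ Suc i) (y v) - y ?u + (of_nat (Suc i) * ?c) *s (?s ^^ i) v"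
          have "?s ?r = (?s ^^ Suc (Suc i)) (y v) - ?s (y ?u) + (of_nat (Suc i) * ?c) *s ?u"
            by (simp only: endo_add[OF s(1)] endo_diff[OF s(1)] endo_scale[OF s(1)] funpow.simps comp_apply)
          then have "(?s ^^ Suc (Suc i)) (y v) - y (?s ?u) + (of_nat (Suc (Suc i)) * ?c) *s ?u
             = ?s ?r + (?s (y ?u) - y (?s ?u) + ?c *s ?u)"
            by (simp only: of_nat_Suc[of "Suc i"] distrib_right scale_left_distrib) simp
          moreover have "\<dots> \<in> U"
            using sinv[OF Suc] e[OF sX[OF that, of "Suc i"]] by (rule subspace_add[OF sU])
          ultimately show ?case by (simp only: funpow.simps comp_apply)
        qed
        have "?c = 0"
        proof (rule ccontr)
          assume c: "?c \<noteq> 0"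
          let ?w = "(of_nat (Suc k') * ?c) *s (?s ^^ k') u"
          have "(?s ^^ Suc k') (y u) \<in> U" "y ((?s ^^ Suc k') u) \<in> U"
            using k Xinv[OF y] Uinv[OF y] u(1) by (simp_all only: k'[symmetric])
          then have "(?s ^^ Suc k') (y u) - y ((?s ^^ Suc k') u) \<in> U"
            by (rule subspace_diff[OF sU])
          from subspace_diff[OF sU Q[OF u(1), of k'] this] have "?w \<in> U"
            by (simp only: add_diff_cancel_left')
          show False
            using u(2) c subspace_scale_cancel[OF sU \<open>?w \<in> U\<close>] of_nat_neq_0[of k', where ?'a = 'k]
            by (simp del: of_nat_Suc)
        qed
        then show ?thesis using IH[OF cz v] by simp
      qed
      \<comment> \<open>Hence the kernel of \<open>s\<close> on \<open>X / U\<close> is a submodule. It is nonzero because \<open>s\<close> is nilpotent, and is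
        everything by simplicity.\<close>
      let ?Y = "{v \<in> X. ?s v \<in> U}"
      have "good ?Y"
        unfolding good_def invariant_def
      proof (intro conjI ballI)
        show "subspace ?Y"
          using subspace_inter[OF \<open>subspace X\<close> ends.linear_subspace_vimage[OF s(1) sU]]
          by (simp add: Int_def vimage_def)
        fix y v assume y: "y \<in> h" and v: "v \<in> ?Y"
        have "?s (y v) = y (?s v) - commutator y z v"
          using h_endo[OF y] by (simp add: commutator_apply endo_diff endo_scale)
        then show "y v \<in> ?Y"
          using v comm[OF y] Uinv[OF y] Xinv[OF y] subspace_diff[OF sU] by simp
      next
        have "(?s ^^ k') u \<in> ?Y"
          using sX[OF u(1)] k u(1) by (simp add: k')
        then show "U \<subset> ?Y"
          using XU sinv u(2) by blast
        show "?Y \<subseteq> W" using XW by blast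
      qed
      then have "?Y = X"
        using least \<open>subspace X\<close> by (intro subspace_dim_equal) (auto simp: good_def invariant_def)
      then show "z v - lam z *s v \<in> U" using v by blast
    qed
  qed
  obtain w where w: "w \<in> X" "w \<notin> U" using XU by blast
  show thesis
    using main[of 0 n] w XW by (intro that[of w]) (auto simp: C_0)
qed


text \<open>
  A basis \<open>S\<close> of \<open>W\<close> in which every operator of the family is triangular, and block diagonal with
  respect to the weights: \<open>rk\<close> gives the order of the basis vectors, and \<open>wt b\<close> the weight of \<open>b\<close>.
\<close>

definition weight_basis ::
    "'v set \<Rightarrow> 'v set \<Rightarrow> ('v \<Rightarrow> nat) \<Rightarrow> ('v \<Rightarrow> ('v \<Rightarrow> 'v) \<Rightarrow> 'k) \<Rightarrow> bool" where
  "weight_basis W S rk wt \<longleftrightarrow> independent S \<and> span S = W \<and>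
     (\<forall>b\<in>S. \<forall>x\<in>h. x b - wt b x *s b \<in> span {c \<in> S. rk c < rk b \<and> wt c = wt b})"

text \<open>Such a basis is built from common eigenvectors modulo the span of the previous ones.\<close>

lemma weight_basis_single_weight:
  assumes W: "invariant W"
    and nil: "\<And>x. x \<in> h \<Longrightarrow> \<exists>m. \<forall>v\<in>W. (shift x (lam x) ^^ m) v = 0"
  obtains S rk where "weight_basis W S rk (\<lambda>_. lam)"
proof -
  define P where "P S rk \<longleftrightarrow> S \<subseteq> W \<and> independent S \<and> (\<forall>c\<in>S. rk c < card S) \<and>
     (\<forall>b\<in>S. \<forall>x\<in>h. x b - lam x *s b \<in> span {c \<in> S. rk c < rk b})" for S and rk :: "'v \<Rightarrow> nat"
  have sW: "subspace W" using W by (simp add: invariant_def)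
  have "d \<le> dim W \<Longrightarrow> \<exists>S rk. P S rk \<and> card S = d" for d
  proof (induction d)
    case 0
    show ?case
      by (intro exI[of _ "{}"]) (simp add: P_def independent_empty)
  next
    case (Suc d)
    then obtain S rk where P: "P S rk" and d: "card S = d" by auto
    have fin: "finite S" using P finiteI_independent by (auto simp: P_def)
    have SW: "span S \<subseteq> W"
      using P sW by (intro span_minimal) (auto simp: P_def)
    have "dim (span S) = d"
      using P d by (simp add: dim_eq_card_independent P_def)
    then have "span S \<noteq> W" using Suc.prems by auto
    with SW have "span S \<subset> W" by blast
    moreover have "invariant (span S)"
      unfolding invariant_def
    proof (intro conjI ballI)
      fix x v assume x: "x \<in> h" and v: "v \<in> span S"
      show "x v \<in> span S"
      proof (rule endo_image_span[OF h_endo[OF x] _ subspace_span v])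
        fix b assume b: "b \<in> S"
        have "x b - lam x *s b \<in> span S"
          using P b x span_mono[of "{c \<in> S. rk c < rk b}" S] by (auto simp: P_def)
        then have "x b - lam x *s b + lam x *s b \<in> span S"
          by (rule span_add[OF _ span_scale[OF span_base[OF b]]])
        then show "x b \<in> span S" by simp
      qed
    qed simp
    ultimately obtain w where w: "w \<in> W" "w \<notin> span S" "\<forall>x\<in>h. x w - lam x *s w \<in> span S"
      using common_eigenvector_mod[OF W _ _ nil] by metis
    have wS: "w \<notin> S" using w span_base by blast
    let ?S = "insert w S" and ?rk = "rk(w := d)"
    have card: "card ?S = Suc d" using fin wS d by simp
    have lt: "{c \<in> ?S. ?rk c < ?rk b} = {c \<in> S. rk c < rk b}" if "b \<in> S" for b
      using that wS P d by (auto simp: P_def)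
    have ltw: "{c \<in> ?S. ?rk c < ?rk w} = S"
      using wS P d by (auto simp: P_def)
    have "P ?S ?rk"
      unfolding P_def card
    proof (intro conjI ballI)
      show "?S \<subseteq> W" using w P by (auto simp: P_def)
      show "independent ?S" using w P by (intro independent_insertI) (auto simp: P_def)
      show "?rk c < Suc d" if "c \<in> ?S" for c
        using that P d by (auto simp: P_def intro: less_SucI)
      show "x b - lam x *s b \<in> span {c \<in> ?S. ?rk c < ?rk b}" if "b \<in> ?S" "x \<in> h" for b x
      proof (cases "b = w")
        case True
        then show ?thesis using w(3) that(2) by (simp only: ltw)
      next
        case False
        then have "b \<in> S" using that by simp
        then show ?thesis
          using P that(2) by (simp only: lt) (simp add: P_def)
      qed
    qed
    then show ?case using card by blast
  qed
  from this[OF order_refl] obtain S rk where P: "P S rk" and "card S = dim W" by blast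
  then have "W \<subseteq> span S"
    using card_eq_dim[of S W] finiteI_independent by (auto simp: P_def)
  moreover have "span S \<subseteq> W"
    using P sW by (intro span_minimal) (auto simp: P_def)
  ultimately show thesis
    using P by (intro that[of S rk]) (auto simp: weight_basis_def P_def)
qed

lemma weight_basis_Un:
  assumes 1: "weight_basis K S1 rk1 wt1" and 2: "weight_basis I S2 rk2 wt2"
    and KI: "K \<inter> I = {0}" and W: "W = {a + b |a b. a \<in> K \<and> b \<in> I}"
  shows "weight_basis W (S1 \<union> S2) (\<lambda>b. if b \<in> S1 then rk1 b else rk2 b)
           (\<lambda>b. if b \<in> S1 then wt1 b else wt2 b)"
    (is "weight_basis W ?S ?rk ?wt")
proof -
  have i1: "independent S1" and s1: "span S1 = K" and i2: "independent S2" and s2: "span S2 = I"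
    using 1 2 by (auto simp: weight_basis_def)
  have disj: "b \<notin> S1" if "b \<in> S2" for b
  proof
    assume "b \<in> S1"
    then have "b = 0" using that KI s1 s2 span_base by blast
    then show False using i2 that dependent_zero by blast
  qed
  have "span ?S = W"
    unfolding W s1[symmetric] s2[symmetric] by (rule span_Un)
  moreover have "independent ?S"
  proof -
    have f: "finite S1" "finite S2" using i1 i2 finiteI_independent by auto
    have "u b = 0" if u: "(\<Sum>b\<in>?S. u b *s b) = 0" and b: "b \<in> ?S" for u b
    proof -
      have "(\<Sum>b\<in>?S. u b *s b) = (\<Sum>b\<in>S1. u b *s b) + (\<Sum>b\<in>S2. u b *s b)"
        using disj f by (intro sum.union_disjoint) auto
      then have eq: "(\<Sum>b\<in>S1. u b *s b) = - (\<Sum>b\<in>S2. u b *s b)"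
        using u by (simp add: eq_neg_iff_add_eq_0)
      have "(\<Sum>b\<in>S1. u b *s b) \<in> K" "(\<Sum>b\<in>S2. u b *s b) \<in> I"
        unfolding s1[symmetric] s2[symmetric]
        by (rule span_sum, rule span_scale, rule span_base, assumption)+
      then have "(\<Sum>b\<in>S1. u b *s b) \<in> K \<inter> I"
        unfolding eq using s2 by (metis IntI eq span_neg)
      then have "(\<Sum>b\<in>S1. u b *s b) = 0" "(\<Sum>b\<in>S2. u b *s b) = 0"
        using KI eq by auto
      then show ?thesis
        using b i1 i2 f independentD[of S1 S1 u b] independentD[of S2 S2 u b] by blast
    qed
    then show ?thesis
      using f by (intro independent_if_scalars_zero) auto
  qed
  moreover have "x b - ?wt b x *s b \<in> span {c \<in> ?S. ?rk c < ?rk b \<and> ?wt c = ?wt b}"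
    if "b \<in> ?S" "x \<in> h" for b x
  proof (cases "b \<in> S1")
    case True
    then have "x b - wt1 b x *s b \<in> span {c \<in> S1. rk1 c < rk1 b \<and> wt1 c = wt1 b}"
      using 1 that by (auto simp: weight_basis_def)
    moreover have "{c \<in> S1. rk1 c < rk1 b \<and> wt1 c = wt1 b} \<subseteq> {c \<in> ?S. ?rk c < ?rk b \<and> ?wt c = ?wt b}"
      using True by auto
    ultimately show ?thesis
      using True span_mono by (simp only: if_True) blast
  next
    case False
    then have "x b - wt2 b x *s b \<in> span {c \<in> S2. rk2 c < rk2 b \<and> wt2 c = wt2 b}"
      using 2 that by (auto simp: weight_basis_def)
    moreover have "{c \<in> S2. rk2 c < rk2 b \<and> wt2 c = wt2 b} \<subseteq> {c \<in> ?S. ?rk c < ?rk b \<and> ?wt c = ?wt b}"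
      using False disj by auto
    ultimately show ?thesis
      using False span_mono by (simp only: if_False) blast
  qed
  ultimately show ?thesis by (simp add: weight_basis_def)
qed

text \<open>
  By induction on the dimension: if some operator has two eigenvalues on \<open>W\<close>, the Fitting decomposition
  splits \<open>W\<close> into smaller submodules.
\<close>

lemma weight_basis_exists:
  assumes "invariant W"
  shows "\<exists>S rk wt. weight_basis W S rk wt"
  using assms
proof (induction "dim W" arbitrary: W rule: less_induct)
  case less
  have sW: "subspace W" using less.prems by (simp add: invariant_def)
  let ?nil = "\<lambda>x \<mu>. \<exists>m. \<forall>v\<in>W. (shift x \<mu> ^^ m) v = 0"
  consider (zero) "W = {0}"
    | (split) "\<exists>x\<in>h. \<exists>\<mu>. \<exists>v\<in>W. v \<noteq> 0 \<and> x v = \<mu> *s v \<and> \<not> ?nil x \<mu>"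
    | (single) "W \<noteq> {0}" "\<not> (\<exists>x\<in>h. \<exists>\<mu>. \<exists>v\<in>W. v \<noteq> 0 \<and> x v = \<mu> *s v \<and> \<not> ?nil x \<mu>)"
    by argo
  then show ?case
  proof cases
    case zero
    then show ?thesis
      by (intro exI[of _ "{}"] exI) (simp add: weight_basis_def independent_empty)
  next
    case split
    then obtain x \<mu> v where split: "x \<in> h" "v \<in> W" "v \<noteq> 0" "x v = \<mu> *s v" "\<not> ?nil x \<mu>"
      by (elim bexE exE conjE)
    obtain K I m where KI: "invariant K" "invariant I" "K \<inter> I = {0}" "K \<subseteq> W" "I \<subseteq> W"
        "\<forall>v\<in>W. \<exists>a\<in>K. \<exists>b\<in>I. v = a + b"
        "\<forall>v\<in>K. (shift x \<mu> ^^ m) v = 0" "\<forall>v\<in>W. \<forall>j. (shift x \<mu> ^^ j) v = 0 \<longrightarrow> v \<in> K"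
      by (rule fitting_invariant[OF split(1) less.prems])
    have lt: "dim Y < dim W" if "invariant Y" "Y \<subseteq> W" "Y \<noteq> W" for Y
    proof -
      have "span Y = Y" "span W = W"
        using that sW by (simp_all add: invariant_def span_eq_iff)
      then have "span Y \<subset> span W" using that by (simp only: psubset_eq) simp
      then show ?thesis by (rule dim_psubset)
    qed
    have "K \<noteq> W" using split(5) KI(7) by iprover
    moreover have "I \<noteq> W"
    proof
      assume "I = W"
      have "(shift x \<mu> ^^ 1) v = 0" using split(4) by simp
      then have "v \<in> K" using KI(8) split(2) by blast
      then have "v \<in> K \<inter> I" using split(2) \<open>I = W\<close> by simp
      then show False using split(3) unfolding KI(3) by simp
    qed
    ultimately have "dim K < dim W" "dim I < dim W"
      using lt KI(1,2,4,5) by simp_all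
    then obtain S1 rk1 wt1 S2 rk2 wt2 where
      "weight_basis K S1 rk1 wt1" "weight_basis I S2 rk2 wt2"
      using less.hyps KI(1,2) by blast
    moreover have "W = {a + b |a b. a \<in> K \<and> b \<in> I}"
      using KI(4-6) subspace_add[OF sW] by blast
    ultimately show ?thesis
      using weight_basis_Un[OF _ _ KI(3)] by blast
  next
    case single
    have nil: "\<exists>\<mu>. ?nil x \<mu>" if x: "x \<in> h" for x
    proof -
      have "x ` W \<subseteq> W" using less.prems x by (auto simp: invariant_def)
      then obtain \<mu> v where v: "v \<in> W" "v \<noteq> 0" "x v = \<mu> *s v"
        by (rule eigenvector_exists[OF h_endo[OF x] sW _ single(1)])
      have "?nil x \<mu>"
      proof (rule ccontr)
        assume "\<not> ?nil x \<mu>"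
        with x v have "\<exists>x\<in>h. \<exists>\<mu>. \<exists>v\<in>W. v \<noteq> 0 \<and> x v = \<mu> *s v \<and> \<not> ?nil x \<mu>"
          by (intro bexI[of _ x] exI[of _ \<mu>] bexI[of _ v] conjI)
        with single(2) show False by (rule notE)
      qed
      then show ?thesis ..
    qed
    define lam where "lam x = (SOME \<mu>. ?nil x \<mu>)" for x
    have "?nil x (lam x)" if "x \<in> h" for x
      unfolding lam_def by (rule someI_ex[OF nil[OF that]])
    then obtain S rk where "weight_basis W S rk (\<lambda>_. lam)"
      by (rule weight_basis_single_weight[OF less.prems])
    then show ?thesis by iprover
  qed
qed


text \<open>
  For self-normalizing \<open>h\<close>, every traceless operator that is triangular in a weight basis and
  respects the weights lies in \<open>h\<close>: by descending induction on how far above the diagonal it lives,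
  as commutators with \<open>h\<close> move it further away from the diagonal.
\<close>

lemma weight_triangular_in_self_normalizing:
  assumes wb: "weight_basis UNIV S rk wt" and zero: "(\<lambda>_. 0) \<in> h"
    and self: "\<And>x. endo x \<Longrightarrow> endo_trace scale S x = 0 \<Longrightarrow> (\<And>y. y \<in> h \<Longrightarrow> commutator x y \<in> h) \<Longrightarrow> x \<in> h"
    and x: "endo x" "\<And>b. b \<in> S \<Longrightarrow> x b \<in> span {c \<in> S. rk c \<le> rk b \<and> wt c = wt b}"
    and tr: "endo_trace scale S x = 0"
  shows "x \<in> h"
proof -
  have ind: "independent S" and sp: "span S = UNIV" using wb by (auto simp: weight_basis_def)
  have fin: "finite S" using ind by (rule finiteI_independent)
  \<comment> \<open>\<open>N d\<close> consists of the operators that respect the weights and lower the rank of every basis vector by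
    at least \<open>d\<close>.\<close>
  define B where "B b d = {c \<in> S. rk c + d \<le> rk b \<and> wt c = wt b}" for b d
  define N where "N d = {x. endo x \<and> (\<forall>b\<in>S. x b \<in> span (B b d))}" for d
  have B_mono: "span (B c d) \<subseteq> span (B b (e + d))" if "c \<in> B b e" for b c d e
    by (rule span_mono) (use that in \<open>auto simp: B_def\<close>)
  have N_comp: "y u \<in> span (B b (e + d))" if y: "y \<in> N d" and u: "u \<in> span (B b e)" for y u b d e
  proof (rule endo_image_span[OF _ _ subspace_span u])
    show "endo y" using y by (simp add: N_def)
    fix c assume c: "c \<in> B b e"
    then have "c \<in> S" by (simp add: B_def)
    then have "y c \<in> span (B c d)" using y by (simp add: N_def)
    then show "y c \<in> span (B b (e + d))" using B_mono[OF c] by blast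
  qed
  have shift_comp: "shift y (wt b y) u \<in> span (B b (e + 1))"
    if y: "y \<in> h" and u: "u \<in> span (B b e)" for y u b e
  proof (rule endo_image_span[OF _ _ subspace_span u])
    show "endo (shift y (wt b y))" by (rule endo_shift[OF h_endo[OF y]])
    fix c assume c: "c \<in> B b e"
    then have "c \<in> S" "wt c = wt b" by (auto simp: B_def)
    then have "y c - wt b y *s c \<in> span {a \<in> S. rk a < rk c \<and> wt a = wt c}"
      using wb y by (auto simp: weight_basis_def)
    also have "{a \<in> S. rk a < rk c \<and> wt a = wt c} = B c 1"
      by (auto simp: B_def)
    finally show "y c - wt b y *s c \<in> span (B b (e + 1))" using B_mono[OF c] by blast
  qed
  have comm: "commutator x y \<in> N (Suc d)" if x: "x \<in> N d" and y: "y \<in> h" for x y d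
    unfolding N_def
  proof (intro CollectI conjI ballI)
    have ex: "endo x" using x by (simp add: N_def)
    show "endo (commutator x y)" using ex h_endo[OF y] by (rule endo_commutator)
    fix b assume b: "b \<in> S"
    let ?s = "shift y (wt b y)"
    have bB: "b \<in> span (B b 0)" using b by (intro span_base) (simp add: B_def)
    have "x (?s b) \<in> span (B b (0 + 1 + d))"
      by (rule N_comp[OF x shift_comp[OF y bB]])
    moreover have "?s (x b) \<in> span (B b (0 + d + 1))"
      by (rule shift_comp[OF y N_comp[OF x bB]])
    moreover have "commutator x y b = x (?s b) - ?s (x b)"
      using ex by (simp add: commutator_apply endo_diff endo_scale)
    ultimately show "commutator x y b \<in> span (B b (Suc d))"
      using span_diff by simp
  qed
  have tr0: "endo_trace scale S x = 0" if x: "x \<in> N (Suc d)" for x d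
    unfolding endo_trace_def
  proof (rule sum.neutral, rule ballI)
    fix b assume "b \<in> S"
    then have "x b \<in> span (B b (Suc d))" using x by (simp add: N_def)
    from representation_outside_span[OF ind _ this, of b]
    show "representation S (x b) b = 0" by (simp add: B_def)
  qed
  define M where "M = Suc (Max (insert 0 (rk ` S)))"
  have rkM: "rk b < M" if "b \<in> S" for b
    using fin that by (auto simp: M_def less_Suc_eq_le)
  have "x \<in> h" if "d + k = M" "x \<in> N d" "endo_trace scale S x = 0" for d k x
    using that
  proof (induction k arbitrary: d x)
    case 0
    have ex: "endo x" using 0 by (simp add: N_def)
    have "x b \<in> {0}" if b: "b \<in> S" for b
    proof -
      have "B b M = {}" using rkM[OF b] by (auto simp: B_def)
      moreover have "x b \<in> span (B b M)" using 0 b by (simp add: N_def)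
      ultimately show ?thesis by (simp only: span_empty)
    qed
    then have "x v \<in> {0}" for v
      by (rule endo_image_span[OF ex, where S = S]) (simp_all add: sp)
    then have "x = (\<lambda>_. 0)" by auto
    then show ?case using zero by simp
  next
    case (Suc k)
    show ?case
    proof (rule self)
      show "endo x" using Suc.prems by (simp add: N_def)
      fix y assume "y \<in> h"
      with Suc.prems have c: "commutator x y \<in> N (Suc d)" by (intro comm)
      show "commutator x y \<in> h"
        using Suc.prems by (intro Suc.IH[OF _ c tr0[OF c]]) simp
    qed (rule Suc.prems)
  qed
  from this[of 0 M x] show ?thesis
    using x tr by (simp add: N_def B_def)
qed


end

section \<open>Cartan subalgebras of the special linear algebra\<close>

lemma lie_gl_simps [simp]:
  "carrier (lie_gl scale) = {f. Vector_Spaces.linear scale scale f}"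
  "zero (lie_gl scale) = (\<lambda>_. 0)"
  "add (lie_gl scale) = (\<lambda>f g v. f v + g v)"
  "smult (lie_gl scale) = (\<lambda>c f v. scale c (f v))"
  "bracket (lie_gl scale) = commutator"
  by (simp_all add: lie_gl_def commutator_def fun_eq_iff)

lemma lie_sl_simps [simp]:
  "carrier (lie_sl scale B) = {f. Vector_Spaces.linear scale scale f \<and> endo_trace scale B f = 0}"
  "zero (lie_sl scale B) = (\<lambda>_. 0)"
  "add (lie_sl scale B) = (\<lambda>f g v. f v + g v)"
  "smult (lie_sl scale B) = (\<lambda>c f v. scale c (f v))"
  "bracket (lie_sl scale B) = commutator"
  by (simp_all add: lie_sl_def)

lemma bracket_span_subset:
  assumes "vectorspace class_ring L" "\<And>x y. x \<in> A \<Longrightarrow> y \<in> B \<Longrightarrow> bracket L x y \<in> carrier L"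
  shows "bracket_span L A B \<subseteq> carrier L"
proof -
  interpret vectorspace class_ring L by fact
  show ?thesis
    unfolding bracket_span_def
    by (rule subsetI, rule span_closed[rotated], assumption) (use assms(2) in blast)
qed

lemma bracket_in_bracket_span:
  assumes "vectorspace class_ring L" "\<And>x y. x \<in> A \<Longrightarrow> y \<in> B \<Longrightarrow> bracket L x y \<in> carrier L"
    and "x \<in> A" "y \<in> B"
  shows "bracket L x y \<in> bracket_span L A B"
proof -
  interpret vectorspace class_ring L by fact
  show ?thesis
    unfolding bracket_span_def by (rule span_mem) (use assms(2-4) in blast)+
qed

context closed_field_space
begin

text \<open>
  The basis \<open>S\<close> is a weight basis; diagonal operators are triangular and respect the weights. The trace,
  hence \<open>sl(V)\<close>, does not depend on the basis in which it is computed.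
\<close>

lemma cartan_subalgebra_diagonal:
  assumes h: "cartan_subalgebra h (lie_sl scale Basis)"
  obtains S where "finite_dimensional_vector_space scale S"
    "\<forall>x c. endo x \<longrightarrow> (\<forall>b\<in>S. x b = c b *s b) \<longrightarrow> (\<Sum>b\<in>S. c b) = 0 \<longrightarrow> x \<in> h"
proof -
  have sub: "VectorSpace.subspace class_ring h (lie_sl scale Basis)"
    and closed: "\<And>x y. x \<in> h \<Longrightarrow> y \<in> h \<Longrightarrow> commutator x y \<in> h"
    and norm: "lie_normalizer (lie_sl scale Basis) h = h"
    and nil: "lie_nilpotent ((lie_sl scale Basis)\<lparr>carrier := h\<rparr>)"
    using h by (simp_all add: cartan_subalgebra_def lie_subalgebra_def)
  let ?L = "(lie_sl scale Basis)\<lparr>carrier := h\<rparr>"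
  have hc: "h \<subseteq> carrier (lie_sl scale Basis)" and zero: "(\<lambda>_. 0) \<in> h"
    using sub submodule.zero_closed[of class_ring h "lie_sl scale Basis"]
    by (simp_all only: VectorSpace.subspace_def submodule_def lie_sl_simps)
  have vs: "vectorspace class_ring ?L"
    using sub by (intro vectorspace.subspace_is_vs) (simp_all add: VectorSpace.subspace_def)
  obtain n where n: "lower_central_series ?L n = {\<lambda>_. 0}"
    using nil by (auto simp: lie_nilpotent_def)
  have Ch: "lower_central_series ?L j \<subseteq> h" for j
  proof (induction j)
    case (Suc j)
    then show ?case
      using bracket_span_subset[OF vs, of h "lower_central_series ?L j"] closed by auto
  qed simp
  interpret nilpotent_operators scale Basis h "lower_central_series ?L" n
  proof (intro nilpotent_operators.intro nilpotent_operators_axioms.intro closed_field_space_axioms)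
    show "endo x" if "x \<in> h" for x using hc that by auto
    show "lower_central_series ?L 0 = h" by simp
    show "lower_central_series ?L j \<subseteq> h" for j by (rule Ch)
    show "y v = 0" if "y \<in> lower_central_series ?L n" for y v
      using that by (simp add: n)
    show "commutator x y \<in> lower_central_series ?L (Suc j)"
      if "x \<in> h" "y \<in> lower_central_series ?L j" for x y j
      using bracket_in_bracket_span[OF vs, of h "lower_central_series ?L j" x y] that closed Ch by auto
  qed
  have "invariant UNIV" by (simp add: invariant_def)
  then obtain S rk wt where wb: "weight_basis UNIV S rk wt"
    using weight_basis_exists by blast
  have ind: "independent S" and sp: "span S = UNIV" using wb by (auto simp: weight_basis_def)
  have fin: "finite S" using ind by (rule finiteI_independent)
  have S: "finite_dimensional_vector_space scale S"
    by (intro finite_dimensional_vector_space.intro vector_space_axioms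
        finite_dimensional_vector_space_axioms.intro ind sp fin)
  have tr: "endo_trace scale S x = endo_trace scale Basis x" if "endo x" for x
    by (rule endo_trace_basis_independent[OF S finite_dimensional_vector_space_axioms that])
  show thesis
  proof (rule that[OF S], intro allI impI)
    fix x c assume x: "endo x" and xS: "\<forall>b\<in>S. x b = c b *s b" and c: "(\<Sum>b\<in>S. c b) = 0"
    have "y \<in> h"
      if y: "endo y" "endo_trace scale S y = 0" "\<And>z. z \<in> h \<Longrightarrow> commutator y z \<in> h" for y
    proof -
      have "endo_trace scale Basis y = 0" using y tr by simp
      then have "y \<in> lie_normalizer (lie_sl scale Basis) h"
        using y unfolding lie_normalizer_def by simp
      then show ?thesis by (simp only: norm)
    qed
    moreover have "x b \<in> span {c \<in> S. rk c \<le> rk b \<and> wt c = wt b}" if b: "b \<in> S" for b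
    proof -
      have "b \<in> span {c \<in> S. rk c \<le> rk b \<and> wt c = wt b}"
        using b by (intro span_base) simp
      then show ?thesis by (simp only: bspec[OF xS b] span_scale)
    qed
    moreover have "endo_trace scale S x = 0"
    proof -
      have "representation S (x b) b = c b" if b: "b \<in> S" for b
      proof -
        have "representation S (c b *s b) b = c b"
          using b by (simp add: representation_scale[OF ind] representation_basis[OF ind] sp)
        then show ?thesis by (simp only: bspec[OF xS b])
      qed
      then have "endo_trace scale S x = (\<Sum>b\<in>S. c b)"
        unfolding endo_trace_def by (rule sum.cong[OF refl])
      then show ?thesis using c by simp
    qed
    ultimately show "x \<in> h"
      using weight_triangular_in_self_normalizing[OF wb zero _ x] by iprover
  qed
qed

end

section \<open>Split extensions of Lie algebras\<close>

context lie_algebra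
begin

lemma bracket_zero_right: "x \<in> carrier L \<Longrightarrow> bracket L x \<zero> = \<zero>"
  using bracket_add_right[of x \<zero> \<zero>] bracket_closed[of x \<zero>] add.l_cancel_one'[of "bracket L x \<zero>" "bracket L x \<zero>"]
  by simp

lemma bracket_anti: "x \<in> carrier L \<Longrightarrow> y \<in> carrier L \<Longrightarrow> bracket L x y = \<ominus> bracket L y x"
proof -
  assume x: "x \<in> carrier L" and y: "y \<in> carrier L"
  have eq: "bracket L (x \<oplus> y) (x \<oplus> y) = bracket L x y \<oplus> bracket L y x"
    using x y by (simp add: bracket_add_left bracket_add_right bracket_self[OF x] bracket_self[OF y]
        bracket_closed a_comm)
  then have "bracket L x y \<oplus> bracket L y x = \<zero>"
    unfolding eq[symmetric] using x y by (intro bracket_self a_closed)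
  then show ?thesis
    using x y bracket_closed add.inv_equality by simp
qed

lemma bracket_minus_right:
  assumes "x \<in> carrier L" "y \<in> carrier L"
  shows "bracket L x (\<ominus> y) = \<ominus> bracket L x y"
proof -
  have "bracket L x (\<ominus> y) \<oplus> bracket L x y = \<zero>"
    using bracket_add_right[of x "\<ominus> y" y] assms by (simp add: bracket_zero_right l_neg)
  then show ?thesis
    using assms bracket_closed add.inv_equality by simp
qed

text \<open>The Jacobi identity says that \<open>bracket L x\<close> is a derivation.\<close>

lemma bracket_derivation:
  assumes x: "x \<in> carrier L" and y: "y \<in> carrier L" and z: "z \<in> carrier L"
  shows "bracket L x (bracket L y z) = bracket L (bracket L x y) z \<oplus> bracket L y (bracket L x z)"
proof -
  note c = bracket_closed
  let ?a = "bracket L x (bracket L y z)" and ?b = "bracket L y (bracket L x z)"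
    and ?c = "bracket L (bracket L x y) z"
  have "bracket L y (bracket L z x) = \<ominus> ?b"
    using assms c by (subst bracket_anti[of z x]) (simp_all add: bracket_minus_right)
  moreover have "bracket L z (bracket L x y) = \<ominus> ?c"
    using assms c by (intro bracket_anti) simp_all
  ultimately have "?a \<oplus> (\<ominus> ?b \<oplus> \<ominus> ?c) = \<zero>"
    using jacobi[OF assms] assms c by (simp add: a_assoc)
  then have "?a = \<ominus> (\<ominus> ?b \<oplus> \<ominus> ?c)"
    using assms c by (intro minus_equality[symmetric]) (simp_all add: a_comm)
  also have "\<dots> = ?c \<oplus> ?b"
    using assms c by (simp add: minus_add a_comm)
  finally show ?thesis .
qed

lemma bracket_commute_actions:
  assumes x: "x \<in> carrier L" and y: "y \<in> carrier L" and z: "z \<in> carrier L"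
  shows "bracket L (bracket L x y) z = bracket L x (bracket L y z) \<ominus> bracket L y (bracket L x z)"
  using assms bracket_closed by (subst bracket_derivation[OF assms]) (simp add: minus_eq a_assoc r_neg)

lemma lie_idealD:
  assumes "lie_ideal I L"
  shows "subspace class_ring I L" "I \<subseteq> carrier L" "\<zero> \<in> I"
    "\<And>x y. x \<in> I \<Longrightarrow> y \<in> I \<Longrightarrow> x \<oplus> y \<in> I"
    "\<And>c x. x \<in> I \<Longrightarrow> c \<odot>\<^bsub>L\<^esub> x \<in> I"
    "\<And>x. x \<in> I \<Longrightarrow> \<ominus> x \<in> I"
    "\<And>x y. x \<in> carrier L \<Longrightarrow> y \<in> I \<Longrightarrow> bracket L x y \<in> I"
proof -
  show s: "subspace class_ring I L" and "\<And>x y. x \<in> carrier L \<Longrightarrow> y \<in> I \<Longrightarrow> bracket L x y \<in> I"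
    using assms by (auto simp: lie_ideal_def)
  then interpret I: submodule class_ring I L by (simp add: subspace_def)
  show "I \<subseteq> carrier L" "\<zero> \<in> I"
    "\<And>x y. x \<in> I \<Longrightarrow> y \<in> I \<Longrightarrow> x \<oplus> y \<in> I"
    "\<And>c x. x \<in> I \<Longrightarrow> c \<odot>\<^bsub>L\<^esub> x \<in> I"
    using I.subset by auto
  then show "\<ominus> x \<in> I" if "x \<in> I" for x
    using smult_minus_1[of x] that \<open>I \<subseteq> carrier L\<close> by (metis subsetD)
qed

text \<open>Subtraction, unlike addition, is defined in terms of the carrier.\<close>

lemma ideal_a_minus:
  assumes "lie_ideal I L" "x \<in> I" "y \<in> I"
  shows "x \<ominus>\<^bsub>L\<lparr>carrier := I\<rparr>\<^esub> y = x \<ominus> y"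
proof -
  note I = lie_idealD[OF assms(1)]
  interpret I: vectorspace class_ring "L\<lparr>carrier := I\<rparr>"
    by (rule subspace_is_vs[OF I(1)])
  have "\<ominus>\<^bsub>L\<lparr>carrier := I\<rparr>\<^esub> y = \<ominus> y"
    using I.minus_equality[of "\<ominus> y" y] I assms l_neg[of y] by auto
  then show ?thesis by (simp add: I.minus_eq minus_eq)
qed

text \<open>
  An extension of \<open>S\<close> by the ideal \<open>I\<close> that is split by a homomorphism \<open>\<sigma>\<close> is the semidirect product
  of \<open>I\<close> and \<open>S\<close>, in which \<open>S\<close> acts on \<open>I\<close> through \<open>\<sigma>\<close> and the bracket. That \<open>S\<close> is a Lie algebra
  follows from the other hypotheses, and need not be assumed.
\<close>

lemma split_extension_semidirect:
  fixes S :: "('k, 'b, 'n) lie_algebra_scheme"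
  assumes I: "lie_ideal I L"
    and \<psi>: "\<psi> \<in> LinearCombinations.module_hom class_ring L S"
    and \<psi>_bracket: "\<And>x y. x \<in> carrier L \<Longrightarrow> y \<in> carrier L \<Longrightarrow> \<psi> (bracket L x y) = bracket S (\<psi> x) (\<psi> y)"
    and \<sigma>: "\<sigma> \<in> LinearCombinations.module_hom class_ring S L"
    and \<sigma>_bracket: "\<And>s t. s \<in> carrier S \<Longrightarrow> t \<in> carrier S \<Longrightarrow> \<sigma> (bracket S s t) = bracket L (\<sigma> s) (\<sigma> t)"
    and S_zero: "\<And>s. s \<in> carrier S \<Longrightarrow> \<zero>\<^bsub>S\<^esub> \<oplus>\<^bsub>S\<^esub> s = s"
    and \<psi>_\<sigma>: "\<And>s. s \<in> carrier S \<Longrightarrow> \<psi> (\<sigma> s) = s"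
    and \<psi>_ker: "\<And>x. x \<in> I \<Longrightarrow> \<psi> x = \<zero>\<^bsub>S\<^esub>"
    and compl: "\<And>x. x \<in> carrier L \<Longrightarrow> x \<ominus> \<sigma> (\<psi> x) \<in> I"
  shows "\<exists>\<theta>. lie_derivation_action S (L\<lparr>carrier := I\<rparr>) \<theta> \<and>
      lie_isomorphic L (lie_semidirect (L\<lparr>carrier := I\<rparr>) S \<theta>)"
proof -
  define \<theta> where "\<theta> s x = bracket L (\<sigma> s) x" for s x
  note ID = lie_idealD[OF I]
  note minus = ideal_a_minus[OF I]
  note c = bracket_closed
  have IL: "x \<in> carrier L" if "x \<in> I" for x using that ID by blast
  have \<psi>S: "\<psi> x \<in> carrier S" if "x \<in> carrier L" for x
    using LinearCombinations.module_hom_closed[OF \<psi>] that by auto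
  have \<sigma>L: "\<sigma> s \<in> carrier L" if "s \<in> carrier S" for s
    using LinearCombinations.module_hom_closed[OF \<sigma>] that by auto
  have \<psi>_add: "\<psi> (x \<oplus> y) = \<psi> x \<oplus>\<^bsub>S\<^esub> \<psi> y" if "x \<in> carrier L" "y \<in> carrier L" for x y
    using LinearCombinations.module_hom_add[OF \<psi>] that by simp
  have \<sigma>_add: "\<sigma> (s \<oplus>\<^bsub>S\<^esub> t) = \<sigma> s \<oplus> \<sigma> t" if "s \<in> carrier S" "t \<in> carrier S" for s t
    using LinearCombinations.module_hom_add[OF \<sigma>] that by simp
  have \<psi>_smult: "\<psi> (k \<odot>\<^bsub>L\<^esub> x) = k \<odot>\<^bsub>S\<^esub> \<psi> x" if "x \<in> carrier L" for x k
    using LinearCombinations.module_hom_smult[OF \<psi>] that by simp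
  have \<sigma>_smult: "\<sigma> (k \<odot>\<^bsub>S\<^esub> s) = k \<odot>\<^bsub>L\<^esub> \<sigma> s" if "s \<in> carrier S" for s k
    using LinearCombinations.module_hom_smult[OF \<sigma>] that by simp
  have \<theta>I: "\<theta> s x \<in> I" if "s \<in> carrier S" "x \<in> I" for s x
    unfolding \<theta>_def by (rule ID(7)[OF \<sigma>L[OF that(1)] that(2)])
  have action: "lie_derivation_action S (L\<lparr>carrier := I\<rparr>) \<theta>"
    unfolding lie_derivation_action_def
  proof (intro conjI ballI allI)
    fix s assume s: "s \<in> carrier S"
    show "lie_derivation (L\<lparr>carrier := I\<rparr>) (\<theta> s)"
      unfolding lie_derivation_def LinearCombinations.module_hom_def
    proof (intro conjI ballI allI CollectI impI)
      show "\<theta> s \<in> carrier (L\<lparr>carrier := I\<rparr>) \<rightarrow> carrier (L\<lparr>carrier := I\<rparr>)"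
        using \<theta>I s by simp
    next
      fix x y assume "x \<in> carrier (L\<lparr>carrier := I\<rparr>)" "y \<in> carrier (L\<lparr>carrier := I\<rparr>)"
      then show "\<theta> s (bracket (L\<lparr>carrier := I\<rparr>) x y) = bracket (L\<lparr>carrier := I\<rparr>) (\<theta> s x) y
          \<oplus>\<^bsub>L\<lparr>carrier := I\<rparr>\<^esub> bracket (L\<lparr>carrier := I\<rparr>) x (\<theta> s y)"
        using bracket_derivation[OF \<sigma>L[OF s], of x y] by (simp add: \<theta>_def IL)
    qed (simp_all add: \<theta>_def \<sigma>L s IL bracket_add_right bracket_smult_right)
  next
    fix s t x
    assume s: "s \<in> carrier S" and t: "t \<in> carrier S" and x: "x \<in> carrier (L\<lparr>carrier := I\<rparr>)"
    then have x: "x \<in> I" by simp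
    show "\<theta> (s \<oplus>\<^bsub>S\<^esub> t) x = \<theta> s x \<oplus>\<^bsub>L\<lparr>carrier := I\<rparr>\<^esub> \<theta> t x"
      by (simp add: \<theta>_def \<sigma>_add \<sigma>L s t IL x bracket_add_left)
    have "\<theta> (bracket S s t) x = \<theta> s (\<theta> t x) \<ominus> \<theta> t (\<theta> s x)"
      unfolding \<theta>_def \<sigma>_bracket[OF s t] using s t x
      by (intro bracket_commute_actions \<sigma>L IL)
    then show "\<theta> (bracket S s t) x = \<theta> s (\<theta> t x) \<ominus>\<^bsub>L\<lparr>carrier := I\<rparr>\<^esub> \<theta> t (\<theta> s x)"
      using minus[OF \<theta>I[OF s \<theta>I[OF t x]] \<theta>I[OF t \<theta>I[OF s x]]] by simp
  next
    fix k s x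
    assume s: "s \<in> carrier S" and x: "x \<in> carrier (L\<lparr>carrier := I\<rparr>)"
    then show "\<theta> (k \<odot>\<^bsub>S\<^esub> s) x = k \<odot>\<^bsub>L\<lparr>carrier := I\<rparr>\<^esub> \<theta> s x"
      by (simp add: \<theta>_def \<sigma>_smult \<sigma>L IL bracket_smult_left)
  qed
  \<comment> \<open>The isomorphism; its inverse takes \<open>(x, s)\<close> to \<open>x + \<sigma> s\<close>.\<close>
  define \<phi> where "\<phi> x = (x \<ominus> \<sigma> (\<psi> x), \<psi> x)" for x
  let ?M = "lie_semidirect (L\<lparr>carrier := I\<rparr>) S \<theta>"
  have M: "carrier ?M = I \<times> carrier S"
    by (simp add: lie_semidirect_def)
  have inv: "\<phi> (x \<oplus> \<sigma> s) = (x, s)" if "x \<in> I" "s \<in> carrier S" for x s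
    using that S_zero \<psi>_ker \<psi>_\<sigma>
    by (simp add: \<phi>_def \<psi>_add IL \<sigma>L minus_eq a_assoc r_neg)
  have decomp: "(x \<ominus> \<sigma> (\<psi> x)) \<oplus> \<sigma> (\<psi> x) = x" if "x \<in> carrier L" for x
    using that \<psi>S \<sigma>L by (simp add: minus_eq a_assoc l_neg)
  have "bij_betw \<phi> (carrier L) (carrier ?M)"
    unfolding M
  proof (rule bij_betw_byWitness[where f' = "\<lambda>(x, s). x \<oplus> \<sigma> s"])
    show "\<forall>x\<in>carrier L. (case \<phi> x of (x, s) \<Rightarrow> x \<oplus> \<sigma> s) = x"
      using decomp by (simp add: \<phi>_def)
    show "\<forall>p\<in>I \<times> carrier S. \<phi> (case p of (x, s) \<Rightarrow> x \<oplus> \<sigma> s) = p"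
      using inv by auto
    show "\<phi> ` carrier L \<subseteq> I \<times> carrier S"
      using compl \<psi>S by (auto simp: \<phi>_def)
    show "(\<lambda>(x, s). x \<oplus> \<sigma> s) ` (I \<times> carrier S) \<subseteq> carrier L"
      using IL \<sigma>L by auto
  qed
  moreover have "\<phi> \<in> LinearCombinations.module_hom class_ring L ?M"
    unfolding LinearCombinations.module_hom_def
  proof (intro CollectI conjI allI impI)
    show "\<phi> \<in> carrier L \<rightarrow> carrier ?M"
      using compl \<psi>S by (auto simp: \<phi>_def M)
  next
    fix x y assume "x \<in> carrier L \<and> y \<in> carrier L"
    then show "\<phi> (x \<oplus> y) = \<phi> x \<oplus>\<^bsub>?M\<^esub> \<phi> y"
      by (simp add: \<phi>_def lie_semidirect_def \<psi>_add \<sigma>_add \<psi>S \<sigma>L minus_eq minus_add a_ac)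
  next
    fix k :: 'k and x assume "k \<in> carrier class_ring \<and> x \<in> carrier L"
    then have x: "x \<in> carrier L" by simp
    then have "k \<odot>\<^bsub>L\<^esub> (x \<ominus> \<sigma> (\<psi> x)) = k \<odot>\<^bsub>L\<^esub> x \<ominus> k \<odot>\<^bsub>L\<^esub> \<sigma> (\<psi> x)"
      using \<psi>S \<sigma>L by (simp add: minus_eq smult_r_distr smult_r_minus)
    then show "\<phi> (k \<odot>\<^bsub>L\<^esub> x) = k \<odot>\<^bsub>?M\<^esub> \<phi> x"
      using x by (simp add: \<phi>_def lie_semidirect_def \<psi>_smult \<sigma>_smult \<psi>S)
  qed
  moreover have "\<phi> (bracket L x y) = bracket ?M (\<phi> x) (\<phi> y)" if x: "x \<in> carrier L" and y: "y \<in> carrier L" for x y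
  proof -
    define u p v q where "u = x \<ominus> \<sigma> (\<psi> x)" and "p = \<sigma> (\<psi> x)" and "v = y \<ominus> \<sigma> (\<psi> y)" and "q = \<sigma> (\<psi> y)"
    have uv: "u \<in> I" "v \<in> I" and uvL: "u \<in> carrier L" "v \<in> carrier L"
      using compl x y IL by (auto simp: u_def v_def)
    have pq: "p \<in> carrier L" "q \<in> carrier L"
      using \<psi>S \<sigma>L x y by (auto simp: p_def q_def)
    have xy: "x = u \<oplus> p" "y = v \<oplus> q"
      using decomp x y by (auto simp: u_def v_def p_def q_def)
    have "bracket L x y = (bracket L u v \<oplus> bracket L p v \<oplus> bracket L u q) \<oplus> bracket L p q"
      using uvL pq c by (simp add: xy bracket_add_left bracket_add_right a_ac)
    then have "bracket L x y \<ominus> bracket L p q = bracket L u v \<oplus> bracket L p v \<oplus> bracket L u q"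
      using uvL pq c by (simp add: minus_eq a_assoc r_neg)
    also have "bracket L u q = \<ominus> bracket L q u"
      by (rule bracket_anti[OF uvL(1) pq(2)])
    finally have "bracket L x y \<ominus> bracket L p q
        = bracket L u v \<oplus> bracket L p v \<ominus>\<^bsub>L\<lparr>carrier := I\<rparr>\<^esub> bracket L q u"
      using minus[of "bracket L u v \<oplus> bracket L p v" "bracket L q u"] uv uvL pq ID
      by (simp add: minus_eq)
    moreover have "\<sigma> (\<psi> (bracket L x y)) = bracket L p q"
      using x y \<psi>S by (simp add: \<psi>_bracket \<sigma>_bracket p_def q_def)
    ultimately show ?thesis
      using x y
      by (simp add: \<phi>_def lie_semidirect_def \<psi>_bracket \<theta>_def u_def v_def p_def q_def)
  qed
  ultimately have "lie_isomorphic L ?M"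
    unfolding lie_isomorphic_def by (intro bexI[of _ \<phi>] conjI ballI)
  with action show ?thesis by blast
qed

end

section \<open>Quotient spaces\<close>

lemma vector_space_record_simps [simp]:
  "carrier (vector_space_record scale) = UNIV"
  "zero (vector_space_record scale) = 0"
  "add (vector_space_record scale) = (+)"
  "smult (vector_space_record scale) = scale"
  by (simp_all add: vector_space_record_def)

text \<open>The coset of \<open>U\<close> that contains \<open>a\<close>, independent of any record.\<close>

definition translate :: "'a::ab_group_add set \<Rightarrow> 'a \<Rightarrow> 'a set" where
  "translate U a = (\<lambda>u. u + a) ` U"

text \<open>The quotient of the subspace \<open>W\<close> by the subspace \<open>U\<close>.\<close>

abbreviation vs_quotient ::
    "('k::field \<Rightarrow> 'a::ab_group_add \<Rightarrow> 'a) \<Rightarrow> 'a set \<Rightarrow> 'a set \<Rightarrow> ('k, 'a set) module" where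
  "vs_quotient scale W U \<equiv> quotient_space ((vector_space_record scale)\<lparr>carrier := W\<rparr>) U"

context vector_space
begin

lemma vectorspace_record: "vectorspace class_ring (vector_space_record scale)"
proof -
  have ab: "abelian_group (vector_space_record scale)"
    by (rule abelian_groupI) (auto simp: add_ac intro: exI[of _ "- _"])
  have "Module.module class_ring (vector_space_record scale)"
    by (rule moduleI[OF field.axioms(1)[THEN domain.axioms(1), OF Defs.class_field] ab])
      (auto simp: scale_left_distrib scale_right_distrib)
  then show ?thesis by (simp add: vectorspace_def Defs.class_field)
qed

lemma subspace_record_iff:
  "VectorSpace.subspace class_ring W (vector_space_record scale) \<longleftrightarrow> subspace W"
proof
  assume "VectorSpace.subspace class_ring W (vector_space_record scale)"
  then interpret submodule class_ring W "vector_space_record scale"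
    by (simp add: VectorSpace.subspace_def)
  show "subspace W"
    using m_closed zero_closed smult_closed by (intro subspaceI) simp_all
next
  assume W: "subspace W"
  interpret R: vectorspace class_ring "vector_space_record scale" by (rule vectorspace_record)
  show "VectorSpace.subspace class_ring W (vector_space_record scale)"
    using W R.module_axioms R.vectorspace_axioms
    by (simp add: VectorSpace.subspace_def submodule_def subspace_0 subspace_add subspace_scale)
qed

lemma mem_translate: "subspace U \<Longrightarrow> x \<in> translate U a \<longleftrightarrow> x - a \<in> U"
  unfolding translate_def by (auto simp: image_iff) (metis diff_add_cancel)

lemma translate_eq_iff: "subspace U \<Longrightarrow> translate U a = translate U b \<longleftrightarrow> a - b \<in> U"
proof
  assume U: "subspace U" and "translate U a = translate U b"
  moreover have "a \<in> translate U a" using U by (simp add: mem_translate subspace_0)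
  ultimately show "a - b \<in> U" by (simp add: mem_translate)
next
  assume U: "subspace U" and ab: "a - b \<in> U"
  have "x - a \<in> U \<longleftrightarrow> x - b \<in> U" for x
    using subspace_add[OF U _ ab, of "x - a"] subspace_diff[OF U _ ab, of "x - b"] by auto
  then show "translate U a = translate U b"
    using U by (auto simp: mem_translate)
qed

lemma a_r_coset_eq_translate: "a_r_coset ((vector_space_record scale)\<lparr>carrier := W\<rparr>) U a = translate U a"
  by (auto simp: a_r_coset_def r_coset_def translate_def)

lemma set_add_translate:
  assumes "subspace U"
  shows "set_add ((vector_space_record scale)\<lparr>carrier := W\<rparr>) (translate U a) (translate U b) = translate U (a + b)"
proof -
  have "set_add ((vector_space_record scale)\<lparr>carrier := W\<rparr>) (translate U a) (translate U b)
      = {u + a + (v + b) |u v. u \<in> U \<and> v \<in> U}"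
    by (auto simp: set_add_def set_mult_def translate_def)
  also have "\<dots> = translate U (a + b)"
  proof (intro equalityI subsetI)
    fix x assume "x \<in> {u + a + (v + b) |u v. u \<in> U \<and> v \<in> U}"
    then obtain u v where "x = (u + v) + (a + b)" "u \<in> U" "v \<in> U" by (auto simp: ac_simps)
    then show "x \<in> translate U (a + b)" using subspace_add[OF assms] by (auto simp: translate_def)
  next
    fix x assume "x \<in> translate U (a + b)"
    then obtain u where "x = u + a + (0 + b)" "u \<in> U" by (auto simp: translate_def ac_simps)
    then show "x \<in> {u + a + (v + b) |u v. u \<in> U \<and> v \<in> U}"
      using subspace_0[OF assms] by blast
  qed
  finally show ?thesis .
qed

text \<open>
  For a map that is compatible with the cosets, the union that defines an operation on cosets is the coset
  of the result on any representative.
\<close>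

lemma Union_translate_map:
  assumes U: "subspace U" and f: "\<And>x y. f (x - y) = f x - f y" "\<And>u. u \<in> U \<Longrightarrow> f u \<in> U"
  shows "(\<Union>x\<in>translate U a. translate U (f x)) = translate U (f a)"
proof -
  have "translate U (f x) = translate U (f a)" if "x \<in> translate U a" for x
    using that f(2)[of "x - a"] by (simp add: translate_eq_iff mem_translate U f(1))
  moreover have "a \<in> translate U a" using U by (simp add: mem_translate subspace_0)
  ultimately show ?thesis by blast
qed

lemma carrier_quot: "carrier (vs_quotient scale W U) = translate U ` W"
  by (auto simp: quotient_space_def A_RCOSETS_def' a_r_coset_eq_translate)

lemma quot_ops:
  assumes "subspace U"
  shows "\<zero>\<^bsub>vs_quotient scale W U\<^esub> = translate U 0"
    "translate U a \<oplus>\<^bsub>vs_quotient scale W U\<^esub> translate U b = translate U (a + b)"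
    "c \<odot>\<^bsub>vs_quotient scale W U\<^esub> translate U a = translate U (c *s a)"
proof -
  show "\<zero>\<^bsub>vs_quotient scale W U\<^esub> = translate U 0"
    by (simp add: quotient_space_def translate_def)
  show "translate U a \<oplus>\<^bsub>vs_quotient scale W U\<^esub> translate U b = translate U (a + b)"
    using set_add_translate[OF assms] by (simp add: quotient_space_def)
  show "c \<odot>\<^bsub>vs_quotient scale W U\<^esub> translate U a = translate U (c *s a)"
    using Union_translate_map[OF assms, of "\<lambda>x. c *s x" a] assms
    by (simp add: quotient_space_def a_r_coset_eq_translate scale_right_diff_distrib subspace_scale)
qed

lemma vectorspace_quot:
  assumes U: "subspace U" and W: "subspace W"
  shows "vectorspace class_ring (vs_quotient scale W U)"
proof -
  note ops = quot_ops[OF U]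
  have ab: "abelian_group (vs_quotient scale W U)"
  proof (rule abelian_groupI)
    fix x assume "x \<in> carrier (vs_quotient scale W U)"
    then obtain a where "a \<in> W" "x = translate U a" by (auto simp: carrier_quot)
    then show "\<exists>y\<in>carrier (vs_quotient scale W U). y \<oplus>\<^bsub>vs_quotient scale W U\<^esub> x = \<zero>\<^bsub>vs_quotient scale W U\<^esub>"
      using W by (intro bexI[of _ "translate U (- a)"]) (simp_all add: ops carrier_quot subspace_neg)
  qed (use W in \<open>auto simp: carrier_quot ops subspace_add subspace_0 add_ac\<close>)
  have "Module.module class_ring (vs_quotient scale W U)"
    by (rule moduleI[OF field.axioms(1)[THEN domain.axioms(1), OF Defs.class_field] ab])
      (use W in \<open>auto simp: carrier_quot ops subspace_scale scale_left_distrib scale_right_distrib\<close>)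
  then show ?thesis by (simp add: vectorspace_def Defs.class_field)
qed

text \<open>A set that is a basis of \<open>W\<close> modulo \<open>U\<close> has as many elements as the dimension of the quotient.\<close>

lemma dim_quot:
  assumes U: "subspace U" and W: "subspace W" and T: "finite T" "T \<subseteq> W"
    and ind: "\<And>c. (\<Sum>t\<in>T. c t *s t) \<in> U \<Longrightarrow> \<forall>t\<in>T. c t = 0"
    and sp: "\<And>w. w \<in> W \<Longrightarrow> \<exists>c. w - (\<Sum>t\<in>T. c t *s t) \<in> U"
  shows "vectorspace.dim class_ring (vs_quotient scale W U) = card T"
proof -
  interpret Q: vectorspace class_ring "vs_quotient scale W U" by (rule vectorspace_quot[OF U W])
  note ops = quot_ops[OF U]
  have inj: "inj_on (translate U) T"
  proof (rule inj_onI, rule ccontr)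
    fix s t assume st: "s \<in> T" "t \<in> T" "translate U s = translate U t" "s \<noteq> t"
    define c where "c x = (if x = s then 1 else if x = t then - 1 else 0 :: 'a)" for x
    have "(\<Sum>x\<in>T. c x *s x) = (\<Sum>x\<in>{s, t}. c x *s x)"
      using T st by (intro sum.mono_neutral_right) (auto simp: c_def)
    also have "\<dots> = s - t" using st by (simp add: c_def)
    also have "\<dots> \<in> U" using st by (simp add: translate_eq_iff U)
    finally have "c s = 0" using ind st by blast
    then show False by (simp add: c_def)
  qed
  have sum_W: "(\<Sum>t\<in>T'. c t *s t) \<in> W" if "T' \<subseteq> T" for T' c
    using that T W by (intro subspace_sum subspace_scale) auto
  have lincomb: "Q.lincomb a (translate U ` T) = translate U (\<Sum>t\<in>T. a (translate U t) *s t)" for a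
  proof -
    have "Q.lincomb a (translate U ` T) = (\<Oplus>\<^bsub>vs_quotient scale W U\<^esub>t\<in>T. a (translate U t) \<odot>\<^bsub>vs_quotient scale W U\<^esub> translate U t)"
      unfolding Q.lincomb_def using T W
      by (subst Q.finsum_reindex[OF _ inj]) (auto simp: ops carrier_quot subspace_scale)
    also have "\<dots> = (\<Oplus>\<^bsub>vs_quotient scale W U\<^esub>t\<in>T. translate U (a (translate U t) *s t))"
      by (simp only: ops)
    also have "\<dots> = translate U (\<Sum>t\<in>T. a (translate U t) *s t)"
      using T(1) order_refl
    proof (induction T rule: finite_subset_induct')
      case empty
      show ?case by (simp add: ops)
    next
      case (insert t F)
      have "translate U (a (translate U x) *s x) \<in> carrier (vs_quotient scale W U)" if "x \<in> T" for x
        using that T W by (auto simp: carrier_quot subspace_scale)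
      then show ?case
        using insert by (subst Q.finsum_insert) (auto simp: ops)
    qed
    finally show ?thesis .
  qed
  have "Q.basis (translate U ` T)"
    unfolding Q.basis_def
  proof (intro conjI)
    show TQ: "translate U ` T \<subseteq> carrier (vs_quotient scale W U)" using T by (auto simp: carrier_quot)
    show "Q.lin_indpt (translate U ` T)"
    proof (rule Q.finite_lin_indpt2[OF _ TQ])
      fix a assume "Q.lincomb a (translate U ` T) = \<zero>\<^bsub>vs_quotient scale W U\<^esub>"
      then have "(\<Sum>t\<in>T. a (translate U t) *s t) \<in> U"
        by (simp add: lincomb ops translate_eq_iff U)
      from ind[OF this] show "\<forall>v\<in>translate U ` T. a v = \<zero>\<^bsub>class_ring\<^esub>" by simp
    qed (simp add: T)
    show "Q.span (translate U ` T) = carrier (vs_quotient scale W U)"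
    proof (intro equalityI subsetI)
      fix x assume "x \<in> carrier (vs_quotient scale W U)"
      then obtain w where w: "w \<in> W" "x = translate U w" by (auto simp: carrier_quot)
      obtain c where "w - (\<Sum>t\<in>T. c t *s t) \<in> U" using sp[OF w(1)] by blast
      moreover have "(\<Sum>t\<in>T. c (the_inv_into T (translate U) (translate U t)) *s t) = (\<Sum>t\<in>T. c t *s t)"
        by (rule sum.cong) (simp_all add: the_inv_into_f_f[OF inj])
      ultimately have "x = Q.lincomb (\<lambda>v. c (the_inv_into T (translate U) v)) (translate U ` T)"
        by (simp add: lincomb w(2) translate_eq_iff U)
      then show "x \<in> Q.span (translate U ` T)"
        unfolding Q.finite_span[OF finite_imageI[OF T(1)] TQ] by auto
    qed (rule Q.span_closed[OF TQ])
  qed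
  then have "Q.dim = card (translate U ` T)"
    using Q.dim_basis T(1) by blast
  also have "\<dots> = card T" by (rule card_image[OF inj])
  finally show ?thesis .
qed

end

text \<open>
  In a composition series there is no submodule strictly between consecutive members.
\<close>

lemma composition_series_simple:
  assumes vs: "vector_space scale"
    and cs: "composition_series G (\<lambda>x. x) (vector_space_record scale) m V" and i: "i < m"
    and lin: "\<And>x. x \<in> G \<Longrightarrow> Vector_Spaces.linear scale scale x"
    and W: "module.subspace scale W" "V (Suc i) \<subseteq> W" "W \<subseteq> V i" "\<And>x w. x \<in> G \<Longrightarrow> w \<in> W \<Longrightarrow> x w \<in> W"
  shows "W = V (Suc i) \<or> W = V i"
proof -
  interpret vector_space scale by fact
  let ?A = "V i" and ?U = "V (Suc i)" and ?M = "vector_space_record scale"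
  let ?Q = "vs_quotient scale ?A ?U"
  have lsub: "lie_submodule G (\<lambda>x. x) (V j) ?M" if "j \<le> m" for j
    using cs that by (simp add: composition_series_def)
  have sub: "subspace (V j)" if "j \<le> m" for j
    using lsub[OF that] by (simp add: lie_submodule_def subspace_record_iff)
  have inv: "x v \<in> V j" if "j \<le> m" "x \<in> G" "v \<in> V j" for j x v
    using lsub[OF that(1)] that(2,3) by (simp add: lie_submodule_def)
  have U: "subspace ?U" and A: "subspace ?A" using sub i by auto
  have act: "quotient_action (?M\<lparr>carrier := ?A\<rparr>) ?U (\<lambda>x. x) x (translate ?U a) = translate ?U (x a)" if "x \<in> G" for x a
  proof -
    interpret x: Vector_Spaces.linear scale scale x by (rule lin[OF that])
    show ?thesis
      unfolding quotient_action_def a_r_coset_eq_translate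
      using Union_translate_map[OF U, of x a] inv[of "Suc i"] i that by (simp add: x.diff)
  qed
  have simple: "simple_lie_module G (quotient_action (?M\<lparr>carrier := ?A\<rparr>) ?U (\<lambda>x. x)) ?Q"
    using cs i by (simp add: composition_series_def subquotient_def)
  have "lie_submodule G (quotient_action (?M\<lparr>carrier := ?A\<rparr>) ?U (\<lambda>x. x)) (translate ?U ` W) ?Q"
    unfolding lie_submodule_def
  proof (intro conjI ballI)
    interpret Q: vectorspace class_ring ?Q by (rule vectorspace_quot[OF U A])
    have "submodule class_ring (translate ?U ` W) ?Q"
      unfolding submodule_def carrier_quot
    proof (intro conjI allI impI)
      show "translate ?U ` W \<subseteq> translate ?U ` ?A" using W(3) by (rule image_mono)
      show "\<zero>\<^bsub>?Q\<^esub> \<in> translate ?U ` W"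
        unfolding quot_ops[OF U] by (rule imageI[OF subspace_0[OF W(1)]])
    next
      fix v w assume "v \<in> translate ?U ` W" "w \<in> translate ?U ` W"
      then show "v \<oplus>\<^bsub>?Q\<^esub> w \<in> translate ?U ` W"
        using subspace_add[OF W(1)] by (auto simp: quot_ops[OF U])
    next
      fix c v assume "v \<in> translate ?U ` W"
      then show "c \<odot>\<^bsub>?Q\<^esub> v \<in> translate ?U ` W"
        using subspace_scale[OF W(1)] by (auto simp: quot_ops[OF U])
    qed (rule Q.module_axioms)
    then show "VectorSpace.subspace class_ring (translate ?U ` W) ?Q"
      by (simp add: VectorSpace.subspace_def Q.vectorspace_axioms)
  next
    fix x w assume "x \<in> G" "w \<in> translate ?U ` W"
    then show "quotient_action (?M\<lparr>carrier := ?A\<rparr>) ?U (\<lambda>x. x) x w \<in> translate ?U ` W"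
      using act W(4) by auto
  qed
  then have "translate ?U ` W = {translate ?U 0} \<or> translate ?U ` W = translate ?U ` ?A"
    using simple by (simp add: simple_lie_module_def carrier_quot quot_ops[OF U])
  then show ?thesis
  proof
    assume *: "translate ?U ` W = {translate ?U 0}"
    have "w \<in> ?U" if "w \<in> W" for w
    proof -
      have "translate ?U w = translate ?U 0" using imageI[OF that, of "translate ?U"] unfolding * by simp
      then show ?thesis by (simp add: translate_eq_iff[OF U])
    qed
    then show ?thesis using W(2) by blast
  next
    assume *: "translate ?U ` W = translate ?U ` ?A"
    have "a \<in> W" if "a \<in> ?A" for a
    proof -
      have "translate ?U a \<in> translate ?U ` W" unfolding * using that by (rule imageI)
      then obtain w where w: "translate ?U a = translate ?U w" "w \<in> W" by (rule imageE)
      then have "a - w \<in> W" using W(2) by (simp add: translate_eq_iff[OF U] subset_iff)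
      from subspace_add[OF W(1) this w(2)] show ?thesis by simp
    qed
    then show ?thesis using W(3) by blast
  qed
qed

section \<open>Operators in coordinates\<close>

context closed_field_space
begin

text \<open>
  The basis vectors themselves serve as indices: \<open>coord b v\<close> is the coefficient of \<open>b\<close> in \<open>v\<close>, \<open>entry x a b\<close> is
  the matrix entry of \<open>x\<close> in row \<open>a\<close> and column \<open>b\<close>, \<open>of_entries M\<close> is the operator with matrix \<open>M\<close>, and
  \<open>unit_op a b\<close> is the matrix unit that takes \<open>b\<close> to \<open>a\<close>.
\<close>

abbreviation coord :: "'v \<Rightarrow> 'v \<Rightarrow> 'k" where
  "coord b v \<equiv> representation Basis v b"

definition entry :: "('v \<Rightarrow> 'v) \<Rightarrow> 'v \<Rightarrow> 'v \<Rightarrow> 'k" where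
  "entry x a b = coord a (x b)"

definition of_entries :: "('v \<Rightarrow> 'v \<Rightarrow> 'k) \<Rightarrow> 'v \<Rightarrow> 'v" where
  "of_entries M v = (\<Sum>a\<in>Basis. (\<Sum>b\<in>Basis. M a b * coord b v) *s a)"

definition unit_op :: "'v \<Rightarrow> 'v \<Rightarrow> 'v \<Rightarrow> 'v" where
  "unit_op a b v = coord b v *s a"

lemma coord_add: "coord b (u + v) = coord b u + coord b v"
  by (simp add: representation_add independent_Basis span_Basis)

lemma coord_diff: "coord b (u - v) = coord b u - coord b v"
  by (simp add: representation_diff independent_Basis span_Basis)

lemma coord_scale: "coord b (c *s v) = c * coord b v"
  by (simp add: representation_scale independent_Basis span_Basis)

lemma coord_0: "coord b 0 = 0"
  by (simp add: representation_zero)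

lemma coord_sum: "coord b (sum f I) = (\<Sum>i\<in>I. coord b (f i))"
  by (induction I rule: infinite_finite_induct) (simp_all add: coord_0 coord_add)

lemma coord_basis: "a \<in> Basis \<Longrightarrow> coord b a = (if a = b then 1 else 0)"
  by (simp add: representation_basis independent_Basis)

lemma coord_expansion: "(\<Sum>b\<in>Basis. coord b v *s b) = v"
  by (rule sum_representation_eq) (simp_all add: independent_Basis span_Basis finite_Basis)

lemma coord_eqI: "(\<And>b. b \<in> Basis \<Longrightarrow> coord b u = coord b v) \<Longrightarrow> u = v"
  using coord_expansion[of u] coord_expansion[of v] by (metis (no_types, lifting) sum.cong)

lemma entry_add: "entry (\<lambda>v. x v + y v) a b = entry x a b + entry y a b"
  and entry_diff: "entry (\<lambda>v. x v - y v) a b = entry x a b - entry y a b"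
  and entry_scale: "entry (\<lambda>v. c *s x v) a b = c * entry x a b"
  and entry_0: "entry (\<lambda>_. 0) a b = 0"
  by (simp_all add: entry_def coord_add coord_diff coord_scale coord_0)

lemma entry_sum: "entry (\<lambda>v. \<Sum>i\<in>I. x i v) a b = (\<Sum>i\<in>I. entry (x i) a b)"
  by (simp add: entry_def coord_sum)

lemma endo_eqI:
  assumes "endo x" "endo y" "\<And>a b. a \<in> Basis \<Longrightarrow> b \<in> Basis \<Longrightarrow> entry x a b = entry y a b"
  shows "x = y"
proof
  fix v
  have "x b = y b" if "b \<in> Basis" for b
    using assms(3) that by (intro coord_eqI) (simp add: entry_def)
  then have "(\<Sum>b\<in>Basis. coord b v *s x b) = (\<Sum>b\<in>Basis. coord b v *s y b)"
    by (intro sum.cong) simp_all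
  then have "x (\<Sum>b\<in>Basis. coord b v *s b) = y (\<Sum>b\<in>Basis. coord b v *s b)"
    by (simp only: endo_sum[OF assms(1)] endo_sum[OF assms(2)] endo_scale[OF assms(1)] endo_scale[OF assms(2)])
  then show "x v = y v" by (simp only: coord_expansion)
qed

lemma entry_compose:
  assumes "endo x"
  shows "entry (\<lambda>v. x (y v)) a b = (\<Sum>c\<in>Basis. entry x a c * entry y c b)"
proof -
  have "x (y b) = x (\<Sum>c\<in>Basis. coord c (y b) *s c)"
    by (simp only: coord_expansion)
  also have "\<dots> = (\<Sum>c\<in>Basis. coord c (y b) *s x c)"
    by (simp only: endo_sum[OF assms] endo_scale[OF assms])
  finally show ?thesis
    by (simp add: entry_def coord_sum coord_scale mult.commute)
qed

lemma entry_commutator: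
  assumes "endo x" "endo y"
  shows "entry (commutator x y) a b
    = (\<Sum>c\<in>Basis. entry x a c * entry y c b) - (\<Sum>c\<in>Basis. entry y a c * entry x c b)"
  using entry_compose[OF assms(1), of y a b] entry_compose[OF assms(2), of x a b]
  by (simp only: commutator_def entry_diff)

lemma endo_add_op: "endo x \<Longrightarrow> endo y \<Longrightarrow> endo (\<lambda>v. x v + y v)"
  by (rule ends.linear_compose_add)

lemma endo_scale_op: "endo x \<Longrightarrow> endo (\<lambda>v. c *s x v)"
  by (rule ends.linear_compose_scale_right)

lemma endoI:
  assumes "\<And>u v. x (u + v) = x u + x v" "\<And>c v. x (c *s v) = c *s x v"
  shows "endo x"
  using assms by (simp add: Vector_Spaces.linear_iff vector_space_axioms)

lemma endo_unit_op: "endo (unit_op a b)"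
  by (rule endoI) (simp_all add: unit_op_def coord_add coord_scale scale_left_distrib)

lemma endo_of_entries: "endo (of_entries M)"
  by (rule endoI)
    (simp_all add: of_entries_def coord_add coord_scale scale_left_distrib sum.distrib distrib_left
      scale_sum_right sum_distrib_left mult.left_commute)

lemma entry_of_entries:
  assumes "a \<in> Basis" "b \<in> Basis"
  shows "entry (of_entries M) a b = M a b"
proof -
  have row: "(\<Sum>d\<in>Basis. M c d * coord d b) = M c b" for c
  proof -
    have "(\<Sum>d\<in>Basis. M c d * coord d b) = (\<Sum>d\<in>Basis. if b = d then M c d else 0)"
      by (rule sum.cong) (simp_all add: coord_basis assms)
    then show ?thesis using assms finite_Basis by simp
  qed
  have "entry (of_entries M) a b = (\<Sum>c\<in>Basis. M c b * coord a c)"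
    by (simp add: entry_def of_entries_def coord_sum coord_scale row)
  also have "\<dots> = (\<Sum>c\<in>Basis. if c = a then M c b else 0)"
    by (rule sum.cong) (simp_all add: coord_basis)
  finally show ?thesis using assms finite_Basis by simp
qed

lemma entry_unit_op:
  "a \<in> Basis \<Longrightarrow> d \<in> Basis \<Longrightarrow> entry (unit_op a b) c d = (if c = a \<and> d = b then 1 else 0)"
  by (auto simp: entry_def unit_op_def coord_scale coord_basis)

text \<open>The linear subspaces of \<open>gl(V)\<close>.\<close>

definition op_space :: "('v \<Rightarrow> 'v) set \<Rightarrow> bool" where
  "op_space T \<longleftrightarrow> (\<forall>x\<in>T. endo x) \<and> (\<lambda>_. 0) \<in> T \<and> (\<forall>x\<in>T. \<forall>y\<in>T. (\<lambda>v. x v + y v) \<in> T) \<and>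
     (\<forall>c. \<forall>x\<in>T. (\<lambda>v. c *s x v) \<in> T)"

lemma op_spaceD:
  assumes "op_space T"
  shows "x \<in> T \<Longrightarrow> endo x" "(\<lambda>_. 0) \<in> T" "x \<in> T \<Longrightarrow> y \<in> T \<Longrightarrow> (\<lambda>v. x v + y v) \<in> T"
    "x \<in> T \<Longrightarrow> (\<lambda>v. c *s x v) \<in> T"
  using assms by (simp_all add: op_space_def)

lemma op_space_diff: "op_space T \<Longrightarrow> x \<in> T \<Longrightarrow> y \<in> T \<Longrightarrow> (\<lambda>v. x v - y v) \<in> T"
  using op_spaceD(3)[of T x "\<lambda>v. (- 1) *s y v"] op_spaceD(4)[of T y "- 1"] by simp

lemma op_space_sum:
  assumes "op_space T" "\<And>i. i \<in> I \<Longrightarrow> x i \<in> T"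
  shows "(\<lambda>v. \<Sum>i\<in>I. x i v) \<in> T"
  using assms(2)
  by (induction I rule: infinite_finite_induct)
    (simp_all add: op_spaceD(2)[OF assms(1)] op_spaceD(3)[OF assms(1)])

lemma op_space_scale_cancel:
  assumes "op_space T" "(\<lambda>v. c *s x v) \<in> T" "c \<noteq> 0"
  shows "x \<in> T"
  using op_spaceD(4)[OF assms(1,2), of "inverse c"] assms(3) by simp

text \<open>
  The operator \<open>h\<close> acts as \<open>1\<close> on \<open>a\<close>, as \<open>-1\<close> on \<open>b\<close> and as \<open>0\<close> on the other basis vectors. The eigenvalue
  \<open>2\<close> of its adjoint action occurs only for the matrix unit at \<open>(a, b)\<close>, so that the polynomial
  \<open>t (t - 1) (t + 1) (t + 2)\<close> in the adjoint action extracts this entry.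
\<close>

lemma extract_unit:
  assumes T: "op_space T" and ab: "a \<in> Basis" "b \<in> Basis" "a \<noteq> b" and x: "x \<in> T"
    and stable: "\<And>y. y \<in> T \<Longrightarrow> commutator (\<lambda>v. unit_op a a v - unit_op b b v) y \<in> T"
  shows "(\<lambda>v. entry x a b *s unit_op a b v) \<in> T"
proof -
  let ?h = "\<lambda>v. unit_op a a v - unit_op b b v"
  define w where "w e = (if e = a then 1 else 0) - (if e = b then 1 else 0 :: 'k)" for e
  have h: "endo ?h" by (intro ends.linear_compose_sub endo_unit_op)
  have hent: "entry ?h c d = (if c = d then w c else 0)" if "d \<in> Basis" for c d
    using ab that by (auto simp: entry_diff entry_unit_op w_def)
  have ad: "entry (commutator ?h y) c d = (w c - w d) * entry y c d"
    if "y \<in> T" "c \<in> Basis" "d \<in> Basis" for y c d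
  proof -
    have "(\<Sum>e\<in>Basis. entry ?h c e * entry y e d) = (\<Sum>e\<in>Basis. if c = e then w c * entry y c d else 0)"
      by (rule sum.cong) (auto simp: hent)
    moreover have "(\<Sum>e\<in>Basis. entry y c e * entry ?h e d) = (\<Sum>e\<in>Basis. if e = d then w d * entry y c d else 0)"
      by (rule sum.cong) (auto simp: hent that)
    ultimately show ?thesis
      using that finite_Basis
      by (simp add: entry_commutator[OF h op_spaceD(1)[OF T that(1)]] left_diff_distrib)
  qed
  define F where "F k y = (\<lambda>v. commutator ?h y v + k *s y v)" for k y
  have F: "F k y \<in> T" if "y \<in> T" for k y
    unfolding F_def by (intro op_spaceD(3,4)[OF T] stable that)
  have Fent: "entry (F k y) c d = (w c - w d + k) * entry y c d"
    if "y \<in> T" "c \<in> Basis" "d \<in> Basis" for k y c d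
    unfolding F_def entry_add entry_scale ad[OF that] by (simp add: distrib_right)
  \<comment> \<open>The factor \<open>24\<close> is the value of the polynomial at \<open>2\<close>.\<close>
  let ?z = "F 0 (F (- 1) (F 1 (F 2 x)))"
  have z: "?z \<in> T" by (intro F x)
  have "?z = (\<lambda>v. 24 *s (entry x a b *s unit_op a b v))"
  proof (rule endo_eqI)
    show "endo ?z" by (rule op_spaceD(1)[OF T z])
    show "endo (\<lambda>v. 24 *s (entry x a b *s unit_op a b v))"
      by (intro endo_scale_op endo_unit_op)
    fix c d assume cd: "c \<in> Basis" "d \<in> Basis"
    have "entry ?z c d = (w c - w d) * ((w c - w d - 1) * ((w c - w d + 1) * ((w c - w d + 2) * entry x c d)))"
      using cd by (simp add: Fent F x)
    also have "\<dots> = (if c = a \<and> d = b then 24 * entry x a b else 0)"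
      using ab(3) by (auto simp: w_def)
    also have "\<dots> = entry (\<lambda>v. 24 *s (entry x a b *s unit_op a b v)) c d"
      using ab cd by (auto simp: entry_scale entry_unit_op)
    finally show "entry ?z c d = entry (\<lambda>v. 24 *s (entry x a b *s unit_op a b v)) c d" .
  qed
  with z have "(\<lambda>v. 24 *s (entry x a b *s unit_op a b v)) \<in> T" by (simp only:)
  then show ?thesis by (rule op_space_scale_cancel[OF T]) simp
qed


end

section \<open>Lie algebras of operators that contain the traceless diagonal operators\<close>

text \<open>
  Lie algebras of operators that contain all traceless operators that are diagonal in the chosen basis.
\<close>

locale torus_algebra = closed_field_space scale Basis
  for scale :: "'k::{alg_closed_field, field_char_0} \<Rightarrow> 'v::ab_group_add \<Rightarrow> 'v" (infixr \<open>*s\<close> 75)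
    and Basis :: "'v set" +
  fixes g :: "('v \<Rightarrow> 'v) set"
  assumes g_op_space: "op_space g"
    and g_commutator: "x \<in> g \<Longrightarrow> y \<in> g \<Longrightarrow> commutator x y \<in> g"
    and g_torus: "endo x \<Longrightarrow> (\<And>b. b \<in> Basis \<Longrightarrow> x b = c b *s b) \<Longrightarrow> (\<Sum>b\<in>Basis. c b) = 0 \<Longrightarrow> x \<in> g"
begin

lemmas g_endo = op_spaceD(1)[OF g_op_space]

lemma traceless_diagonal_in_g:
  assumes "endo x" "\<And>a b. a \<in> Basis \<Longrightarrow> b \<in> Basis \<Longrightarrow> a \<noteq> b \<Longrightarrow> entry x a b = 0"
    "(\<Sum>b\<in>Basis. entry x b b) = 0"
  shows "x \<in> g"
proof (rule g_torus[OF assms(1) _ assms(3)])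
  fix b assume b: "b \<in> Basis"
  have "x b = (\<Sum>a\<in>Basis. entry x a b *s a)"
    by (simp only: entry_def coord_expansion)
  also have "\<dots> = (\<Sum>a\<in>Basis. if a = b then entry x b b *s b else 0)"
    using assms(2) b by (intro sum.cong) auto
  finally show "x b = entry x b b *s b"
    using b finite_Basis by simp
qed

lemma unit_diff_in_g:
  assumes "a \<in> Basis" "b \<in> Basis"
  shows "(\<lambda>v. unit_op a a v - unit_op b b v) \<in> g"
proof (rule traceless_diagonal_in_g)
  show "endo (\<lambda>v. unit_op a a v - unit_op b b v)"
    by (intro ends.linear_compose_sub endo_unit_op)
  show "entry (\<lambda>v. unit_op a a v - unit_op b b v) c d = 0" if "c \<in> Basis" "d \<in> Basis" "c \<noteq> d" for c d
    using that assms by (auto simp: entry_diff entry_unit_op)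
  have "(\<Sum>c\<in>Basis. entry (\<lambda>v. unit_op a a v - unit_op b b v) c c)
      = (\<Sum>c\<in>Basis. if c = a then 1 else 0) - (\<Sum>c\<in>Basis. if c = b then 1 else 0)"
    unfolding sum_subtractf[symmetric] using assms
    by (intro sum.cong) (auto simp: entry_diff entry_unit_op)
  then show "(\<Sum>c\<in>Basis. entry (\<lambda>v. unit_op a a v - unit_op b b v) c c) = 0"
    using assms finite_Basis by simp
qed

text \<open>For \<open>T = g\<close>, or \<open>T\<close> an ideal of \<open>g\<close>: a nonzero entry of an element gives a matrix unit.\<close>

lemma unit_component:
  assumes T: "op_space T" "\<And>x y. x \<in> g \<Longrightarrow> y \<in> T \<Longrightarrow> commutator x y \<in> T"
    and x: "x \<in> T" and ab: "a \<in> Basis" "b \<in> Basis" "a \<noteq> b" "entry x a b \<noteq> 0"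
  shows "unit_op a b \<in> T"
proof (rule op_space_scale_cancel[OF T(1) _ ab(4)])
  show "(\<lambda>v. entry x a b *s unit_op a b v) \<in> T"
    using T(2) unit_diff_in_g ab by (intro extract_unit T(1) x) simp_all
qed

text \<open>The diagonal of \<open>x\<close> is traceless, and the rest is a combination of matrix units in \<open>g\<close>.\<close>

lemma in_gI:
  assumes x: "endo x" "\<And>a b. a \<in> Basis \<Longrightarrow> b \<in> Basis \<Longrightarrow> a \<noteq> b \<Longrightarrow> entry x a b \<noteq> 0 \<Longrightarrow> unit_op a b \<in> g"
    "(\<Sum>b\<in>Basis. entry x b b) = 0"
  shows "x \<in> g"
proof -
  define J where "J = {(a, b). a \<in> Basis \<and> b \<in> Basis \<and> a \<noteq> b \<and> entry x a b \<noteq> 0}"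
  have "J \<subseteq> Basis \<times> Basis" by (auto simp: J_def)
  then have J: "finite J" using finite_Basis finite_subset by blast
  let ?y = "\<lambda>v. \<Sum>p\<in>J. entry x (fst p) (snd p) *s unit_op (fst p) (snd p) v"
  have y: "?y \<in> g"
    by (intro op_space_sum[OF g_op_space] op_spaceD(4)[OF g_op_space]) (auto simp: J_def x(2))
  have yent: "entry ?y a b = (if a = b then 0 else entry x a b)" if "a \<in> Basis" "b \<in> Basis" for a b
  proof -
    have "entry ?y a b = (\<Sum>p\<in>J. entry x (fst p) (snd p) * entry (unit_op (fst p) (snd p)) a b)"
      by (simp only: entry_sum entry_scale)
    also have "\<dots> = (\<Sum>p\<in>J. if p = (a, b) then entry x a b else 0)"
    proof (rule sum.cong[OF refl])
      fix p assume "p \<in> J"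
      then have "fst p \<in> Basis" by (auto simp: J_def)
      then show "entry x (fst p) (snd p) * entry (unit_op (fst p) (snd p)) a b = (if p = (a, b) then entry x a b else 0)"
        using that by (cases p) (auto simp: entry_unit_op)
    qed
    finally show ?thesis using J that by (simp add: J_def)
  qed
  have z: "(\<lambda>v. x v - ?y v) \<in> g"
  proof (rule traceless_diagonal_in_g)
    show "endo (\<lambda>v. x v - ?y v)" using x(1) g_endo[OF y] by (rule ends.linear_compose_sub)
    show "entry (\<lambda>v. x v - ?y v) a b = 0" if "a \<in> Basis" "b \<in> Basis" "a \<noteq> b" for a b
      using that by (simp only: entry_diff yent if_False diff_self)
    have "(\<Sum>b\<in>Basis. entry (\<lambda>v. x v - ?y v) b b) = (\<Sum>b\<in>Basis. entry x b b)"
      by (rule sum.cong) (simp_all only: entry_diff yent if_True diff_0_right simp_thms)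
    then show "(\<Sum>b\<in>Basis. entry (\<lambda>v. x v - ?y v) b b) = 0" using x(3) by simp
  qed
  have "(\<lambda>v. (x v - ?y v) + ?y v) \<in> g"
    by (rule op_spaceD(3)[OF g_op_space z y])
  then show ?thesis by simp
qed

text \<open>A submodule contains every basis vector that occurs in one of its elements.\<close>

lemma invariant_coord:
  assumes W: "subspace W" "\<forall>x\<in>g. \<forall>v\<in>W. x v \<in> W" and v: "v \<in> W" and a: "a \<in> Basis"
    and va: "coord a v \<noteq> 0"
  shows "a \<in> W"
proof (cases "Basis = {a}")
  case True
  then have "coord a v *s a = v" using coord_expansion[of v] by simp
  then show ?thesis using subspace_scale_cancel[OF W(1) _ va, of a] v by simp
next
  case False
  then obtain b where b: "b \<in> Basis" "b \<noteq> a" using a by auto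
  \<comment> \<open>On \<open>a\<close>, on \<open>b\<close> and on the other basis vectors, \<open>h\<close> has the eigenvalues \<open>1\<close>, \<open>-1\<close> and \<open>0\<close>. So
    \<open>h\<^sup>2 + h\<close> extracts twice the component at \<open>a\<close>.\<close>
  let ?h = "\<lambda>v. unit_op a a v - unit_op b b v"
  have hW: "\<forall>v\<in>W. ?h v \<in> W"
    by (rule bspec[OF W(2) unit_diff_in_g[OF a b(1)]])
  have 1: "?h v \<in> W" by (rule bspec[OF hW v])
  have 2: "?h (?h v) \<in> W" by (rule bspec[OF hW 1])
  have 3: "?h v + ?h (?h v) = (2 * coord a v) *s a"
  proof -
    have "coord a (?h v) = coord a v" "coord b (?h v) = - coord b v"
      using a b by (simp_all add: unit_op_def coord_diff coord_scale coord_basis)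
    then have "?h (?h v) = coord a v *s a + coord b v *s b"
      by (simp only: unit_op_def scale_minus_left diff_minus_eq_add)
    moreover have "?h v = coord a v *s a - coord b v *s b"
      by (simp only: unit_op_def)
    moreover have "(2 * coord a v) *s a = coord a v *s a + coord a v *s a"
      by (simp only: mult_2 scale_left_distrib)
    ultimately show ?thesis by (simp only: add.commute add.assoc diff_add_cancel) simp
  qed
  have "(2 * coord a v) *s a \<in> W"
    using subspace_add[OF W(1) 1 2] by (simp only: 3)
  then show ?thesis using subspace_scale_cancel[OF W(1)] va by simp
qed

lemma invariant_span_basis:
  assumes W: "subspace W" "\<forall>x\<in>g. \<forall>v\<in>W. x v \<in> W"
  shows "W = span (Basis \<inter> W)"
proof
  show "W \<subseteq> span (Basis \<inter> W)"
  proof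
    fix v assume v: "v \<in> W"
    have "(\<Sum>b\<in>Basis. coord b v *s b) \<in> span (Basis \<inter> W)"
    proof (rule span_sum)
      fix b assume b: "b \<in> Basis"
      show "coord b v *s b \<in> span (Basis \<inter> W)"
      proof (cases "coord b v = 0")
        case False
        then have "b \<in> Basis \<inter> W" using invariant_coord[OF W v b] b by simp
        then show ?thesis by (intro span_scale span_base)
      qed (simp add: span_zero)
    qed
    then show "v \<in> span (Basis \<inter> W)" by (simp only: coord_expansion)
  qed
  show "span (Basis \<inter> W) \<subseteq> W"
    by (rule span_minimal[OF _ W(1)]) simp
qed

text \<open>
  If there is no submodule strictly between \<open>U\<close> and \<open>W\<close>, then \<open>g\<close> contains every off-diagonal matrix
  unit between the basis vectors of \<open>W\<close> outside \<open>U\<close>: those that can be reached from \<open>b\<close> span,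
  together with \<open>U\<close>, a submodule.
\<close>

lemma simple_quotient_units:
  assumes U: "subspace U" "\<forall>x\<in>g. \<forall>v\<in>U. x v \<in> U"
    and W: "subspace W" "\<forall>x\<in>g. \<forall>v\<in>W. x v \<in> W" and UW: "U \<subseteq> W"
    and simple: "\<And>X. subspace X \<Longrightarrow> U \<subseteq> X \<Longrightarrow> X \<subseteq> W \<Longrightarrow> \<forall>x\<in>g. \<forall>v\<in>X. x v \<in> X \<Longrightarrow> X = U \<or> X = W"
    and ab: "a \<in> Basis" "b \<in> Basis" "a \<in> W" "b \<in> W" "a \<notin> U" "b \<notin> U" "a \<noteq> b"
  shows "unit_op a b \<in> g"
proof -
  define Q where "Q = {c \<in> Basis. c \<in> U \<or> c = b \<or> unit_op c b \<in> g}"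
  have QB: "Q \<subseteq> Basis" by (auto simp: Q_def)
  have QW: "Q \<subseteq> W"
  proof
    fix c assume c: "c \<in> Q"
    have "c \<in> W" if "unit_op c b \<in> g"
    proof -
      have "unit_op c b b = c" using ab by (simp add: unit_op_def coord_basis)
      then show ?thesis using W(2) that ab(4) by force
    qed
    then show "c \<in> W" using c UW ab by (auto simp: Q_def)
  qed
  have Uspan: "U = span (Basis \<inter> U)" by (rule invariant_span_basis[OF U])
  have alt: "span Q = U \<or> span Q = W"
  proof (rule simple[OF subspace_span])
    have "span (Basis \<inter> U) \<subseteq> span Q" by (rule span_mono) (auto simp: Q_def)
    then show UQ: "U \<subseteq> span Q" using Uspan by simp
    show "span Q \<subseteq> W" by (rule span_minimal[OF QW W(1)])
    have "x v \<in> span Q" if x: "x \<in> g" and v: "v \<in> span Q" for x v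
    proof (rule endo_image_span[OF g_endo[OF x] _ subspace_span v])
      fix c assume c: "c \<in> Q"
      show "x c \<in> span Q"
      proof (cases "c \<in> U")
        case True
        then show ?thesis using U(2) x UQ by blast
      next
        case False
        have cB: "c \<in> Basis" using c QB by blast
        have reach: "d \<in> Q" if d: "d \<in> Basis" "coord d (x c) \<noteq> 0" for d
        proof (cases "d = c \<or> d = b")
          case True
          then show ?thesis using c ab by (auto simp: Q_def)
        next
          case dc: False
          have dcg: "unit_op d c \<in> g"
            using d dc cB x by (intro unit_component[OF g_op_space g_commutator x]) (simp_all add: entry_def)
          show ?thesis
          proof (cases "c = b")
            case True
            then show ?thesis using dcg d by (simp add: Q_def)
          next
            case cb: False
            then have "unit_op c b \<in> g" using c False by (auto simp: Q_def)
            then have "commutator (unit_op d c) (unit_op c b) \<in> g"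
              using dcg by (intro g_commutator)
            moreover have "commutator (unit_op d c) (unit_op c b) = unit_op d b"
              using dc cb cB d by (simp add: fun_eq_iff commutator_apply unit_op_def coord_scale coord_basis)
            ultimately show ?thesis using d by (simp add: Q_def)
          qed
        qed
        have "(\<Sum>d\<in>Basis. coord d (x c) *s d) \<in> span Q"
        proof (rule span_sum)
          fix d assume d: "d \<in> Basis"
          show "coord d (x c) *s d \<in> span Q"
          proof (cases "coord d (x c) = 0")
            case False
            show ?thesis by (rule span_scale[OF span_base[OF reach[OF d False]]])
          qed (simp add: span_zero)
        qed
        then show ?thesis by (simp only: coord_expansion)
      qed
    qed
    then show "\<forall>x\<in>g. \<forall>v\<in>span Q. x v \<in> span Q" by (intro ballI)
  qed
  have "b \<in> span Q" by (rule span_base) (simp add: Q_def ab)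
  then have "span Q \<noteq> U" using ab(6) by auto
  then have "a \<in> span Q" using alt ab(3) by simp
  then have "a \<in> Q"
    using representation_outside_span[OF independent_Basis QB, of a a] ab(1) by (auto simp: coord_basis)
  then show ?thesis using ab by (simp add: Q_def)
qed

end

section \<open>The radical\<close>

lemma bracket_span_subset_subspace:
  assumes "VectorSpace.subspace class_ring T L" "\<And>x y. x \<in> A \<Longrightarrow> y \<in> B \<Longrightarrow> bracket L x y \<in> T"
  shows "bracket_span L A B \<subseteq> T"
proof -
  interpret L: vectorspace class_ring L using assms(1) by (simp add: VectorSpace.subspace_def)
  show ?thesis
    unfolding bracket_span_def
  proof (rule L.span_is_subset)
    show "{bracket L x y |x y. x \<in> A \<and> y \<in> B} \<subseteq> T" using assms(2) by blast
    show "submodule class_ring T L" using assms(1) by (simp add: VectorSpace.subspace_def)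
  qed
qed

lemma subspace_bracket_span:
  assumes "vectorspace class_ring L" "\<And>x y. x \<in> A \<Longrightarrow> y \<in> B \<Longrightarrow> bracket L x y \<in> carrier L"
  shows "VectorSpace.subspace class_ring (bracket_span L A B) L"
proof -
  interpret L: vectorspace class_ring L by fact
  show ?thesis
    unfolding bracket_span_def by (rule L.span_is_subspace) (use assms(2) in blast)
qed

lemma derived_series_subspace:
  assumes "lie_algebra L"
  shows "VectorSpace.subspace class_ring (derived_series L k) L" "derived_series L k \<subseteq> carrier L"
proof -
  interpret L: lie_algebra L by fact
  have sub: "T \<subseteq> carrier L" if "VectorSpace.subspace class_ring T L" for T
    using that submodule.subset by (auto simp: VectorSpace.subspace_def)
  show *: "VectorSpace.subspace class_ring (derived_series L k) L"
  proof (induction k)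
    case 0
    have "submodule class_ring (carrier L) L"
      using L.module_axioms by (simp add: submodule_def)
    then show ?case by (simp add: VectorSpace.subspace_def L.vectorspace_axioms)
  next
    case (Suc k)
    show ?case
      unfolding derived_series.simps using L.bracket_closed sub[OF Suc]
      by (intro subspace_bracket_span L.vectorspace_axioms) auto
  qed
  show "derived_series L k \<subseteq> carrier L" by (rule sub[OF *])
qed

lemma bracket_in_derived_series:
  assumes L: "lie_algebra L" and xy: "x \<in> derived_series L k" "y \<in> derived_series L k"
  shows "bracket L x y \<in> derived_series L (Suc k)"
proof -
  interpret L: lie_algebra L by fact
  show ?thesis
    unfolding derived_series.simps using xy L.bracket_closed derived_series_subspace(2)[OF L, of k]
    by (intro bracket_in_bracket_span L.vectorspace_axioms) auto
qed

context closed_field_space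
begin

text \<open>The set \<open>G\<close> of operators as a Lie algebra with the operations of \<open>gl(V)\<close>.\<close>

abbreviation op_algebra :: "('v \<Rightarrow> 'v) set \<Rightarrow> ('k, 'v \<Rightarrow> 'v) lie_algebra" where
  "op_algebra G \<equiv> (lie_gl scale)\<lparr>carrier := G\<rparr>"

lemma op_algebra_endo: "op_algebra {x. endo x} = lie_gl scale"
  by (simp add: lie_gl_def)

lemma subspace_op_space:
  assumes "VectorSpace.subspace class_ring T (op_algebra G)" "\<forall>x\<in>G. endo x"
  shows "op_space T" "T \<subseteq> G"
proof -
  interpret T: submodule class_ring T "op_algebra G"
    using assms(1) by (simp add: VectorSpace.subspace_def)
  show "T \<subseteq> G" using T.subset by simp
  then have "\<forall>x\<in>T. endo x" using assms(2) by blast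
  then show "op_space T"
    using T.m_closed T.zero_closed T.smult_closed by (simp add: op_space_def)
qed

lemma op_space_subspace:
  assumes "op_space T" "T \<subseteq> G" "vectorspace class_ring (op_algebra G)"
  shows "VectorSpace.subspace class_ring T (op_algebra G)"
proof -
  interpret G: vectorspace class_ring "op_algebra G" by fact
  have "submodule class_ring T (op_algebra G)"
    using assms(1,2) G.module_axioms by (simp add: submodule_def op_space_def)
  then show ?thesis by (simp add: VectorSpace.subspace_def assms(3))
qed

end

text \<open>
  The basis is divided into blocks numbered below \<open>m\<close>, where \<open>lev b\<close> is the number of the block of \<open>b\<close>.
  The elements of \<open>g\<close> do not decrease the number, and \<open>g\<close> contains the off-diagonal matrix units inside each
  block.
\<close>

locale block_algebra = torus_algebra scale Basis g
  for scale :: "'k::{alg_closed_field, field_char_0} \<Rightarrow> 'v::ab_group_add \<Rightarrow> 'v" (infixr \<open>*s\<close> 75)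
    and Basis :: "'v set" and g :: "('v \<Rightarrow> 'v) set" +
  fixes lev :: "'v \<Rightarrow> nat" and m :: nat
  assumes lev_less: "b \<in> Basis \<Longrightarrow> lev b < m"
    and entry_lev: "x \<in> g \<Longrightarrow> a \<in> Basis \<Longrightarrow> b \<in> Basis \<Longrightarrow> entry x a b \<noteq> 0 \<Longrightarrow> lev b \<le> lev a"
    and unit_lev: "a \<in> Basis \<Longrightarrow> b \<in> Basis \<Longrightarrow> lev a = lev b \<Longrightarrow> a \<noteq> b \<Longrightarrow> unit_op a b \<in> g"
begin

text \<open>The basis vectors in block \<open>f\<close>.\<close>

definition block :: "nat \<Rightarrow> 'v set" where
  "block f = {b \<in> Basis. lev b = f}"

text \<open>The elements of \<open>g\<close> whose diagonal blocks are scalar matrices.\<close>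

definition rad :: "('v \<Rightarrow> 'v) set" where
  "rad = {x \<in> g. \<forall>a\<in>Basis. \<forall>b\<in>Basis. lev a = lev b \<longrightarrow>
     (a \<noteq> b \<longrightarrow> entry x a b = 0) \<and> entry x a a = entry x b b}"

text \<open>The operators that increase the number of the block by at least \<open>k\<close>.\<close>

definition filt :: "nat \<Rightarrow> ('v \<Rightarrow> 'v) set" where
  "filt k = {x. endo x \<and> (\<forall>a\<in>Basis. \<forall>b\<in>Basis. entry x a b \<noteq> 0 \<longrightarrow> lev b + k \<le> lev a)}"

lemma finite_block: "finite (block f)"
  using finite_Basis by (simp add: block_def)

lemma radD:
  assumes "x \<in> rad" "a \<in> Basis" "b \<in> Basis" "lev a = lev b"
  shows "x \<in> g" "a \<noteq> b \<Longrightarrow> entry x a b = 0" "entry x a a = entry x b b"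
  using assms unfolding rad_def by blast+

lemma radI:
  assumes "x \<in> g"
    "\<And>a b. a \<in> Basis \<Longrightarrow> b \<in> Basis \<Longrightarrow> lev a = lev b \<Longrightarrow> a \<noteq> b \<Longrightarrow> entry x a b = 0"
    "\<And>a b. a \<in> Basis \<Longrightarrow> b \<in> Basis \<Longrightarrow> lev a = lev b \<Longrightarrow> entry x a a = entry x b b"
  shows "x \<in> rad"
  using assms unfolding rad_def by blast

lemma rad_subset: "rad \<subseteq> g"
  unfolding rad_def by (rule Collect_restrict)

lemma op_space_rad: "op_space rad"
  unfolding op_space_def
proof (intro conjI ballI allI)
  note G = op_spaceD[OF g_op_space]
  fix x assume x: "x \<in> rad"
  have xg: "x \<in> g" by (rule subsetD[OF rad_subset x])
  then show "endo x" by (rule G)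
  show "(\<lambda>v. c *s x v) \<in> rad" for c
  proof (rule radI)
    show "(\<lambda>v. c *s x v) \<in> g" by (rule G(4)[OF xg])
    fix a b assume ab: "a \<in> Basis" "b \<in> Basis" "lev a = lev b"
    show "entry (\<lambda>v. c *s x v) a a = entry (\<lambda>v. c *s x v) b b"
      unfolding entry_scale by (rule arg_cong[OF radD(3)[OF x ab]])
    show "entry (\<lambda>v. c *s x v) a b = 0" if "a \<noteq> b"
      unfolding entry_scale radD(2)[OF x ab that] by (rule mult_zero_right)
  qed
  fix y assume y: "y \<in> rad"
  have yg: "y \<in> g" by (rule subsetD[OF rad_subset y])
  show "(\<lambda>v. x v + y v) \<in> rad"
  proof (rule radI)
    show "(\<lambda>v. x v + y v) \<in> g" by (rule G(3)[OF xg yg])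
    fix a b assume ab: "a \<in> Basis" "b \<in> Basis" "lev a = lev b"
    show "entry (\<lambda>v. x v + y v) a a = entry (\<lambda>v. x v + y v) b b"
      unfolding entry_add by (rule arg_cong2[OF radD(3)[OF x ab] radD(3)[OF y ab]])
    show "entry (\<lambda>v. x v + y v) a b = 0" if "a \<noteq> b"
      unfolding entry_add radD(2)[OF x ab that] radD(2)[OF y ab that] by (rule add_0)
  qed
next
  show "(\<lambda>_. 0) \<in> rad"
    by (rule radI[OF op_spaceD(2)[OF g_op_space]]) (simp_all add: entry_0)
qed

lemma filtD:
  assumes "x \<in> filt k"
  shows "endo x" "a \<in> Basis \<Longrightarrow> b \<in> Basis \<Longrightarrow> entry x a b \<noteq> 0 \<Longrightarrow> lev b + k \<le> lev a"
  using assms by (simp_all add: filt_def)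

lemma filtI:
  assumes "endo x" "\<And>a b. a \<in> Basis \<Longrightarrow> b \<in> Basis \<Longrightarrow> entry x a b \<noteq> 0 \<Longrightarrow> lev b + k \<le> lev a"
  shows "x \<in> filt k"
  using assms by (simp add: filt_def)

lemma op_space_filt: "op_space (filt k)"
  unfolding op_space_def
proof (intro conjI ballI allI)
  fix x assume x: "x \<in> filt k"
  then show "endo x" by (rule filtD)
  show "(\<lambda>v. c *s x v) \<in> filt k" for c
  proof (rule filtI[OF endo_scale_op[OF filtD(1)[OF x]]])
    fix a b assume ab: "a \<in> Basis" "b \<in> Basis" and "entry (\<lambda>v. c *s x v) a b \<noteq> 0"
    then have "entry x a b \<noteq> 0" by (simp add: entry_scale)
    with ab show "lev b + k \<le> lev a" by (rule filtD(2)[OF x])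
  qed
  fix y assume y: "y \<in> filt k"
  show "(\<lambda>v. x v + y v) \<in> filt k"
  proof (rule filtI[OF endo_add_op[OF filtD(1)[OF x] filtD(1)[OF y]]])
    fix a b assume ab: "a \<in> Basis" "b \<in> Basis" and "entry (\<lambda>v. x v + y v) a b \<noteq> 0"
    then have "entry x a b \<noteq> 0 \<or> entry y a b \<noteq> 0" by (auto simp: entry_add)
    then show "lev b + k \<le> lev a" using filtD(2)[OF x ab] filtD(2)[OF y ab] by (elim disjE)
  qed
next
  show "(\<lambda>_. 0) \<in> filt k"
    by (rule filtI[OF ends.linear_zero]) (simp add: entry_0)
qed

text \<open>Diagonal blocks of products are products of diagonal blocks, by triangularity.\<close>

lemma entry_product_block:
  assumes "x \<in> g" "y \<in> g" "a \<in> Basis" "b \<in> Basis" "lev a = f" "lev b = f"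
  shows "(\<Sum>c\<in>Basis. entry x a c * entry y c b) = (\<Sum>c\<in>block f. entry x a c * entry y c b)"
proof (rule sum.mono_neutral_right)
  show "\<forall>c\<in>Basis - block f. entry x a c * entry y c b = 0"
  proof (intro ballI, rule ccontr)
    fix c assume c: "c \<in> Basis - block f" and "entry x a c * entry y c b \<noteq> 0"
    then have "lev c \<le> lev a" "lev b \<le> lev c"
      using entry_lev[OF assms(1,3), of c] entry_lev[OF assms(2) _ assms(4), of c] by auto
    then show False using c assms by (simp add: block_def)
  qed
qed (auto simp: finite_Basis block_def)

lemma rad_product_block:
  assumes "x \<in> rad" "y \<in> g" "a \<in> Basis" "b \<in> Basis" "lev a = f" "lev b = f"
  shows "(\<Sum>c\<in>Basis. entry x a c * entry y c b) = entry x b b * entry y a b"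
    "(\<Sum>c\<in>Basis. entry y a c * entry x c b) = entry x b b * entry y a b"
proof -
  have xg: "x \<in> g" using assms(1) rad_subset by blast
  have f: "finite (block f)" by (rule finite_block)
  note off = radD(2)[OF assms(1)]
  have diag: "entry x a a = entry x b b"
    by (rule radD(3)[OF assms(1,3,4)]) (simp add: assms)
  have "(\<Sum>c\<in>block f. entry x a c * entry y c b) = (\<Sum>c\<in>block f. if a = c then entry x b b * entry y a b else 0)"
  proof (rule sum.cong[OF refl])
    fix c assume "c \<in> block f"
    then have c: "c \<in> Basis" "lev a = lev c" using assms by (simp_all add: block_def)
    show "entry x a c * entry y c b = (if a = c then entry x b b * entry y a b else 0)"
    proof (cases "a = c")
      case True
      then show ?thesis using diag by simp
    next
      case False
      then show ?thesis using off[OF assms(3) c] by simp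
    qed
  qed
  then show "(\<Sum>c\<in>Basis. entry x a c * entry y c b) = entry x b b * entry y a b"
    unfolding entry_product_block[OF xg assms(2-6)] using f assms by (simp add: block_def)
  have "(\<Sum>c\<in>block f. entry y a c * entry x c b) = (\<Sum>c\<in>block f. if c = b then entry x b b * entry y a b else 0)"
  proof (rule sum.cong[OF refl])
    fix c assume "c \<in> block f"
    then have c: "c \<in> Basis" "lev c = lev b" using assms by (simp_all add: block_def)
    show "entry y a c * entry x c b = (if c = b then entry x b b * entry y a b else 0)"
      using off[OF c(1) assms(4) c(2)] by simp
  qed
  then show "(\<Sum>c\<in>Basis. entry y a c * entry x c b) = entry x b b * entry y a b"
    unfolding entry_product_block[OF assms(2) xg assms(3-6)] using f assms by (simp add: block_def)
qed

lemma commutator_rad_block: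
  assumes "x \<in> g" "y \<in> rad" "a \<in> Basis" "b \<in> Basis" "lev a = lev b"
  shows "entry (commutator x y) a b = 0"
  using rad_product_block[OF assms(2,1,3,4,5) refl]
    entry_commutator[OF g_endo[OF assms(1)] g_endo[OF subsetD[OF rad_subset assms(2)]], of a b]
  by simp

lemma commutator_rad:
  assumes "x \<in> g" "y \<in> rad"
  shows "commutator x y \<in> rad" "commutator x y \<in> filt 1"
proof -
  have yg: "y \<in> g" by (rule subsetD[OF rad_subset assms(2)])
  note c = g_commutator[OF assms(1) yg]
  show "commutator x y \<in> rad"
  proof (rule radI[OF c])
    fix a b assume ab: "a \<in> Basis" "b \<in> Basis" "lev a = lev b"
    show "entry (commutator x y) a b = 0" by (rule commutator_rad_block[OF assms ab])
    show "entry (commutator x y) a a = entry (commutator x y) b b"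
      using commutator_rad_block[OF assms ab(1,1)] commutator_rad_block[OF assms ab(2,2)] by simp
  qed
  show "commutator x y \<in> filt 1"
  proof (rule filtI[OF g_endo[OF c]])
    fix a b assume ab: "a \<in> Basis" "b \<in> Basis" "entry (commutator x y) a b \<noteq> 0"
    then have "lev a \<noteq> lev b" using commutator_rad_block[OF assms ab(1,2)] by iprover
    then show "lev b + 1 \<le> lev a" using entry_lev[OF c ab] by simp
  qed
qed

lemma commutator_filt:
  assumes "x \<in> filt i" "y \<in> filt j"
  shows "commutator x y \<in> filt (i + j)"
proof -
  note e = filtD(1)[OF assms(1)] filtD(1)[OF assms(2)]
  have prod: "\<exists>c\<in>Basis. entry x a c \<noteq> 0 \<and> entry y c b \<noteq> 0"
    if "(\<Sum>c\<in>Basis. entry x a c * entry y c b) \<noteq> 0" for x y a b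
  proof (rule ccontr)
    assume "\<not> ?thesis"
    then have "(\<Sum>c\<in>Basis. entry x a c * entry y c b) = 0" by (intro sum.neutral) auto
    with that show False by simp
  qed
  have "lev b + (i + j) \<le> lev a"
    if ab: "a \<in> Basis" "b \<in> Basis" "entry (commutator x y) a b \<noteq> 0" for a b
  proof -
    have "(\<Sum>c\<in>Basis. entry x a c * entry y c b) \<noteq> 0 \<or> (\<Sum>c\<in>Basis. entry y a c * entry x c b) \<noteq> 0"
      using ab(3) by (auto simp: entry_commutator[OF e])
    then show ?thesis
    proof
      assume "(\<Sum>c\<in>Basis. entry x a c * entry y c b) \<noteq> 0"
      from prod[OF this] obtain c where c: "c \<in> Basis" "entry x a c \<noteq> 0" "entry y c b \<noteq> 0"
        by (elim bexE conjE)
      show ?thesis using filtD(2)[OF assms(1) ab(1) c(1,2)] filtD(2)[OF assms(2) c(1) ab(2) c(3)] by linarith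
    next
      assume "(\<Sum>c\<in>Basis. entry y a c * entry x c b) \<noteq> 0"
      from prod[OF this] obtain c where c: "c \<in> Basis" "entry y a c \<noteq> 0" "entry x c b \<noteq> 0"
        by (elim bexE conjE)
      show ?thesis using filtD(2)[OF assms(2) ab(1) c(1,2)] filtD(2)[OF assms(1) c(1) ab(2) c(3)] by linarith
    qed
  qed
  then show ?thesis
    by (intro filtI endo_commutator e)
qed

lemma filt_mono: "i \<le> j \<Longrightarrow> filt j \<subseteq> filt i"
proof
  fix x assume "i \<le> j" and x: "x \<in> filt j"
  show "x \<in> filt i"
  proof (rule filtI[OF filtD(1)[OF x]])
    fix a b assume "a \<in> Basis" "b \<in> Basis" "entry x a b \<noteq> 0"
    then have "lev b + j \<le> lev a" by (rule filtD(2)[OF x])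
    with \<open>i \<le> j\<close> show "lev b + i \<le> lev a" by linarith
  qed
qed

lemma filt_eq_zero: "x \<in> filt m \<Longrightarrow> x = (\<lambda>_. 0)"
proof (rule endo_eqI)
  assume x: "x \<in> filt m"
  then show "endo x" by (rule filtD)
  show "endo (\<lambda>_. 0)" by (rule ends.linear_zero)
  fix a b assume ab: "a \<in> Basis" "b \<in> Basis"
  have "\<not> lev b + m \<le> lev a" using lev_less[OF ab(1)] by simp
  then have "entry x a b = 0" using filtD(2)[OF x ab] by (rule contrapos_np) 
  then show "entry x a b = entry (\<lambda>_. 0) a b" by (simp add: entry_0)
qed

lemma lie_algebra_op_algebra: "lie_algebra (op_algebra g)"
proof (rule lie_subalgebra_lie_algebra[OF lie_algebra_lie_gl[OF vector_space_axioms]])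
  have "vectorspace class_ring (op_algebra {x. endo x})"
    using lie_algebra_lie_gl[OF vector_space_axioms] by (simp add: op_algebra_endo lie_algebra_def)
  then have "VectorSpace.subspace class_ring g (op_algebra {x. endo x})"
    using g_endo by (intro op_space_subspace g_op_space) auto
  then show "lie_subalgebra g (lie_gl scale)"
    using g_commutator by (simp add: lie_subalgebra_def op_algebra_endo)
qed

lemma vectorspace_op_algebra: "vectorspace class_ring (op_algebra g)"
  using lie_algebra_op_algebra by (simp add: lie_algebra_def)

lemma lie_ideal_rad: "lie_ideal rad (op_algebra g)"
  unfolding lie_ideal_def
  using op_space_subspace[OF op_space_rad rad_subset vectorspace_op_algebra] commutator_rad(1) by simp

lemma ideal_op_space:
  assumes "lie_ideal I (op_algebra g)"
  shows "op_space I" "I \<subseteq> g" "vectorspace class_ring (op_algebra I)" "lie_algebra (op_algebra I)"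
    "\<And>x y. x \<in> g \<Longrightarrow> y \<in> I \<Longrightarrow> commutator x y \<in> I"
proof -
  have s: "VectorSpace.subspace class_ring I (op_algebra g)"
    and "\<And>x y. x \<in> g \<Longrightarrow> y \<in> I \<Longrightarrow> commutator x y \<in> I"
    using assms by (simp_all add: lie_ideal_def)
  then show "\<And>x y. x \<in> g \<Longrightarrow> y \<in> I \<Longrightarrow> commutator x y \<in> I" by blast
  then show "lie_algebra (op_algebra I)"
    using lie_subalgebra_lie_algebra[OF lie_algebra_op_algebra, of I] s subspace_op_space[OF s] g_endo
    by (auto simp: lie_subalgebra_def)
  show "op_space I" "I \<subseteq> g" using subspace_op_space[OF s] g_endo by auto
  show "vectorspace class_ring (op_algebra I)"
    using vectorspace.subspace_is_vs[OF vectorspace_op_algebra s] by simp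
qed

lemma lie_solvable_rad: "lie_solvable (op_algebra rad)"
proof -
  note vs = ideal_op_space(3)[OF lie_ideal_rad]
  let ?D = "derived_series (op_algebra rad)"
  note alg = ideal_op_space(4)[OF lie_ideal_rad]
  have D: "?D k \<subseteq> rad" for k
    using derived_series_subspace(2)[OF alg, of k] by simp
  have "?D (Suc k) \<subseteq> filt (Suc k)" for k
  proof (induction k)
    case 0
    have "?D (Suc 0) \<subseteq> rad \<inter> filt 1"
      unfolding derived_series.simps
    proof (rule bracket_span_subset_subspace)
      show "VectorSpace.subspace class_ring (rad \<inter> filt 1) (op_algebra rad)"
        using op_space_rad op_space_filt[of 1] vs
        by (intro op_space_subspace) (auto simp: op_space_def)
    qed (use commutator_rad rad_subset in auto)
    then show ?case by simp
  next
    case (Suc k)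
    have "?D (Suc (Suc k)) \<subseteq> rad \<inter> filt (Suc (Suc k))"
      unfolding derived_series.simps(2)[of _ "Suc k"]
    proof (rule bracket_span_subset_subspace)
      show "VectorSpace.subspace class_ring (rad \<inter> filt (Suc (Suc k))) (op_algebra rad)"
        using op_space_rad op_space_filt[of "Suc (Suc k)"] vs
        by (intro op_space_subspace) (auto simp: op_space_def)
      fix x y assume xy: "x \<in> ?D (Suc k)" "y \<in> ?D (Suc k)"
      then have "commutator x y \<in> filt (Suc k + Suc k)"
        using Suc by (intro commutator_filt) blast+
      moreover have "filt (Suc k + Suc k) \<subseteq> filt (Suc (Suc k))" by (rule filt_mono) simp
      moreover have "commutator x y \<in> rad"
        using xy D rad_subset commutator_rad(1) by blast
      ultimately show "bracket (op_algebra rad) x y \<in> rad \<inter> filt (Suc (Suc k))" by auto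
    qed
    then show ?case by simp
  qed
  then have "?D (Suc m) \<subseteq> filt (Suc m)" .
  also have "\<dots> \<subseteq> filt m" by (rule filt_mono) simp
  also have "\<dots> \<subseteq> {\<lambda>_. 0}" using filt_eq_zero by blast
  finally have "?D (Suc m) \<subseteq> {\<lambda>_. 0}" .
  moreover have "VectorSpace.subspace class_ring (?D (Suc m)) (op_algebra rad)"
    by (rule derived_series_subspace(1)[OF alg])
  then have "(\<lambda>_. 0) \<in> ?D (Suc m)"
    using submodule.zero_closed[of class_ring "?D (Suc m)" "op_algebra rad"]
    by (simp add: VectorSpace.subspace_def)
  ultimately have "?D (Suc m) = {\<zero>\<^bsub>op_algebra rad\<^esub>}" by auto
  then show ?thesis unfolding lie_solvable_def ..
qed

text \<open>An ideal that contains a matrix unit within a block contains a copy of \<open>sl\<^sub>2\<close>.\<close>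

lemma unit_ideal_not_solvable:
  assumes I: "lie_ideal I (op_algebra g)" and ab: "a \<in> Basis" "b \<in> Basis" "a \<noteq> b" "lev a = lev b"
    and u: "unit_op a b \<in> I"
  shows "\<not> lie_solvable (op_algebra I)"
proof -
  note II = ideal_op_space[OF I]
  let ?e = "unit_op a b" and ?f = "unit_op b a" and ?h = "\<lambda>v. unit_op a a v - unit_op b b v"
  let ?D = "derived_series (op_algebra I)"
  have fg: "?f \<in> g" using ab by (intro unit_lev) auto
  have ef: "commutator ?e ?f = ?h" and he: "commutator ?h ?e = (\<lambda>v. 2 *s ?e v)"
    and fh: "commutator ?f ?h = (\<lambda>v. 2 *s ?f v)"
  proof -
    note s = fun_eq_iff commutator_apply unit_op_def coord_diff coord_scale coord_basis
    have two: "2 *s v = v + v" for v using scale_left_distrib[of 1 1 v] by simp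
    show "commutator ?e ?f = ?h"
      using ab by (simp add: s)
    show "commutator ?h ?e = (\<lambda>v. 2 *s ?e v)" "commutator ?f ?h = (\<lambda>v. 2 *s ?f v)"
      using ab unfolding two by (simp_all add: s)
  qed
  have br: "commutator x y \<in> ?D (Suc k)" if "x \<in> ?D k" "y \<in> ?D k" for x y k
    using bracket_in_derived_series[OF II(4) that] by (simp del: derived_series.simps)
  have sc: "x \<in> ?D (Suc k)" if "(\<lambda>v. 2 *s x v) \<in> ?D (Suc k)" for x k
  proof -
    have "op_space (?D (Suc k))"
      by (rule subspace_op_space(1)[OF derived_series_subspace(1)[OF II(4)]]) (simp add: op_spaceD(1)[OF II(1)])
    from op_space_scale_cancel[OF this that] show ?thesis by simp
  qed
  have "?e \<in> ?D k \<and> ?f \<in> ?D k \<and> ?h \<in> ?D k" for k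
  proof (induction k)
    case 0
    have eg: "?e \<in> g" using u II(2) by blast
    have "commutator ?e ?f = (\<lambda>v. (- 1) *s commutator ?f ?e v)"
      by (simp add: fun_eq_iff commutator_apply)
    then have h: "?h \<in> I"
      using op_spaceD(4)[OF II(1) II(5)[OF fg u], of "- 1"] by (simp only: ef)
    have "(\<lambda>v. 2 *s ?f v) \<in> I" using II(5)[OF fg h] by (simp only: fh)
    then have "?f \<in> I" by (rule op_space_scale_cancel[OF II(1)]) simp
    with h u show ?case by simp
  next
    case (Suc k)
    then show ?case
      using br[of ?e k ?f] sc[of ?e k] sc[of ?f k] br[of ?h k ?e] br[of ?f k ?h] by (simp only: ef he fh)
  qed
  moreover have "?e \<noteq> (\<lambda>_. 0)"
  proof
    assume "?e = (\<lambda>_. 0)"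
    then have "unit_op a b b = (\<lambda>_. 0) b" by (rule fun_cong)
    then have "a = 0" using ab by (simp add: unit_op_def coord_basis)
    then show False using ab(1) independent_Basis dependent_zero by blast
  qed
  ultimately show ?thesis
    unfolding lie_solvable_def by auto
qed

text \<open>
  The matrix unit comes from an off-diagonal entry inside a block, or, for different diagonal entries at
  \<open>a\<close> and \<open>b\<close>, from the commutator with the matrix unit at \<open>(a, b)\<close>.
\<close>

lemma solvable_ideal_subset_rad:
  assumes I: "lie_ideal I (op_algebra g)" "lie_solvable (op_algebra I)"
  shows "I \<subseteq> rad"
proof
  fix x assume x: "x \<in> I"
  note II = ideal_op_space[OF I(1)]
  have no: "unit_op a b \<notin> I" if "a \<in> Basis" "b \<in> Basis" "a \<noteq> b" "lev a = lev b" for a b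
    using unit_ideal_not_solvable[OF I(1) that] I(2) by blast
  have off: "entry y a b = 0" if "y \<in> I" "a \<in> Basis" "b \<in> Basis" "a \<noteq> b" "lev a = lev b" for y a b
    using unit_component[OF II(1) II(5) that(1-4)] no[OF that(2-5)] by blast
  have diag: "entry x a a = entry x b b" if ab: "a \<in> Basis" "b \<in> Basis" "lev a = lev b" for a b
  proof (cases "a = b")
    case False
    let ?e = "unit_op a b"
    have eg: "?e \<in> g" by (rule unit_lev[OF ab False])
    have "(\<Sum>c\<in>Basis. entry ?e a c * entry x c b) = (\<Sum>c\<in>Basis. if c = b then entry x b b else 0)"
      using ab by (intro sum.cong) (auto simp: entry_unit_op)
    moreover have "(\<Sum>c\<in>Basis. entry x a c * entry ?e c b) = (\<Sum>c\<in>Basis. if c = a then entry x a a else 0)"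
      using ab by (intro sum.cong) (auto simp: entry_unit_op)
    moreover have "endo x" using II(1) x by (rule op_spaceD)
    ultimately have "entry (commutator ?e x) a b = entry x b b - entry x a a"
      using ab finite_Basis by (simp add: entry_commutator endo_unit_op)
    then show ?thesis using off[OF II(5)[OF eg x] ab(1,2) False ab(3)] by simp
  qed simp
  show "x \<in> rad"
    by (rule radI[OF subsetD[OF II(2) x] off[OF x] diag])
qed

lemma lie_radical_eq_rad:
  assumes "lie_radical r (op_algebra g)"
  shows "r = rad"
proof
  have r: "lie_ideal r (op_algebra g)" "lie_solvable (op_algebra r)"
    and max: "\<And>I. lie_ideal I (op_algebra g) \<Longrightarrow> lie_solvable (op_algebra I) \<Longrightarrow> I \<subseteq> r"
    using assms by (simp_all add: lie_radical_def)
  show "r \<subseteq> rad" by (rule solvable_ideal_subset_rad[OF r])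
  show "rad \<subseteq> r" by (rule max[OF lie_ideal_rad lie_solvable_rad])
qed

end

section \<open>Splitting off the radical\<close>

text \<open>The projection of the \<open>n\<close>-by-\<open>n\<close> matrices to the traceless ones along the scalar matrices.\<close>

definition traceless_part :: "nat \<Rightarrow> 'k::field_char_0 mat \<Rightarrow> 'k mat" where
  "traceless_part n A = A - (mat_trace A / of_nat n) \<cdot>\<^sub>m 1\<^sub>m n"

lemma lie_sl_mat_simps [simp]:
  "carrier (lie_sl_mat n) = {A \<in> carrier_mat n n. mat_trace A = 0}"
  "zero (lie_sl_mat n) = 0\<^sub>m n n"
  "add (lie_sl_mat n) = (+)"
  "smult (lie_sl_mat n) = (\<cdot>\<^sub>m)"
  "bracket (lie_sl_mat n) = (\<lambda>A B. A * B - B * A)"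
  by (simp_all add: lie_sl_mat_def)

lemma traceless_part_carrier: "A \<in> carrier_mat n n \<Longrightarrow> traceless_part n A \<in> carrier_mat n n"
  unfolding traceless_part_def by (intro minus_carrier_mat smult_carrier_mat one_carrier_mat)

lemma traceless_part_index:
  "A \<in> carrier_mat n n \<Longrightarrow> i < n \<Longrightarrow> j < n \<Longrightarrow>
    traceless_part n A $$ (i, j) = A $$ (i, j) - (if i = j then mat_trace A / of_nat n else 0)"
  by (simp add: traceless_part_def)

lemma mat_trace_traceless_part:
  assumes "A \<in> carrier_mat n n" "n \<noteq> 0"
  shows "mat_trace (traceless_part n A) = 0"
proof -
  have "mat_trace (traceless_part n A) = (\<Sum>i<n. A $$ (i, i) - mat_trace A / of_nat n)"
    using carrier_matD[OF traceless_part_carrier[OF assms(1)]]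
    by (simp add: mat_trace_def[of "traceless_part n A"] traceless_part_index assms)
  also have "\<dots> = mat_trace A - mat_trace A"
    using assms by (simp add: sum_subtractf mat_trace_def)
  finally show ?thesis by simp
qed

lemma traceless_part_eq_self: "A \<in> carrier_mat n n \<Longrightarrow> mat_trace A = 0 \<Longrightarrow> traceless_part n A = A"
  by (intro eq_matI) (simp_all add: traceless_part_def)

lemma traceless_part_add:
  assumes "A \<in> carrier_mat n n" "B \<in> carrier_mat n n"
  shows "traceless_part n (A + B) = traceless_part n A + traceless_part n B"
proof -
  have "mat_trace (A + B) = mat_trace A + mat_trace B"
    using assms by (simp add: mat_trace_def sum.distrib)
  then show ?thesis
    using assms by (intro eq_matI) (simp_all add: traceless_part_def add_divide_distrib)
qed

lemma traceless_part_smult: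
  assumes "A \<in> carrier_mat n n"
  shows "traceless_part n (c \<cdot>\<^sub>m A) = c \<cdot>\<^sub>m traceless_part n A"
proof -
  have "mat_trace (c \<cdot>\<^sub>m A) = c * mat_trace A"
    using assms by (simp add: mat_trace_def sum_distrib_left)
  then show ?thesis
    using assms by (intro eq_matI) (simp_all add: traceless_part_def right_diff_distrib)
qed

lemma mult_traceless_part_index:
  assumes A: "A \<in> carrier_mat n n" and B: "B \<in> carrier_mat n n" and ij: "i < n" "j < n"
  defines "\<alpha> \<equiv> mat_trace A / of_nat n" and "\<beta> \<equiv> mat_trace B / of_nat n"
  shows "(traceless_part n A * traceless_part n B) $$ (i, j)
    = (A * B) $$ (i, j) - A $$ (i, j) * \<beta> - \<alpha> * B $$ (i, j) + (if i = j then \<alpha> * \<beta> else 0)"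
proof -
  let ?a = "\<lambda>k. A $$ (i, k)" and ?b = "\<lambda>k. B $$ (k, j)"
  note tA = traceless_part_carrier[OF A] and tB = traceless_part_carrier[OF B]
  have mult: "(X * Y) $$ (i, j) = (\<Sum>k<n. X $$ (i, k) * Y $$ (k, j))"
    if "X \<in> carrier_mat n n" "Y \<in> carrier_mat n n" for X Y :: "'a mat"
    using that ij by (simp add: scalar_prod_def atLeast0LessThan)
  have "(traceless_part n A * traceless_part n B) $$ (i, j)
      = (\<Sum>k<n. (?a k - (if i = k then \<alpha> else 0)) * (?b k - (if k = j then \<beta> else 0)))"
    unfolding mult[OF tA tB] \<alpha>_def \<beta>_def using ij
    by (intro sum.cong) (simp_all add: traceless_part_index[OF A] traceless_part_index[OF B])
  also have "\<dots> = (\<Sum>k<n. ?a k * ?b k) - (\<Sum>k<n. if k = j then ?a j * \<beta> else 0)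
      - (\<Sum>k<n. if i = k then \<alpha> * ?b i else 0) + (\<Sum>k<n. if i = k then (if i = j then \<alpha> * \<beta> else 0) else 0)"
    unfolding sum_subtractf[symmetric] sum.distrib[symmetric]
    by (intro sum.cong) (auto simp: algebra_simps)
  also have "\<dots> = (\<Sum>k<n. ?a k * ?b k) - ?a j * \<beta> - \<alpha> * ?b i + (if i = j then \<alpha> * \<beta> else 0)"
    using ij by simp
  finally show ?thesis by (simp add: mult[OF A B])
qed

lemma traceless_part_commutator:
  assumes A: "A \<in> carrier_mat n n" and B: "B \<in> carrier_mat n n" and n: "n \<noteq> 0"
  shows "traceless_part n (A * B - B * A)
    = traceless_part n A * traceless_part n B - traceless_part n B * traceless_part n A"
proof -
  let ?C = "traceless_part n A * traceless_part n B - traceless_part n B * traceless_part n A"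
  note tA = traceless_part_carrier[OF A] and tB = traceless_part_carrier[OF B]
  have eq: "A * B - B * A = ?C"
  proof (rule eq_matI)
    fix i j assume "i < dim_row ?C" "j < dim_col ?C"
    then have ij: "i < n" "j < n" using tA tB by auto
    have "(A * B - B * A) $$ (i, j) = (A * B) $$ (i, j) - (B * A) $$ (i, j)"
      using A B ij by simp
    moreover have "?C $$ (i, j) = (traceless_part n A * traceless_part n B) $$ (i, j)
        - (traceless_part n B * traceless_part n A) $$ (i, j)"
      using tA tB ij by simp
    ultimately show "(A * B - B * A) $$ (i, j) = ?C $$ (i, j)"
      using mult_traceless_part_index[OF A B ij] mult_traceless_part_index[OF B A ij]
      by (simp only:) (simp add: mult.commute)
  qed (use A B tA tB in auto)
  have "?C \<in> carrier (lie_sl_mat n)"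
    using lie_algebra.bracket_closed[OF lie_algebra_lie_sl_mat, of "traceless_part n A" n "traceless_part n B"]
      tA tB mat_trace_traceless_part[OF A n] mat_trace_traceless_part[OF B n] by simp
  then show ?thesis
    unfolding eq by (intro traceless_part_eq_self) simp_all
qed

context block_algebra
begin

lemma a_minus_op_algebra:
  assumes "x \<in> g" "y \<in> g"
  shows "x \<ominus>\<^bsub>op_algebra g\<^esub> y = (\<lambda>v. x v - y v)"
proof -
  interpret G: lie_algebra "op_algebra g" by (rule lie_algebra_op_algebra)
  have neg: "(\<lambda>v. - y v) \<in> g"
    using op_spaceD(4)[OF g_op_space assms(2), of "- 1"] by simp
  have "\<ominus>\<^bsub>op_algebra g\<^esub> y = (\<lambda>v. - y v)"
    using G.minus_equality[of "\<lambda>v. - y v" y] assms neg by simp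
  then show ?thesis by (simp add: a_minus_def)
qed

text \<open>
  The projection \<open>\<psi>\<close> takes the traceless parts of the diagonal blocks, and \<open>\<sigma>\<close> is the inclusion of the block
  diagonal operators. Blocks of size one contribute nothing and are left out of \<open>F\<close>.
\<close>

lemma semidirect_decomposition:
  assumes n: "\<And>f. f < m \<Longrightarrow> n f = card (block f)" and F: "F = {f. f < m \<and> n f \<ge> 2}"
  shows "\<exists>\<theta>. lie_derivation_action (lie_direct_sum F (\<lambda>f. lie_sl_mat (n f))) (op_algebra rad) \<theta> \<and>
    lie_isomorphic (op_algebra g)
      (lie_semidirect (op_algebra rad) (lie_direct_sum F (\<lambda>f. lie_sl_mat (n f))) \<theta>)"
proof -
  let ?S = "lie_direct_sum F (\<lambda>f. lie_sl_mat (n f)) :: ('k, nat \<Rightarrow> 'k mat) lie_algebra"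
  have Fm: "f < m" "n f \<noteq> 0" if "f \<in> F" for f using that F by auto
  have "\<exists>e. bij_betw e {..<n f} (block f)" if "f < m" for f
    using ex_bij_betw_nat_finite[OF finite_block, of f] n[OF that] by (simp add: atLeast0LessThan)
  then obtain e where e: "\<And>f. f < m \<Longrightarrow> bij_betw (e f) {..<n f} (block f)" by metis
  \<comment> \<open>\<open>e f\<close> enumerates block \<open>f\<close>, and \<open>idx a\<close> is the position of \<open>a\<close> in its block.\<close>
  define idx where "idx a = inv_into {..<n (lev a)} (e (lev a)) a" for a
  have eB: "e f i \<in> Basis" "lev (e f i) = f" if "f < m" "i < n f" for f i
    using bij_betw_apply[OF e[OF that(1)], of i] that by (auto simp: block_def)
  have idx_e: "idx (e f i) = i" if "f < m" "i < n f" for f i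
    using that e[OF that(1)] by (simp add: idx_def eB inv_into_f_f bij_betw_def)
  have e_idx: "e (lev a) (idx a) = a" and idx_less: "idx a < n (lev a)" if "a \<in> Basis" for a
  proof -
    have a: "a \<in> e (lev a) ` {..<n (lev a)}"
      using e[OF lev_less[OF that]] that by (simp add: bij_betw_def block_def)
    show "e (lev a) (idx a) = a" unfolding idx_def by (rule f_inv_into_f[OF a])
    show "idx a < n (lev a)" using inv_into_into[OF a] by (simp add: idx_def)
  qed
  have e_inj: "e f i = e f j \<longleftrightarrow> i = j" if "f < m" "i < n f" "j < n f" for f i j
    using that idx_e by metis
  have sum_block: "(\<Sum>b\<in>block f. h b) = (\<Sum>i<n f. h (e f i))" if "f < m" for f and h :: "'v \<Rightarrow> 'k"
    by (rule sum.reindex_bij_betw[OF e[OF that], symmetric])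

  define blk where "blk x f = mat (n f) (n f) (\<lambda>(i, j). entry x (e f i) (e f j))" for x f
  have blk_carrier: "blk x f \<in> carrier_mat (n f) (n f)" for x f
    by (simp add: blk_def)
  have blk_add: "blk (\<lambda>v. x v + y v) f = blk x f + blk y f" for x y f
    by (intro eq_matI) (simp_all add: blk_def entry_add)
  have blk_scale: "blk (\<lambda>v. c *s x v) f = c \<cdot>\<^sub>m blk x f" for x c f
    by (intro eq_matI) (simp_all add: blk_def entry_scale)
  have blk_mult: "(\<Sum>c\<in>Basis. entry x (e f i) c * entry y c (e f j)) = (blk x f * blk y f) $$ (i, j)"
    if "x \<in> g" "y \<in> g" "f < m" "i < n f" "j < n f" for x y f i j
  proof -
    have "(\<Sum>c\<in>Basis. entry x (e f i) c * entry y c (e f j)) = (\<Sum>c\<in>block f. entry x (e f i) c * entry y c (e f j))"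
      using that eB by (intro entry_product_block) simp_all
    also have "\<dots> = (\<Sum>k<n f. entry x (e f i) (e f k) * entry y (e f k) (e f j))"
      by (rule sum_block[OF that(3)])
    also have "\<dots> = (blk x f * blk y f) $$ (i, j)"
      using that by (simp add: blk_def scalar_prod_def atLeast0LessThan)
    finally show ?thesis .
  qed
  have blk_commutator: "blk (commutator x y) f = blk x f * blk y f - blk y f * blk x f"
    if "x \<in> g" "y \<in> g" "f < m" for x y f
  proof (rule eq_matI)
    fix i j assume "i < dim_row (blk x f * blk y f - blk y f * blk x f)"
      "j < dim_col (blk x f * blk y f - blk y f * blk x f)"
    then have ij: "i < n f" "j < n f" by (simp_all add: blk_def)
    have "blk (commutator x y) f $$ (i, j) = entry (commutator x y) (e f i) (e f j)"
      using ij by (simp add: blk_def)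
    also have "\<dots> = (blk x f * blk y f) $$ (i, j) - (blk y f * blk x f) $$ (i, j)"
      unfolding entry_commutator[OF g_endo[OF that(1)] g_endo[OF that(2)]]
        blk_mult[OF that ij] blk_mult[OF that(2,1,3) ij] ..
    also have "\<dots> = (blk x f * blk y f - blk y f * blk x f) $$ (i, j)"
      using ij by (simp add: blk_def)
    finally show "blk (commutator x y) f $$ (i, j) = (blk x f * blk y f - blk y f * blk x f) $$ (i, j)" .
  qed (simp_all add: blk_def)

  define \<psi> where "\<psi> x = (\<lambda>f\<in>F. traceless_part (n f) (blk x f))" for x
  define \<sigma> where "\<sigma> s = of_entries (\<lambda>a b. if lev a = lev b \<and> lev a \<in> F then s (lev a) $$ (idx a, idx b) else 0)"
    for s :: "nat \<Rightarrow> 'k mat"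
  have \<sigma>_entry: "entry (\<sigma> s) a b = (if lev a = lev b \<and> lev a \<in> F then s (lev a) $$ (idx a, idx b) else 0)"
    if "a \<in> Basis" "b \<in> Basis" for s a b
    unfolding \<sigma>_def by (rule entry_of_entries[OF that])
  have \<sigma>_endo: "endo (\<sigma> s)" for s
    unfolding \<sigma>_def by (rule endo_of_entries)
  have blk_\<sigma>: "blk (\<sigma> s) f = s f" if "f \<in> F" "s f \<in> carrier_mat (n f) (n f)" for s f
    using that Fm eB by (intro eq_matI) (auto simp: blk_def \<sigma>_entry idx_e)
  have S_carrier: "s \<in> carrier ?S \<longleftrightarrow> s \<in> extensional F \<and> (\<forall>f\<in>F. s f \<in> carrier_mat (n f) (n f) \<and> mat_trace (s f) = 0)" for s
    by (auto simp: lie_direct_sum_def PiE_iff)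
  have S_ops: "\<zero>\<^bsub>?S\<^esub> = (\<lambda>f\<in>F. 0\<^sub>m (n f) (n f))" "s \<oplus>\<^bsub>?S\<^esub> t = (\<lambda>f\<in>F. s f + t f)"
    "c \<odot>\<^bsub>?S\<^esub> s = (\<lambda>f\<in>F. c \<cdot>\<^sub>m s f)" "bracket ?S s t = (\<lambda>f\<in>F. s f * t f - t f * s f)" for s t c
    by (simp_all add: lie_direct_sum_def)
  have \<sigma>g: "\<sigma> s \<in> g" if s: "s \<in> carrier ?S" for s
  proof (rule in_gI[OF \<sigma>_endo])
    show "unit_op a b \<in> g" if "a \<in> Basis" "b \<in> Basis" "a \<noteq> b" "entry (\<sigma> s) a b \<noteq> 0" for a b
      using that by (intro unit_lev) (auto simp: \<sigma>_entry split: if_splits)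
    have "(\<Sum>b\<in>block f. entry (\<sigma> s) b b) = 0" if "f < m" for f
    proof (cases "f \<in> F")
      case True
      then have sf: "s f \<in> carrier_mat (n f) (n f)" "mat_trace (s f) = 0" using s by (auto simp: S_carrier)
      have "(\<Sum>b\<in>block f. entry (\<sigma> s) b b) = (\<Sum>i<n f. s f $$ (i, i))"
        unfolding sum_block[OF that] using True that
        by (intro sum.cong) (simp_all add: \<sigma>_entry eB idx_e)
      then show ?thesis using sf by (simp add: mat_trace_def)
    next
      case False
      then show ?thesis by (intro sum.neutral) (auto simp: block_def \<sigma>_entry)
    qed
    moreover have "(\<Sum>b\<in>Basis. entry (\<sigma> s) b b) = (\<Sum>f<m. \<Sum>b\<in>block f. entry (\<sigma> s) b b)"
      unfolding block_def using lev_less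
      by (intro sum.group[symmetric]) (auto simp: finite_Basis)
    ultimately show "(\<Sum>b\<in>Basis. entry (\<sigma> s) b b) = 0" by simp
  qed
  have \<psi>S: "\<psi> x \<in> carrier ?S" for x
    using Fm by (simp add: S_carrier \<psi>_def traceless_part_carrier blk_carrier mat_trace_traceless_part)
  have \<psi>_\<sigma>: "\<psi> (\<sigma> s) = s" if "s \<in> carrier ?S" for s
  proof (rule extensionalityI[where A = F])
    show "s \<in> extensional F" using that by (simp add: S_carrier)
    fix f assume "f \<in> F"
    then show "\<psi> (\<sigma> s) f = s f"
      using that by (simp add: S_carrier \<psi>_def blk_\<sigma> traceless_part_eq_self)
  qed (simp add: \<psi>_def)
  have \<sigma>_bracket: "\<sigma> (bracket ?S s t) = commutator (\<sigma> s) (\<sigma> t)"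
    if s: "s \<in> carrier ?S" and t: "t \<in> carrier ?S" for s t
  proof (rule endo_eqI[OF \<sigma>_endo endo_commutator[OF \<sigma>_endo \<sigma>_endo]])
    fix a b assume ab: "a \<in> Basis" "b \<in> Basis"
    show "entry (\<sigma> (bracket ?S s t)) a b = entry (commutator (\<sigma> s) (\<sigma> t)) a b"
    proof (cases "lev a = lev b \<and> lev a \<in> F")
      case True
      define f where "f = lev a"
      have f: "f \<in> F" "lev b = f" using True by (auto simp: f_def)
      have ij: "idx a < n f" "idx b < n f" "e f (idx a) = a" "e f (idx b) = b"
        using idx_less e_idx ab f(2) f_def by metis+
      have st: "s f \<in> carrier_mat (n f) (n f)" "t f \<in> carrier_mat (n f) (n f)"
        using s t f by (auto simp: S_carrier)
      have "entry (commutator (\<sigma> s) (\<sigma> t)) a b = blk (commutator (\<sigma> s) (\<sigma> t)) f $$ (idx a, idx b)"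
        using ij by (simp add: blk_def)
      also have "\<dots> = (s f * t f - t f * s f) $$ (idx a, idx b)"
        using f(1) st by (simp add: blk_commutator[OF \<sigma>g[OF s] \<sigma>g[OF t] Fm(1)] blk_\<sigma>)
      also have "\<dots> = entry (\<sigma> (bracket ?S s t)) a b"
        using ab f by (simp add: \<sigma>_entry S_ops f_def[symmetric])
      finally show ?thesis ..
    next
      case False
      have "(\<Sum>c\<in>Basis. entry (\<sigma> s) a c * entry (\<sigma> t) c b) = 0" for s t
        using False ab by (intro sum.neutral) (auto simp: \<sigma>_entry)
      then have "entry (commutator (\<sigma> s) (\<sigma> t)) a b = 0"
        by (simp add: entry_commutator \<sigma>_endo)
      moreover have "entry (\<sigma> (bracket ?S s t)) a b = 0"
        using False ab by (auto simp: \<sigma>_entry)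
      ultimately show ?thesis by simp
    qed
  qed
  have \<sigma>_hom: "\<sigma> \<in> LinearCombinations.module_hom class_ring ?S (op_algebra g)"
    unfolding LinearCombinations.module_hom_def
  proof (intro CollectI conjI allI impI)
    show "\<sigma> \<in> carrier ?S \<rightarrow> carrier (op_algebra g)" using \<sigma>g by simp
  next
    fix s t assume "s \<in> carrier ?S \<and> t \<in> carrier ?S"
    then have st: "s f \<in> carrier_mat (n f) (n f)" "t f \<in> carrier_mat (n f) (n f)" if "f \<in> F" for f
      using that by (simp_all add: S_carrier)
    have "\<sigma> (s \<oplus>\<^bsub>?S\<^esub> t) = (\<lambda>v. \<sigma> s v + \<sigma> t v)"
    proof (rule endo_eqI[OF \<sigma>_endo endo_add_op[OF \<sigma>_endo \<sigma>_endo]])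
      fix a b assume ab: "a \<in> Basis" "b \<in> Basis"
      show "entry (\<sigma> (s \<oplus>\<^bsub>?S\<^esub> t)) a b = entry (\<lambda>v. \<sigma> s v + \<sigma> t v) a b"
        using carrier_matD[OF st(1)] carrier_matD[OF st(2)] idx_less[OF ab(1)] idx_less[OF ab(2)]
        by (auto simp: entry_add \<sigma>_entry[OF ab] S_ops)
    qed
    then show "\<sigma> (s \<oplus>\<^bsub>?S\<^esub> t) = \<sigma> s \<oplus>\<^bsub>op_algebra g\<^esub> \<sigma> t" by simp
  next
    fix c :: 'k and s assume "c \<in> carrier class_ring \<and> s \<in> carrier ?S"
    then have st: "s f \<in> carrier_mat (n f) (n f)" if "f \<in> F" for f
      using that by (simp add: S_carrier)
    have "\<sigma> (c \<odot>\<^bsub>?S\<^esub> s) = (\<lambda>v. c *s \<sigma> s v)"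
    proof (rule endo_eqI[OF \<sigma>_endo endo_scale_op[OF \<sigma>_endo]])
      fix a b assume ab: "a \<in> Basis" "b \<in> Basis"
      show "entry (\<sigma> (c \<odot>\<^bsub>?S\<^esub> s)) a b = entry (\<lambda>v. c *s \<sigma> s v) a b"
        using carrier_matD[OF st] idx_less[OF ab(1)] idx_less[OF ab(2)]
        by (auto simp: entry_scale \<sigma>_entry[OF ab] S_ops)
    qed
    then show "\<sigma> (c \<odot>\<^bsub>?S\<^esub> s) = c \<odot>\<^bsub>op_algebra g\<^esub> \<sigma> s" by simp
  qed
  have \<psi>_hom: "\<psi> \<in> LinearCombinations.module_hom class_ring (op_algebra g) ?S"
    unfolding LinearCombinations.module_hom_def
  proof (intro CollectI conjI allI impI)
    show "\<psi> \<in> carrier (op_algebra g) \<rightarrow> carrier ?S" using \<psi>S by simp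
  qed (simp_all add: S_ops \<psi>_def blk_add blk_scale traceless_part_add[OF blk_carrier blk_carrier]
      traceless_part_smult[OF blk_carrier] cong: restrict_cong)
  have \<psi>_bracket: "\<psi> (commutator x y) = bracket ?S (\<psi> x) (\<psi> y)" if "x \<in> g" "y \<in> g" for x y
    unfolding S_ops \<psi>_def
    by (rule restrict_ext)
      (simp add: blk_commutator[OF that Fm(1)] traceless_part_commutator[OF blk_carrier blk_carrier Fm(2)])
  have \<psi>_rad: "\<psi> x = \<zero>\<^bsub>?S\<^esub>" if x: "x \<in> rad" for x
    unfolding S_ops \<psi>_def
  proof (rule restrict_ext)
    fix f assume f: "f \<in> F"
    define c where "c = entry x (e f 0) (e f 0)"
    have ent: "entry x (e f i) (e f j) = (if i = j then c else 0)" if "i < n f" "j < n f" for i j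
    proof (cases "i = j")
      case True
      then show ?thesis
        unfolding c_def using radD(3)[OF x, of "e f i" "e f 0"] that eB Fm[OF f] by simp
    next
      case False
      then show ?thesis
        using radD(2)[OF x, of "e f i" "e f j"] that eB Fm[OF f] e_inj by simp
    qed
    have "mat_trace (blk x f) = of_nat (n f) * c"
      by (simp add: mat_trace_def blk_def ent)
    then show "traceless_part (n f) (blk x f) = 0\<^sub>m (n f) (n f)"
      using Fm(2)[OF f] by (intro eq_matI) (auto simp: traceless_part_def blk_def ent)
  qed
  have compl: "(\<lambda>v. x v - \<sigma> (\<psi> x) v) \<in> rad" if x: "x \<in> g" for x
  proof -
    have in_g: "(\<lambda>v. x v - \<sigma> (\<psi> x) v) \<in> g"
      by (rule op_space_diff[OF g_op_space x \<sigma>g[OF \<psi>S]])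
    \<comment> \<open>A block outside \<open>F\<close> has only one element.\<close>
    have F_block: "a = b" if "a \<in> Basis" "b \<in> Basis" "lev a = lev b" "lev a \<notin> F" for a b
    proof -
      have "card (block (lev a)) \<le> 1"
        using that(4) lev_less[OF that(1)] n F by auto
      then show ?thesis
        using that(1-3) card_le_Suc0_iff_eq[OF finite_block, of "lev a"] by (simp add: block_def)
    qed
    have ent: "entry (\<lambda>v. x v - \<sigma> (\<psi> x) v) a b
        = (if a = b then mat_trace (blk x (lev a)) / of_nat (n (lev a)) else 0)"
      if ab: "a \<in> Basis" "b \<in> Basis" "lev a = lev b" "lev a \<in> F" for a b
    proof -
      define f where "f = lev a"
      have f: "f \<in> F" "lev b = f" using that by (simp_all add: f_def)
      have ij: "idx a < n f" "idx b < n f" "e f (idx a) = a" "e f (idx b) = b"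
        using idx_less e_idx ab f(2) f_def by metis+
      have "idx a = idx b \<longleftrightarrow> a = b" using ij by metis
      moreover have "blk x f $$ (idx a, idx b) = entry x a b" using ij by (simp add: blk_def)
      moreover have "entry (\<sigma> (\<psi> x)) a b = traceless_part (n f) (blk x f) $$ (idx a, idx b)"
        using f ab by (simp add: \<sigma>_entry f_def[symmetric] \<psi>_def)
      ultimately show ?thesis
        unfolding entry_diff f_def[symmetric] using traceless_part_index[OF blk_carrier ij(1,2), of x] by simp
    qed
    show ?thesis
    proof (rule radI[OF in_g])
      fix a b assume ab: "a \<in> Basis" "b \<in> Basis" "lev a = lev b"
      show "entry (\<lambda>v. x v - \<sigma> (\<psi> x) v) a b = 0" if "a \<noteq> b"
        using F_block[OF ab] ent[OF ab] that by (cases "lev a \<in> F") auto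
      show "entry (\<lambda>v. x v - \<sigma> (\<psi> x) v) a a = entry (\<lambda>v. x v - \<sigma> (\<psi> x) v) b b"
      proof (cases "lev a \<in> F")
        case True
        then show ?thesis using ent[OF ab(1,1)] ent[OF ab(2,2)] ab(3) by simp
      next
        case False
        then show ?thesis using F_block[OF ab] by simp
      qed
    qed
  qed
  have "\<exists>\<theta>. lie_derivation_action ?S ((op_algebra g)\<lparr>carrier := rad\<rparr>) \<theta> \<and>
      lie_isomorphic (op_algebra g) (lie_semidirect ((op_algebra g)\<lparr>carrier := rad\<rparr>) ?S \<theta>)"
  proof (rule lie_algebra.split_extension_semidirect[OF lie_algebra_op_algebra lie_ideal_rad \<psi>_hom _ \<sigma>_hom])
    show "\<psi> (bracket (op_algebra g) x y) = bracket ?S (\<psi> x) (\<psi> y)"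
      if "x \<in> carrier (op_algebra g)" "y \<in> carrier (op_algebra g)" for x y
      using \<psi>_bracket that by simp
    show "\<sigma> (bracket ?S s t) = bracket (op_algebra g) (\<sigma> s) (\<sigma> t)"
      if "s \<in> carrier ?S" "t \<in> carrier ?S" for s t
      using \<sigma>_bracket[OF that] by simp
    show "\<zero>\<^bsub>?S\<^esub> \<oplus>\<^bsub>?S\<^esub> s = s" if "s \<in> carrier ?S" for s
    proof (rule extensionalityI[where A = F])
      show "s \<in> extensional F" using that by (simp add: S_carrier)
      show "(\<zero>\<^bsub>?S\<^esub> \<oplus>\<^bsub>?S\<^esub> s) f = s f" if "f \<in> F" for f
        using that \<open>s \<in> carrier ?S\<close> by (simp add: S_ops S_carrier)
    qed (simp add: S_ops)
    show "x \<ominus>\<^bsub>op_algebra g\<^esub> \<sigma> (\<psi> x) \<in> rad" if "x \<in> carrier (op_algebra g)" for x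
      using that compl \<sigma>g[OF \<psi>S] by (simp add: a_minus_op_algebra)
  qed (fact \<psi>_\<sigma> \<psi>_rad)+
  then show ?thesis by simp
qed

end

section \<open>Composition series\<close>

text \<open>A composition series of \<open>V\<close> as a module over a Lie algebra as above.\<close>

locale composition_torus_algebra = torus_algebra scale Basis g
  for scale :: "'k::{alg_closed_field, field_char_0} \<Rightarrow> 'v::ab_group_add \<Rightarrow> 'v" (infixr \<open>*s\<close> 75)
    and Basis :: "'v set" and g :: "('v \<Rightarrow> 'v) set" +
  fixes V :: "nat \<Rightarrow> 'v set" and m :: nat
  assumes series: "composition_series g (\<lambda>x. x) (vector_space_record scale) m V"
begin

text \<open>
  The level of a basis vector is the index of the last member of the series that contains it. Only the
  indices up to \<open>m\<close> matter; as \<open>V m\<close> is zero, the search for the first member that omits \<open>b\<close> ends there.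
\<close>

definition level :: "'v \<Rightarrow> nat" where
  "level b = (LEAST i. b \<notin> V (Suc i))"

lemma V_0: "V 0 = UNIV" and V_m: "V m = {0}"
  using series by (simp_all add: composition_series_def)

lemma V_subspace: "i \<le> m \<Longrightarrow> subspace (V i)"
  and V_invariant: "i \<le> m \<Longrightarrow> \<forall>x\<in>g. \<forall>v\<in>V i. x v \<in> V i"
  using series by (simp_all add: composition_series_def lie_submodule_def subspace_record_iff)

lemma V_Suc: "i < m \<Longrightarrow> V (Suc i) \<subseteq> V i"
  using series by (auto simp: composition_series_def)

lemma V_antimono: "i \<le> j \<Longrightarrow> j \<le> m \<Longrightarrow> V j \<subseteq> V i"
proof (induction j rule: dec_induct)
  case (step j)
  then show ?case using V_Suc[of j] by auto
qed simp

lemma level_spec: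
  assumes b: "b \<in> Basis"
  shows "level b < m" "b \<in> V (level b)" "b \<notin> V (Suc (level b))"
proof -
  have b0: "b \<noteq> 0" using b independent_Basis dependent_zero by blast
  then have "m \<noteq> 0" using V_0 V_m by (metis UNIV_I singletonD)
  then have "b \<notin> V (Suc (m - 1))" using b0 V_m by simp
  then have "level b \<le> m - 1" and l: "b \<notin> V (Suc (level b))"
    unfolding level_def by (rule Least_le, rule LeastI)
  then show "level b < m" "b \<notin> V (Suc (level b))" using \<open>m \<noteq> 0\<close> by auto
  show "b \<in> V (level b)"
  proof (cases "level b")
    case 0
    then show ?thesis using V_0 by simp
  next
    case (Suc i)
    then have "i < level b" by simp
    then have "\<not> b \<notin> V (Suc i)" unfolding level_def by (rule not_less_Least)
    then show ?thesis using Suc by simp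
  qed
qed

lemma level_eq_iff:
  assumes b: "b \<in> Basis" and f: "f < m"
  shows "level b = f \<longleftrightarrow> b \<in> V f \<and> b \<notin> V (Suc f)"
proof
  assume "level b = f"
  then show "b \<in> V f \<and> b \<notin> V (Suc f)" using level_spec[OF b] by simp
next
  assume bf: "b \<in> V f \<and> b \<notin> V (Suc f)"
  have "\<not> level b < f" using V_antimono[of "Suc (level b)" f] level_spec(3)[OF b] bf f by auto
  moreover have "\<not> f < level b" using V_antimono[of "Suc f" "level b"] level_spec(1,2)[OF b] bf by auto
  ultimately show "level b = f" by simp
qed

sublocale block_algebra scale Basis g level m
proof
  show "level b < m" if "b \<in> Basis" for b by (rule level_spec(1)[OF that])
next
  fix x a b assume x: "x \<in> g" and ab: "a \<in> Basis" "b \<in> Basis" "entry x a b \<noteq> 0"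
  have lb: "level b \<le> m" using level_spec(1)[OF ab(2)] by simp
  have "x b \<in> V (level b)"
    by (rule bspec[OF bspec[OF V_invariant[OF lb] x] level_spec(2)[OF ab(2)]])
  from invariant_coord[OF V_subspace[OF lb] V_invariant[OF lb] this ab(1)]
  have aV: "a \<in> V (level b)" using ab(3) by (simp add: entry_def)
  show "level b \<le> level a"
  proof (rule ccontr)
    assume "\<not> level b \<le> level a"
    then have "V (level b) \<subseteq> V (Suc (level a))" using lb by (intro V_antimono) auto
    then show False using level_spec(3)[OF ab(1)] aV by blast
  qed
next
  fix a b assume ab: "a \<in> Basis" "b \<in> Basis" "level a = level b" "a \<noteq> b"
  define f where "f = level a"
  have f: "f < m" using level_spec(1)[OF ab(1)] by (simp add: f_def)
  then have le: "Suc f \<le> m" "f \<le> m" by simp_all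
  have simple: "X = V (Suc f) \<or> X = V f"
    if X: "subspace X" "V (Suc f) \<subseteq> X" "X \<subseteq> V f" "\<forall>x\<in>g. \<forall>v\<in>X. x v \<in> X" for X
  proof (rule composition_series_simple[OF vector_space_axioms series f g_endo X(1-3)])
    fix x w assume "x \<in> g" "w \<in> X"
    then show "x w \<in> X" by (rule bspec[OF bspec[OF X(4)]])
  qed
  have mem: "a \<in> V f" "b \<in> V f" "a \<notin> V (Suc f)" "b \<notin> V (Suc f)"
    using level_spec(2,3)[OF ab(1)] level_spec(2,3)[OF ab(2)] by (simp_all add: f_def ab(3))
  show "unit_op a b \<in> g"
    by (rule simple_quotient_units[OF V_subspace[OF le(1)] V_invariant[OF le(1)] V_subspace[OF le(2)]
        V_invariant[OF le(2)] V_Suc[OF f] simple ab(1,2) mem ab(4)])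
qed

lemma dim_subquotient:
  assumes f: "f < m"
  shows "vectorspace.dim class_ring (subquotient (vector_space_record scale) V f) = card (block f)"
  unfolding subquotient_def
proof (rule dim_quot)
  have le: "Suc f \<le> m" "f \<le> m" using f by simp_all
  show U: "subspace (V (Suc f))" and W: "subspace (V f)" using V_subspace le by simp_all
  show "finite (block f)" by (rule finite_block)
  have block: "b \<in> block f \<longleftrightarrow> b \<in> Basis \<and> b \<in> V f \<and> b \<notin> V (Suc f)" for b
    using level_eq_iff[OF _ f, of b] by (cases "b \<in> Basis") (simp_all add: block_def)
  show "block f \<subseteq> V f"
  proof
    fix b assume "b \<in> block f"
    then show "b \<in> V f" by (simp only: block)
  qed
  show "\<forall>t\<in>block f. c t = 0" if *: "(\<Sum>t\<in>block f. c t *s t) \<in> V (Suc f)" for c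
  proof (rule ballI, rule ccontr)
    fix b assume b: "b \<in> block f" and c: "c b \<noteq> 0"
    have bB: "b \<in> Basis" using b by (simp add: block_def)
    have eq: "coord b (\<Sum>t\<in>block f. c t *s t) = c b"
    proof -
      have "coord b (c t *s t) = (if t = b then c t else 0)" if "t \<in> block f" for t
        using that by (simp add: coord_scale coord_basis block_def)
      then have "coord b (\<Sum>t\<in>block f. c t *s t) = (\<Sum>t\<in>block f. if t = b then c t else 0)"
        unfolding coord_sum by (rule sum.cong[OF refl])
      also have "\<dots> = c b" using b finite_block[of f] by simp
      finally show ?thesis .
    qed
    have "b \<in> V (Suc f)"
      by (rule invariant_coord[OF U V_invariant[OF le(1)] * bB]) (simp only: eq c not_False_eq_True)
    then show False using b by (simp only: block simp_thms)
  qed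
  show "\<exists>c. w - (\<Sum>t\<in>block f. c t *s t) \<in> V (Suc f)" if w: "w \<in> V f" for w
  proof (rule exI[of _ "\<lambda>b. coord b w"])
    have "w = (\<Sum>b\<in>Basis. coord b w *s b)" by (simp only: coord_expansion)
    also have "\<dots> = (\<Sum>b\<in>Basis - block f. coord b w *s b) + (\<Sum>b\<in>block f. coord b w *s b)"
      by (rule sum.subset_diff) (auto simp: block_def finite_Basis)
    finally have "w - (\<Sum>b\<in>block f. coord b w *s b) = (\<Sum>b\<in>Basis - block f. coord b w *s b)"
      by (rule diff_eq_eq[THEN iffD2])
    moreover have "(\<Sum>b\<in>Basis - block f. coord b w *s b) \<in> V (Suc f)"
    proof (rule subspace_sum[OF U])
      fix b assume b: "b \<in> Basis - block f"
      show "coord b w *s b \<in> V (Suc f)"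
      proof (cases "coord b w = 0")
        case True
        then show ?thesis using subspace_0[OF U] by simp
      next
        case False
        have "b \<in> V f" using b by (intro invariant_coord[OF W V_invariant[OF le(2)] w _ False]) simp
        then have "b \<in> V (Suc f)" using b by (simp add: block)
        then show ?thesis by (rule subspace_scale[OF U])
      qed
    qed
    ultimately show "w - (\<Sum>b\<in>block f. coord b w *s b) \<in> V (Suc f)" by (simp only:)
  qed
qed

end

section \<open>The structure theorem\<close>

theorem theorem3p20:
  fixes scale :: "'k::{alg_closed_field, field_char_0} \<Rightarrow> 'v::ab_group_add \<Rightarrow> 'v"
    and B :: "'v set"
    and \<gg> \<rr> \<hh> :: "('v \<Rightarrow> 'v) set"
    and m :: nat
    and V :: "nat \<Rightarrow> 'v set"
    and n :: "nat \<Rightarrow> nat"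
    and F :: "nat set"
  assumes "finite_dimensional_vector_space scale B"
    and "lie_subalgebra \<gg> (lie_gl scale)"
    and "lie_radical \<rr> ((lie_gl scale)\<lparr>carrier := \<gg>\<rparr>)"
    and "cartan_subalgebra \<hh> (lie_sl scale B)"
    and "\<hh> \<subseteq> \<gg>"
    and "composition_series \<gg> (\<lambda>x. x) (vector_space_record scale) m V"
    and "\<And>i. i < m \<Longrightarrow> n i = vectorspace.dim class_ring (subquotient (vector_space_record scale) V i)"
    and "F = {f. f < m \<and> n f \<ge> 2}"
  shows "\<exists>\<theta>. lie_derivation_action (lie_direct_sum F (\<lambda>f. lie_sl_mat (n f)))
                ((lie_gl scale)\<lparr>carrier := \<rr>\<rparr>) \<theta> \<and>
             lie_isomorphic ((lie_gl scale)\<lparr>carrier := \<gg>\<rparr>)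
               (lie_semidirect ((lie_gl scale)\<lparr>carrier := \<rr>\<rparr>)
                  (lie_direct_sum F (\<lambda>f. lie_sl_mat (n f))) \<theta>)"
proof -
  interpret B: closed_field_space scale B
    by (rule closed_field_space.intro[OF assms(1)])
  obtain S where S: "finite_dimensional_vector_space scale S"
    and torus: "\<forall>x c. Vector_Spaces.linear scale scale x \<longrightarrow> (\<forall>b\<in>S. x b = scale (c b) b) \<longrightarrow>
      (\<Sum>b\<in>S. c b) = 0 \<longrightarrow> x \<in> \<hh>"
    by (rule B.cartan_subalgebra_diagonal[OF assms(4)])
  interpret S: closed_field_space scale S
    by (rule closed_field_space.intro[OF S])
  have sub: "VectorSpace.subspace class_ring \<gg> (lie_gl scale)"
    and comm: "\<And>x y. x \<in> \<gg> \<Longrightarrow> y \<in> \<gg> \<Longrightarrow> commutator x y \<in> \<gg>"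
    using assms(2) by (simp_all add: lie_subalgebra_def)
  interpret G: torus_algebra scale S \<gg>
  proof (intro torus_algebra.intro S.closed_field_space_axioms torus_algebra_axioms.intro)
    show "S.op_space \<gg>"
      by (rule S.subspace_op_space[of _ "{x. Vector_Spaces.linear scale scale x}"])
        (simp_all add: S.op_algebra_endo sub)
    show "commutator x y \<in> \<gg>" if "x \<in> \<gg>" "y \<in> \<gg>" for x y by (rule comm[OF that])
    show "x \<in> \<gg>" if "Vector_Spaces.linear scale scale x" "\<And>b. b \<in> S \<Longrightarrow> x b = scale (c b) b"
      "(\<Sum>b\<in>S. c b) = 0" for x c
      using torus that subsetD[OF assms(5), of x] by blast
  qed
  interpret G: composition_torus_algebra scale S \<gg> V m
    by (intro composition_torus_algebra.intro G.torus_algebra_axioms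
        composition_torus_algebra_axioms.intro assms(6))
  have rad: "\<rr> = G.rad"
    by (rule G.lie_radical_eq_rad[OF assms(3)])
  have n: "n f = card (G.block f)" if "f < m" for f
    using assms(7)[OF that] G.dim_subquotient[OF that] by (rule trans)
  show ?thesis
    unfolding rad by (rule G.semidirect_decomposition[OF n assms(8)])
qed

end
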